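(* Let $(M,g)$ be a Riemannian manifold of dimension $n$, let $p\in\mathbb{R}$, $q\geqslant 0$, and let $h_{p,q}$ be the generalised Cheeger-Gromoll metric on $TM$. A vector field $\sigma:(M,g)\to(TM,h_{p,q})$ is a harmonic map if and only if $$\sum_{i=1}^n R(\sigma,\nabla_{e_i}\sigma)e_i=0$$ and $$\nabla^*\nabla\sigma+2p\,\omega(\sigma)\nabla_{X(\sigma)}\sigma=\Big[\tfrac{p\,\omega(\sigma)+q}{1+q|\sigma|^2}|\nabla\sigma|^2+\tfrac{pq\,\omega(\sigma)}{1+q|\sigma|^2}|X(\sigma)|^2\Big]\sigma ,$$ where $\{e_i\}_{i=1,\dots,n}$ is an orthonormal frame on $(M,g)$.
   Context: Let $\nabla$ be the Levi-Civita connection of $(M,g)$, $\pi:TM\to M$ the projection and $K:TTM\to TM$ the connection map of $\nabla$. For $e\in TM$ put $\omega(e)=(1+|e|^2)^{-1}$. The generalised Cheeger-Gromoll metric $h_{p,q}$ on $TM$ is, for $A,B\in T_eTM$, $$h_{p,q}(A,B)=g(d\pi(A),d\pi(B))+\omega^p(e)\big[g(KA,KB)+q\,g(KA,e)g(KB,e)\big].$$ A smooth map $\sigma$ between Riemannian manifolds is harmonic if its tension field $\tau(\sigma)=\operatorname{trace}\nabla d\sigma$ vanishes. Notation: $R(X,Y)=[\nabla_X,\nabla_Y]-\nabla_{[X,Y]}$, $\nabla^*\nabla\sigma=-\operatorname{trace}(\nabla^2\sigma)$, $X(\sigma)=\nabla\big(\tfrac{|\sigma|^2}{2}\big)$ is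 the gradient of $|\sigma|^2/2$, and $|\nabla\sigma|^2=\sum_i|\nabla_{e_i}\sigma|^2$. *)

theory Defs
  imports "HOL-Analysis.Analysis" "HOL-Library.Function_Algebras"
begin

text \<open>Tangent vectors are families of chart components, with pointwise operations.\<close>

instantiation "fun" :: (type, real_vector) real_vector
begin

definition scaleR_fun :: "real \<Rightarrow> ('a \<Rightarrow> 'b) \<Rightarrow> 'a \<Rightarrow> 'b" where
  "scaleR_fun r f = (\<lambda>x. r *\<^sub>R f x)"

instance
  by standard (auto simp: scaleR_fun_def fun_eq_iff scaleR_add_right scaleR_add_left)

end


subsection \<open>Smooth manifolds\<close>

primrec Ck_on :: "nat \<Rightarrow> ('a::real_normed_vector \<Rightarrow> 'b::real_normed_vector) \<Rightarrow> 'a set \<Rightarrow> bool" where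
  "Ck_on 0 f S \<longleftrightarrow> continuous_on S f"
| "Ck_on (Suc k) f S \<longleftrightarrow>
     (\<forall>x\<in>S. f differentiable (at x)) \<and> (\<forall>v. Ck_on k (\<lambda>x. frechet_derivative f (at x) v) S)"

text \<open>Only used for open \<open>S\<close> in a Euclidean space.\<close>

definition smooth_on :: "('a::real_normed_vector \<Rightarrow> 'b::real_normed_vector) \<Rightarrow> 'a set \<Rightarrow> bool" where
  "smooth_on f S \<longleftrightarrow> (\<forall>k. Ck_on k f S)"

text \<open>
  A chart is a domain together with a coordinate map into the model space, which is relevant on
  the domain only. A manifold is given by an atlas \<open>A\<close> (not required to be maximal): its points
  are those covered by the charts, and its topology is the one making the charts homeomorphisms.
\<close>

type_synonym ('m, 'a) chart = "'m set \<times> ('m \<Rightarrow> 'a)"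

abbreviation cdom :: "('m, 'a) chart \<Rightarrow> 'm set" where "cdom \<equiv> fst"
abbreviation cmap :: "('m, 'a) chart \<Rightarrow> 'm \<Rightarrow> 'a" where "cmap \<equiv> snd"

definition cinv :: "('m, 'a) chart \<Rightarrow> 'a \<Rightarrow> 'm" where
  "cinv c = inv_into (cdom c) (cmap c)"

definition points :: "('m, 'a) chart set \<Rightarrow> 'm set" where
  "points A = (\<Union>c\<in>A. cdom c)"

definition charts_at :: "('m, 'a) chart set \<Rightarrow> 'm \<Rightarrow> ('m, 'a) chart set" where
  "charts_at A x = {c \<in> A. x \<in> cdom c}"

definition smooth_atlas :: "('m, 'a::euclidean_space) chart set \<Rightarrow> bool" where
  "smooth_atlas A \<longleftrightarrow>
     (\<forall>c\<in>A. inj_on (cmap c) (cdom c)) \<and>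
     (\<forall>c\<in>A. \<forall>d\<in>A. open (cmap c ` (cdom c \<inter> cdom d)) \<and>
        smooth_on (cmap d \<circ> cinv c) (cmap c ` (cdom c \<inter> cdom d)))"

definition manifold_topology :: "('m, 'a::euclidean_space) chart set \<Rightarrow> 'm topology" where
  "manifold_topology A =
     topology (\<lambda>W. W \<subseteq> points A \<and> (\<forall>c\<in>A. open (cmap c ` (cdom c \<inter> W))))"

definition smooth_manifold :: "('m, 'a::euclidean_space) chart set \<Rightarrow> bool" where
  "smooth_manifold A \<longleftrightarrow> smooth_atlas A \<and>
     Hausdorff_space (manifold_topology A) \<and> second_countable (manifold_topology A)"

definition smooth_map ::
    "('m, 'a::euclidean_space) chart set \<Rightarrow> ('k, 'b::euclidean_space) chart set \<Rightarrow> ('m \<Rightarrow> 'k) \<Rightarrow> bool" where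
  "smooth_map A B f \<longleftrightarrow> f \<in> points A \<rightarrow> points B \<and>
     (\<forall>c\<in>A. \<forall>d\<in>B. open (cmap c ` (cdom c \<inter> f -` cdom d)) \<and>
        smooth_on (cmap d \<circ> f \<circ> cinv c) (cmap c ` (cdom c \<inter> f -` cdom d)))"


subsection \<open>Tangent spaces and the tangent bundle\<close>

text \<open>
  A tangent vector at \<open>x\<close> is the family of its components in the charts around \<open>x\<close>, related to
  each other by the derivatives of the coordinate changes. Components in the remaining charts
  are set to 0, so that equality of tangent vectors is equality of functions.
\<close>

type_synonym ('m, 'a) tvec = "('m, 'a) chart \<Rightarrow> 'a"

definition tangent_space :: "('m, 'a::euclidean_space) chart set \<Rightarrow> 'm \<Rightarrow> ('m, 'a) tvec set" where
  "tangent_space A x = {v. (\<forall>c. c \<notin> charts_at A x \<longrightarrow> v c = 0) \<and>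
     (\<forall>c\<in>charts_at A x. \<forall>d\<in>charts_at A x.
        v d = frechet_derivative (cmap d \<circ> cinv c) (at (cmap c x)) (v c))}"

text \<open>The tangent vector at \<open>x\<close> with component \<open>u\<close> in the chart \<open>c\<close>.\<close>

definition coord_vec ::
    "('m, 'a::euclidean_space) chart set \<Rightarrow> ('m, 'a) chart \<Rightarrow> 'm \<Rightarrow> 'a \<Rightarrow> ('m, 'a) tvec" where
  "coord_vec A c x u =
     (\<lambda>d. if d \<in> charts_at A x then frechet_derivative (cmap d \<circ> cinv c) (at (cmap c x)) u else 0)"

lemma smooth_on_has_derivative:
  assumes "smooth_on f S" "x \<in> S"
  shows "(f has_derivative frechet_derivative f (at x)) (at x)"
proof -
  have "Ck_on (Suc 0) f S" using assms(1) unfolding smooth_on_def by blast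
  then have "f differentiable (at x)" using assms(2) by simp
  then show ?thesis by (simp only: frechet_derivative_works)
qed

lemma chart_change_derivative:
  assumes "smooth_atlas A" "c \<in> charts_at A x" "d \<in> charts_at A x"
  shows "((cmap d \<circ> cinv c) has_derivative frechet_derivative (cmap d \<circ> cinv c) (at (cmap c x)))
    (at (cmap c x))"
  by (rule smooth_on_has_derivative[of _ "cmap c ` (cdom c \<inter> cdom d)"])
    (use assms in \<open>auto simp: smooth_atlas_def charts_at_def\<close>)

lemma cinv_cmap:
  assumes "smooth_atlas A" "c \<in> charts_at A x"
  shows "cinv c (cmap c x) = x"
  using assms by (auto simp: smooth_atlas_def charts_at_def cinv_def)

lemma chart_change_cocycle:
  assumes A: "smooth_atlas A" and c: "c \<in> charts_at A x" "d \<in> charts_at A x" "e \<in> charts_at A x"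
  shows "frechet_derivative (cmap e \<circ> cinv d) (at (cmap d x))
      (frechet_derivative (cmap d \<circ> cinv c) (at (cmap c x)) u) =
    frechet_derivative (cmap e \<circ> cinv c) (at (cmap c x)) u"
proof -
  let ?S = "cmap c ` (cdom c \<inter> cdom d)"
  have "((cmap e \<circ> cinv d) \<circ> (cmap d \<circ> cinv c) has_derivative
      frechet_derivative (cmap e \<circ> cinv d) (at (cmap d x)) \<circ>
      frechet_derivative (cmap d \<circ> cinv c) (at (cmap c x))) (at (cmap c x))"
    using chart_change_derivative[OF A c(1,2)] chart_change_derivative[OF A c(2,3)]
    by (intro diff_chain_at) (auto simp: cinv_cmap[OF A c(1)])
  then have "(cmap e \<circ> cinv c has_derivative
      frechet_derivative (cmap e \<circ> cinv d) (at (cmap d x)) \<circ>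
      frechet_derivative (cmap d \<circ> cinv c) (at (cmap c x))) (at (cmap c x))"
  proof (rule has_derivative_transform_within_open[where s = ?S])
    show "open ?S" "cmap c x \<in> ?S"
      using A c by (auto simp: smooth_atlas_def charts_at_def)
    fix y assume "y \<in> ?S"
    then obtain z where z: "z \<in> cdom c" "z \<in> cdom d" "y = cmap c z" by auto
    then have "c \<in> charts_at A z" "d \<in> charts_at A z" using c by (auto simp: charts_at_def)
    then show "((cmap e \<circ> cinv d) \<circ> (cmap d \<circ> cinv c)) y = (cmap e \<circ> cinv c) y"
      using z by (simp add: cinv_cmap[OF A])
  qed
  from frechet_derivative_at[OF this] show ?thesis by (metis comp_apply)
qed

lemma chart_change_self:
  assumes A: "smooth_atlas A" and c: "c \<in> charts_at A x"
  shows "frechet_derivative (cmap c \<circ> cinv c) (at (cmap c x)) u = u"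
proof -
  have "(cmap c \<circ> cinv c has_derivative (\<lambda>u. u)) (at (cmap c x))"
  proof (rule has_derivative_transform_within_open[where s = "cmap c ` cdom c", OF has_derivative_ident])
    show "open (cmap c ` cdom c)" "cmap c x \<in> cmap c ` cdom c"
      using A c by (force simp: smooth_atlas_def charts_at_def)+
    fix y assume "y \<in> cmap c ` cdom c"
    then show "y = (cmap c \<circ> cinv c) y" by (auto simp: cinv_def f_inv_into_f)
  qed
  from frechet_derivative_at[OF this] show ?thesis by metis
qed

lemma coord_vec_tangent:
  assumes "smooth_atlas A" "c \<in> charts_at A x"
  shows "coord_vec A c x u \<in> tangent_space A x" "coord_vec A c x u c = u"
  using assms by (auto simp: coord_vec_def tangent_space_def chart_change_cocycle chart_change_self)

lemma coord_vec_linear: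
  assumes "smooth_atlas A" "c \<in> charts_at A x"
  shows "coord_vec A c x (a *\<^sub>R u + b *\<^sub>R v) = a *\<^sub>R coord_vec A c x u + b *\<^sub>R coord_vec A c x v"
proof
  fix d
  show "coord_vec A c x (a *\<^sub>R u + b *\<^sub>R v) d = (a *\<^sub>R coord_vec A c x u + b *\<^sub>R coord_vec A c x v) d"
  proof (cases "d \<in> charts_at A x")
    case True
    have "linear (frechet_derivative (cmap d \<circ> cinv c) (at (cmap c x)))"
      using chart_change_derivative[OF assms True] by (rule has_derivative_linear)
    then show ?thesis using True by (simp add: coord_vec_def scaleR_fun_def linear_add linear_scale)
  qed (simp add: coord_vec_def scaleR_fun_def)
qed

lemma tangent_eq_coord_vec:
  assumes "c \<in> charts_at A x" "v \<in> tangent_space A x"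
  shows "coord_vec A c x (v c) = v"
proof
  fix d
  have "d \<in> charts_at A x \<Longrightarrow> v d = frechet_derivative (cmap d \<circ> cinv c) (at (cmap c x)) (v c)"
    "d \<notin> charts_at A x \<Longrightarrow> v d = 0"
    using assms unfolding tangent_space_def by blast+
  then show "coord_vec A c x (v c) d = v d" by (simp add: coord_vec_def)
qed

definition tangent_chart ::
    "('m, 'a::euclidean_space) chart set \<Rightarrow> ('m, 'a) chart \<Rightarrow> ('m \<times> ('m, 'a) tvec, 'a \<times> 'a) chart" where
  "tangent_chart A c =
     ({(x, v). x \<in> cdom c \<and> v \<in> tangent_space A x}, \<lambda>(x, v). (cmap c x, v c))"

definition tangent_bundle ::
    "('m, 'a::euclidean_space) chart set \<Rightarrow> ('m \<times> ('m, 'a) tvec, 'a \<times> 'a) chart set" where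
  "tangent_bundle A = tangent_chart A ` A"

text \<open>
  The derivative of a vector-valued function \<open>F\<close>, defined near \<open>x\<close>, along the tangent vector \<open>u\<close>.
  It is computed in one chart; the value does not depend on which.
\<close>

definition dir_deriv ::
    "('m, 'a::euclidean_space) chart set \<Rightarrow> ('m \<Rightarrow> 'w::real_normed_vector) \<Rightarrow> 'm \<Rightarrow> ('m, 'a) tvec \<Rightarrow> 'w" where
  "dir_deriv A F x u =
     (let c = (SOME c. c \<in> charts_at A x) in frechet_derivative (F \<circ> cinv c) (at (cmap c x)) (u c))"

definition differential ::
    "('m, 'a::euclidean_space) chart set \<Rightarrow> ('k, 'b::euclidean_space) chart set \<Rightarrow> ('m \<Rightarrow> 'k) \<Rightarrow>
     'm \<Rightarrow> ('m, 'a) tvec \<Rightarrow> ('k, 'b) tvec" where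
  "differential A B f x u =
     (\<lambda>d. if d \<in> charts_at B (f x) then dir_deriv A (\<lambda>y. cmap d (f y)) x u else 0)"

text \<open>Smooth vector fields on an open subset \<open>W\<close> of the manifold.\<close>

definition smooth_field ::
    "('m, 'a::euclidean_space) chart set \<Rightarrow> 'm set \<Rightarrow> ('m \<Rightarrow> ('m, 'a) tvec) \<Rightarrow> bool" where
  "smooth_field A W X \<longleftrightarrow> (\<forall>x\<in>W. X x \<in> tangent_space A x) \<and>
     (\<forall>c\<in>A. smooth_on (\<lambda>y. X (cinv c y) c) (cmap c ` (cdom c \<inter> W)))"

definition lie_bracket ::
    "('m, 'a::euclidean_space) chart set \<Rightarrow> ('m \<Rightarrow> ('m, 'a) tvec) \<Rightarrow> ('m \<Rightarrow> ('m, 'a) tvec) \<Rightarrow>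
     'm \<Rightarrow> ('m, 'a) tvec" where
  "lie_bracket A X Y x =
     (\<lambda>d. if d \<in> charts_at A x
          then dir_deriv A (\<lambda>y. Y y d) x (X x) - dir_deriv A (\<lambda>y. X y d) x (Y x) else 0)"


subsection \<open>Riemannian metrics and the Levi-Civita connection\<close>

type_synonym ('m, 'a) metric = "'m \<Rightarrow> ('m, 'a) tvec \<Rightarrow> ('m, 'a) tvec \<Rightarrow> real"

text \<open>The components of \<open>g\<close> in the chart \<open>c\<close>, as a function of the coordinates \<open>y\<close>.\<close>

definition metric_comp ::
    "('m, 'a::euclidean_space) chart set \<Rightarrow> ('m, 'a) metric \<Rightarrow> ('m, 'a) chart \<Rightarrow> 'a \<Rightarrow> 'a \<Rightarrow> 'a \<Rightarrow> real" where
  "metric_comp A g c y u v =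
     g (cinv c y) (coord_vec A c (cinv c y) u) (coord_vec A c (cinv c y) v)"

definition riemannian_metric :: "('m, 'a::euclidean_space) chart set \<Rightarrow> ('m, 'a) metric \<Rightarrow> bool" where
  "riemannian_metric A g \<longleftrightarrow>
     (\<forall>x\<in>points A. \<forall>u\<in>tangent_space A x. \<forall>v\<in>tangent_space A x.
        g x u v = g x v u \<and> (u \<noteq> 0 \<longrightarrow> g x u u > 0) \<and>
        (\<forall>w\<in>tangent_space A x. \<forall>a b. g x (a *\<^sub>R u + b *\<^sub>R v) w = a * g x u w + b * g x v w)) \<and>
     (\<forall>c\<in>A. \<forall>u v. smooth_on (\<lambda>y. metric_comp A g c y u v) (cmap c ` cdom c))"

definition riemannian_manifold :: "('m, 'a::euclidean_space) chart set \<Rightarrow> ('m, 'a) metric \<Rightarrow> bool" where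
  "riemannian_manifold A g \<longleftrightarrow> smooth_manifold A \<and> riemannian_metric A g"

text \<open>
  In a chart a connection is \<open>\<nabla>\<^sub>u V = DV u + \<Gamma> u V\<close> with \<open>\<Gamma>\<close> bilinear at each point.
  It is torsion-free iff \<open>\<Gamma>\<close> is symmetric, and the last conjunct is
  compatibility with the metric, stated for coordinate vector fields. By \<open>levi_civita_ex1\<close>
  these conditions determine \<open>\<Gamma>\<close>, and by \<open>nabla_torsion_free\<close> the resulting \<open>\<nabla>\<close> is torsion-free.
\<close>

definition is_levi_civita_at ::
    "('m, 'a::euclidean_space) chart set \<Rightarrow> ('m, 'a) metric \<Rightarrow> ('m, 'a) chart \<Rightarrow> 'a \<Rightarrow>
     ('a \<Rightarrow> 'a \<Rightarrow> 'a) \<Rightarrow> bool" where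
  "is_levi_civita_at A g c y \<Gamma> \<longleftrightarrow> bilinear \<Gamma> \<and> (\<forall>u v. \<Gamma> u v = \<Gamma> v u) \<and>
     (\<forall>u v w. frechet_derivative (\<lambda>z. metric_comp A g c z u v) (at y) w =
        metric_comp A g c y (\<Gamma> w u) v + metric_comp A g c y u (\<Gamma> w v))"

lemma metric_comp_inner_product:
  assumes M: "riemannian_manifold A g" and c: "c \<in> A" and y: "y \<in> cmap c ` cdom c"
  shows "metric_comp A g c y u v = metric_comp A g c y v u"
    and "metric_comp A g c y (a *\<^sub>R u + b *\<^sub>R v) w = a * metric_comp A g c y u w + b * metric_comp A g c y v w"
    and "u \<noteq> 0 \<Longrightarrow> metric_comp A g c y u u > 0"
proof -
  from y obtain x where x: "x \<in> cdom c" "y = cmap c x" by auto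
  have A: "smooth_atlas A" using M by (simp add: riemannian_manifold_def smooth_manifold_def)
  have cx: "c \<in> charts_at A x" using c x by (simp add: charts_at_def)
  have inv: "cinv c y = x" using cinv_cmap[OF A cx] x by simp
  have xp: "x \<in> points A" using c x by (auto simp: points_def)
  have g: "g x u v = g x v u \<and> (u \<noteq> 0 \<longrightarrow> g x u u > 0) \<and>
        (\<forall>w\<in>tangent_space A x. \<forall>a b. g x (a *\<^sub>R u + b *\<^sub>R v) w = a * g x u w + b * g x v w)"
    if "u \<in> tangent_space A x" "v \<in> tangent_space A x" for u v
    using M xp that by (simp add: riemannian_manifold_def riemannian_metric_def)
  note T = coord_vec_tangent[OF A cx]
  show "metric_comp A g c y u v = metric_comp A g c y v u"
    using g[OF T(1) T(1)] by (simp add: metric_comp_def inv)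
  show "metric_comp A g c y (a *\<^sub>R u + b *\<^sub>R v) w = a * metric_comp A g c y u w + b * metric_comp A g c y v w"
    using g[OF T(1) T(1)] T(1) by (simp add: metric_comp_def inv coord_vec_linear[OF A cx])
  assume "u \<noteq> 0"
  then have "coord_vec A c x u \<noteq> 0" using T(2)[of u] by (metis zero_fun_apply)
  then show "metric_comp A g c y u u > 0"
    using g[OF T(1) T(1)] by (simp add: metric_comp_def inv)
qed

lemma levi_civita_ex1:
  fixes A :: "('m, 'a::euclidean_space) chart set"
  assumes M: "riemannian_manifold A g" and c: "c \<in> A" and y: "y \<in> cmap c ` cdom c"
  shows "\<exists>!\<Gamma>. is_levi_civita_at A g c y \<Gamma>"
proof -
  let ?S = "cmap c ` cdom c"
  define m where "m = metric_comp A g c"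
  define D where "D w u v = frechet_derivative (\<lambda>z. m z u v) (at y) w" for w u v
  note ip = metric_comp_inner_product[OF M c, folded m_def]
  have S: "open ?S" using M c by (force simp: riemannian_manifold_def smooth_manifold_def smooth_atlas_def)
  have lin1: "m z (a *\<^sub>R u + b *\<^sub>R v) w = a * m z u w + b * m z v w" if "z \<in> ?S" for z a b u v w
    using ip(2)[OF that] .
  have sym: "m z u v = m z v u" if "z \<in> ?S" for z u v using ip(1)[OF that] .
  have add: "m z (u + v) w = m z u w + m z v w" and scale: "m z (a *\<^sub>R u) w = a * m z u w"
    and addr: "m z w (u + v) = m z w u + m z w v" and scaler: "m z w (a *\<^sub>R u) = a * m z w u"
    if "z \<in> ?S" for z a u v w
    using lin1[OF that, of 1 u 1 v w] lin1[OF that, of a u 0 v w]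
    by (simp_all add: sym[OF that, of w])
  have diff: "((\<lambda>z. m z u v) has_derivative (\<lambda>w. D w u v)) (at y)" for u v
    unfolding D_def m_def using M c y
    by (intro smooth_on_has_derivative[of _ ?S])
      (auto simp: riemannian_manifold_def riemannian_metric_def eta_contract_eq)
  have Deq: "D w u v = f w" if "(F has_derivative f) (at y)" "\<And>z. z \<in> ?S \<Longrightarrow> F z = m z u v" for F f u v w
    using has_derivative_unique[OF diff has_derivative_transform_within_open[OF that(1) S y that(2)]]
    by (metis)
  have D1: "linear (\<lambda>w. D w u v)" for u v by (rule has_derivative_linear[OF diff])
  have D2: "linear (\<lambda>u. D w u v)" for w v
    by (rule linearI; rule Deq)
      (auto intro!: derivative_eq_intros diff simp: add scale)
  have Dsym: "D w u v = D w v u" for u v w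
    by (rule Deq[OF diff]) (simp add: sym)
  have D3: "linear (\<lambda>v. D w u v)" for w u using D2[of w u] by (simp add: Dsym[of _ u])
  have riesz: "\<exists>u. \<forall>z. m y u z = L z" if L: "linear L" for L
  proof -
    define T where "T u = (\<Sum>b\<in>Basis. m y u b *\<^sub>R b)" for u
    have T: "linear T"
      by (rule linearI) (simp_all add: T_def add[OF y] scale[OF y] scaleR_left_distrib sum.distrib scaleR_right.sum)
    have Tin: "T u \<bullet> b = m y u b" if "b \<in> Basis" for u b
      using that by (simp add: T_def inner_sum_left inner_Basis if_distrib sum.If_cases cong: if_cong)
    have lin: "linear (m y u)" for u by (rule linearI) (simp_all add: addr[OF y] scaler[OF y])
    have eq: "m y u = L'" if "linear L'" "\<And>b. b \<in> Basis \<Longrightarrow> m y u b = L' b" for u L'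
      using linear_eq_stdbasis[OF lin that(1)] that(2) by blast
    have "inj T"
    proof (subst linear_injective_0[OF T], intro allI impI)
      fix u assume "T u = 0"
      then have "m y u = (\<lambda>_. 0)" by (intro eq linear_zero) (use Tin[of _ u] in auto)
      then show "u = 0" using ip(3)[OF y, of u] by fastforce
    qed
    then have "surj T" by (simp add: linear_injective_imp_surjective[OF T])
    then obtain u where u: "T u = (\<Sum>b\<in>Basis. L b *\<^sub>R b)" by (metis surjD)
    have "m y u = L"
    proof (rule eq[OF L])
      fix b :: 'a assume b: "b \<in> Basis"
      then have "(\<Sum>b\<in>Basis. L b *\<^sub>R b) \<bullet> b = L b"
        by (simp add: inner_sum_left inner_Basis if_distrib sum.If_cases cong: if_cong)
      then show "m y u b = L b" using Tin[OF b, of u] u by metis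
    qed
    then show ?thesis by auto
  qed
  have nondeg: "u = v" if "\<And>z. m y u z = m y v z" for u v
  proof (rule ccontr)
    assume "u \<noteq> v"
    then have "m y (u - v) (u - v) > 0" using ip(3)[OF y] by simp
    then show False using lin1[OF y, of 1 u "-1" v "u - v"] that by simp
  qed
  define K where "K w u z = (D w u z + D u w z - D z w u) / 2" for w u z
  have Dlin: "D (a + b) u v = D a u v + D b u v" "D u (a + b) v = D u a v + D u b v"
    "D u v (a + b) = D u v a + D u v b" "D (r *\<^sub>R a) u v = r * D a u v"
    "D u (r *\<^sub>R a) v = r * D u a v" "D u v (r *\<^sub>R a) = r * D u v a" for a b u v r
    using linear_add[OF D1] linear_add[OF D2] linear_add[OF D3]
      linear_scale[OF D1] linear_scale[OF D2] linear_scale[OF D3] by simp_all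
  have K: "K w u (a + b) = K w u a + K w u b" "K w u (r *\<^sub>R a) = r * K w u a"
    "K (a + b) u w = K a u w + K b u w" "K (r *\<^sub>R a) u w = r * K a u w"
    "K u (a + b) w = K u a w + K u b w" "K u (r *\<^sub>R a) w = r * K u a w" for w u a b r
    unfolding K_def Dlin by (simp_all add: algebra_simps add_divide_distrib diff_divide_distrib)
  define \<Gamma> where "\<Gamma> w u = (SOME x. \<forall>z. m y x z = K w u z)" for w u
  have "\<forall>z. m y (\<Gamma> w u) z = K w u z" for w u
    unfolding \<Gamma>_def by (rule someI_ex, rule riesz, rule linearI) (simp_all add: K)
  then have \<Gamma>: "m y (\<Gamma> w u) z = K w u z" for w u z by blast
  have lc: "is_levi_civita_at A g c y G \<longleftrightarrow> bilinear G \<and> (\<forall>u v. G u v = G v u) \<and>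
     (\<forall>u v w. D w u v = m y (G w u) v + m y u (G w v))" for G
    by (simp add: is_levi_civita_at_def D_def m_def)
  show ?thesis
  proof (rule ex1I[of _ \<Gamma>])
    have "bilinear \<Gamma>"
      unfolding bilinear_def
      by (intro conjI allI linearI nondeg) (simp_all add: add[OF y] scale[OF y] \<Gamma> K)
    moreover have "\<Gamma> u v = \<Gamma> v u" for u v
    proof (rule nondeg)
      fix z show "m y (\<Gamma> u v) z = m y (\<Gamma> v u) z"
        using Dsym[of z u v] by (simp add: \<Gamma> K_def)
    qed
    moreover have "D w u v = m y (\<Gamma> w u) v + m y u (\<Gamma> w v)" for u v w
      unfolding sym[OF y, of u "\<Gamma> w v"] \<Gamma> K_def Dsym[of w v u] by (simp add: field_simps)
    ultimately show "is_levi_civita_at A g c y \<Gamma>" by (simp add: lc)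
  next
    fix G assume "is_levi_civita_at A g c y G"
    then have G: "G u v = G v u" "D w u v = m y (G w u) v + m y u (G w v)" for u v w by (auto simp: lc)
    have "m y (G w u) z = K w u z" for w u z
      unfolding K_def G(2)
      using sym[OF y, of u "G w z"] sym[OF y, of w "G u z"] sym[OF y, of w "G z u"]
        arg_cong[OF G(1)[of u w], of "\<lambda>a. m y a z"] arg_cong[OF G(1)[of z w], of "\<lambda>a. m y a u"]
        arg_cong[OF G(1)[of z u], of "\<lambda>a. m y a w"]
      by argo
    then show "G = \<Gamma>" by (intro ext nondeg) (simp add: \<Gamma>)
  qed
qed

definition christoffel ::
    "('m, 'a::euclidean_space) chart set \<Rightarrow> ('m, 'a) metric \<Rightarrow> ('m, 'a) chart \<Rightarrow> 'a \<Rightarrow> 'a \<Rightarrow> 'a \<Rightarrow> 'a" where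
  "christoffel A g c y = (THE \<Gamma>. is_levi_civita_at A g c y \<Gamma>)"

text \<open>
  The pull-back by \<open>f\<close> of the Levi-Civita connection of \<open>(B, h)\<close>: the covariant derivative,
  along \<open>u\<close> tangent to \<open>A\<close> at \<open>x\<close>, of a vector field \<open>V\<close> along \<open>f\<close> (so \<open>V y\<close> is tangent to \<open>B\<close> at \<open>f y\<close>).
\<close>

definition cov_deriv_along ::
    "('m, 'a::euclidean_space) chart set \<Rightarrow> ('k, 'b::euclidean_space) chart set \<Rightarrow> ('k, 'b) metric \<Rightarrow>
     ('m \<Rightarrow> 'k) \<Rightarrow> ('m \<Rightarrow> ('k, 'b) tvec) \<Rightarrow> 'm \<Rightarrow> ('m, 'a) tvec \<Rightarrow> ('k, 'b) tvec" where
  "cov_deriv_along A B h f V x u =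
     (\<lambda>d. if d \<in> charts_at B (f x)
          then dir_deriv A (\<lambda>y. V y d) x u +
               christoffel B h d (cmap d (f x)) (differential A B f x u d) (V x d)
          else 0)"

definition cov_deriv ::
    "('m, 'a::euclidean_space) chart set \<Rightarrow> ('m, 'a) metric \<Rightarrow> ('m \<Rightarrow> ('m, 'a) tvec) \<Rightarrow>
     'm \<Rightarrow> ('m, 'a) tvec \<Rightarrow> ('m, 'a) tvec" where
  "cov_deriv A g = cov_deriv_along A A g (\<lambda>x. x)"

definition nabla ::
    "('m, 'a::euclidean_space) chart set \<Rightarrow> ('m, 'a) metric \<Rightarrow> ('m \<Rightarrow> ('m, 'a) tvec) \<Rightarrow>
     ('m \<Rightarrow> ('m, 'a) tvec) \<Rightarrow> 'm \<Rightarrow> ('m, 'a) tvec" where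
  "nabla A g X Y = (\<lambda>x. cov_deriv A g Y x (X x))"

lemma chosen_chart:
  assumes "x \<in> points A"
  shows "(SOME c. c \<in> charts_at A x) \<in> charts_at A x"
proof -
  from assms obtain c where "c \<in> charts_at A x" by (auto simp: points_def charts_at_def)
  then show ?thesis by (rule someI)
qed


lemma component_differentiable:
  assumes A: "smooth_atlas A" and c: "c \<in> charts_at A x" "d \<in> charts_at A x"
    and \<sigma>: "smooth_field A (points A) \<sigma>"
  shows "((\<lambda>y. \<sigma> y d) \<circ> cinv c) differentiable (at (cmap c x))"
proof -
  let ?S = "cmap c ` (cdom c \<inter> cdom d)"
  have "cdom d \<inter> points A = cdom d" using c by (auto simp: points_def charts_at_def)
  moreover have "d \<in> A" using c by (simp add: charts_at_def)
  ultimately have "smooth_on (\<lambda>y. \<sigma> (cinv d y) d) (cmap d ` cdom d)"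
    using \<sigma> unfolding smooth_field_def by metis
  then have "((\<lambda>y. \<sigma> (cinv d y) d) has_derivative frechet_derivative (\<lambda>y. \<sigma> (cinv d y) d) (at (cmap d x)))
      (at (cmap d x))"
    by (rule smooth_on_has_derivative) (use c in \<open>auto simp: charts_at_def\<close>)
  then have "((\<lambda>y. \<sigma> (cinv d y) d) \<circ> (cmap d \<circ> cinv c) has_derivative
      frechet_derivative (\<lambda>y. \<sigma> (cinv d y) d) (at (cmap d x)) \<circ>
      frechet_derivative (cmap d \<circ> cinv c) (at (cmap c x))) (at (cmap c x))"
    using chart_change_derivative[OF A c]
    by (intro diff_chain_at) (auto simp: cinv_cmap[OF A c(1)])
  then have "((\<lambda>y. \<sigma> y d) \<circ> cinv c has_derivative
      frechet_derivative (\<lambda>y. \<sigma> (cinv d y) d) (at (cmap d x)) \<circ>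
      frechet_derivative (cmap d \<circ> cinv c) (at (cmap c x))) (at (cmap c x))"
  proof (rule has_derivative_transform_within_open[where s = ?S])
    show "open ?S" "cmap c x \<in> ?S"
      using A c by (auto simp: smooth_atlas_def charts_at_def)
    fix y assume "y \<in> ?S"
    then obtain z where z: "z \<in> cdom c" "z \<in> cdom d" "y = cmap c z" by auto
    then have "c \<in> charts_at A z" "d \<in> charts_at A z" using c by (auto simp: charts_at_def)
    then show "((\<lambda>y. \<sigma> (cinv d y) d) \<circ> (cmap d \<circ> cinv c)) y = ((\<lambda>y. \<sigma> y d) \<circ> cinv c) y"
      using z by (simp add: cinv_cmap[OF A])
  qed
  then show ?thesis by (rule differentiableI)
qed

lemma nabla_torsion_free:
  assumes M: "riemannian_manifold A g" and x: "x \<in> points A"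
    and X: "X x \<in> tangent_space A x" and Y: "Y x \<in> tangent_space A x"
  shows "nabla A g X Y x - nabla A g Y X x = lie_bracket A X Y x"
proof
  fix d
  show "(nabla A g X Y x - nabla A g Y X x) d = lie_bracket A X Y x d"
  proof (cases "d \<in> charts_at A x")
    case d: True
    have eq: "differential A A (\<lambda>x. x) x u d = u d" if "u \<in> tangent_space A x" for u
    proof -
      let ?c = "SOME c. c \<in> charts_at A x"
      have "u d = frechet_derivative (cmap d \<circ> cinv ?c) (at (cmap ?c x)) (u ?c)"
        using d that chosen_chart[OF x] unfolding tangent_space_def by blast
      then show ?thesis using d by (simp add: differential_def dir_deriv_def Let_def)
    qed
    have "\<exists>!\<Gamma>. is_levi_civita_at A g d (cmap d x) \<Gamma>"
      using d by (intro levi_civita_ex1[OF M]) (auto simp: charts_at_def)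
    from theI'[OF this, folded christoffel_def]
    have "christoffel A g d (cmap d x) u v = christoffel A g d (cmap d x) v u" for u v
      by (simp add: is_levi_civita_at_def)
    then show ?thesis
      using d by (simp add: nabla_def cov_deriv_def cov_deriv_along_def lie_bracket_def eq X Y)
  qed (simp add: nabla_def cov_deriv_def cov_deriv_along_def lie_bracket_def)
qed

definition curvature ::
    "('m, 'a::euclidean_space) chart set \<Rightarrow> ('m, 'a) metric \<Rightarrow> ('m \<Rightarrow> ('m, 'a) tvec) \<Rightarrow>
     ('m \<Rightarrow> ('m, 'a) tvec) \<Rightarrow> ('m \<Rightarrow> ('m, 'a) tvec) \<Rightarrow> 'm \<Rightarrow> ('m, 'a) tvec" where
  "curvature A g X Y Z = (\<lambda>x.
     nabla A g X (nabla A g Y Z) x - nabla A g Y (nabla A g X Z) x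
       - nabla A g (lie_bracket A X Y) Z x)"

definition gradient ::
    "('m, 'a::euclidean_space) chart set \<Rightarrow> ('m, 'a) metric \<Rightarrow> ('m \<Rightarrow> real) \<Rightarrow> 'm \<Rightarrow> ('m, 'a) tvec" where
  "gradient A g f x = (THE v. v \<in> tangent_space A x \<and>
     (\<forall>u\<in>tangent_space A x. g x v u = dir_deriv A f x u))"

definition orthonormal_basis ::
    "('m, 'a::euclidean_space) chart set \<Rightarrow> ('m, 'a) metric \<Rightarrow> 'm \<Rightarrow> (nat \<Rightarrow> ('m, 'a) tvec) \<Rightarrow> bool" where
  "orthonormal_basis A g x b \<longleftrightarrow>
     (\<forall>i\<in>{1..DIM('a)}. b i \<in> tangent_space A x) \<and>
     (\<forall>i\<in>{1..DIM('a)}. \<forall>j\<in>{1..DIM('a)}. g x (b i) (b j) = (if i = j then 1 else 0))"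

definition orthonormal_frame ::
    "('m, 'a::euclidean_space) chart set \<Rightarrow> ('m, 'a) metric \<Rightarrow> 'm set \<Rightarrow>
     (nat \<Rightarrow> 'm \<Rightarrow> ('m, 'a) tvec) \<Rightarrow> bool" where
  "orthonormal_frame A g W e \<longleftrightarrow> openin (manifold_topology A) W \<and>
     (\<forall>i\<in>{1..DIM('a)}. smooth_field A W (e i)) \<and>
     (\<forall>x\<in>W. orthonormal_basis A g x (\<lambda>i. e i x))"

text \<open>The trace of a bilinear map on the tangent space at \<open>x\<close>; it does not depend on the basis.\<close>

definition metric_trace ::
    "('m, 'a::euclidean_space) chart set \<Rightarrow> ('m, 'a) metric \<Rightarrow> 'm \<Rightarrow>
     (('m, 'a) tvec \<Rightarrow> ('m, 'a) tvec \<Rightarrow> 'w::real_vector) \<Rightarrow> 'w" where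
  "metric_trace A g x \<beta> =
     (let b = (SOME b. orthonormal_basis A g x b) in \<Sum>i = 1..DIM('a). \<beta> (b i) (b i))"

text \<open>
  A smooth vector field near \<open>x\<close> with value \<open>v\<close> at \<open>x\<close>: the one with constant components in a
  chart around \<open>x\<close>. It serves to evaluate the tensors below, which are defined through
  vector fields but depend on their values at \<open>x\<close> only.
\<close>

definition extend :: "('m, 'a::euclidean_space) chart set \<Rightarrow> 'm \<Rightarrow> ('m, 'a) tvec \<Rightarrow> 'm \<Rightarrow> ('m, 'a) tvec" where
  "extend A x v = (let c = (SOME c. c \<in> charts_at A x) in (\<lambda>y. coord_vec A c y (v c)))"

text \<open>\<open>\<nabla>\<^sup>2\<sigma>(u, v) = \<nabla>\<^sub>u \<nabla>\<^sub>V \<sigma> - \<nabla>\<^bsub>\<nabla>\<^sub>u V\<^esub> \<sigma>\<close>, where \<open>V\<close> is a vector field with value \<open>v\<close> at \<open>x\<close>.\<close>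

definition second_cov_deriv ::
    "('m, 'a::euclidean_space) chart set \<Rightarrow> ('m, 'a) metric \<Rightarrow> ('m \<Rightarrow> ('m, 'a) tvec) \<Rightarrow>
     'm \<Rightarrow> ('m, 'a) tvec \<Rightarrow> ('m, 'a) tvec \<Rightarrow> ('m, 'a) tvec" where
  "second_cov_deriv A g \<sigma> x u v =
     cov_deriv A g (nabla A g (extend A x v) \<sigma>) x u - cov_deriv A g \<sigma> x (cov_deriv A g (extend A x v) x u)"

definition rough_laplacian ::
    "('m, 'a::euclidean_space) chart set \<Rightarrow> ('m, 'a) metric \<Rightarrow> ('m \<Rightarrow> ('m, 'a) tvec) \<Rightarrow>
     'm \<Rightarrow> ('m, 'a) tvec" where
  "rough_laplacian A g \<sigma> x = - metric_trace A g x (second_cov_deriv A g \<sigma> x)"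

definition norm_sq_nabla ::
    "('m, 'a::euclidean_space) chart set \<Rightarrow> ('m, 'a) metric \<Rightarrow> ('m \<Rightarrow> ('m, 'a) tvec) \<Rightarrow> 'm \<Rightarrow> real" where
  "norm_sq_nabla A g \<sigma> x =
     metric_trace A g x (\<lambda>u v. g x (cov_deriv A g \<sigma> x u) (cov_deriv A g \<sigma> x v))"


subsection \<open>Harmonic maps\<close>

text \<open>\<open>\<nabla>df(u, v) = \<nabla>\<^sup>f\<^sub>u (df V) - df (\<nabla>\<^sub>u V)\<close>, where \<open>V\<close> is a vector field with value \<open>v\<close> at \<open>x\<close>
  and \<open>\<nabla>\<^sup>f\<close> is the pull-back connection.\<close>

definition nabla_differential ::
    "('m, 'a::euclidean_space) chart set \<Rightarrow> ('m, 'a) metric \<Rightarrow>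
     ('k, 'b::euclidean_space) chart set \<Rightarrow> ('k, 'b) metric \<Rightarrow> ('m \<Rightarrow> 'k) \<Rightarrow>
     'm \<Rightarrow> ('m, 'a) tvec \<Rightarrow> ('m, 'a) tvec \<Rightarrow> ('k, 'b) tvec" where
  "nabla_differential A g B h f x u v =
     cov_deriv_along A B h f (\<lambda>y. differential A B f y (extend A x v y)) x u
       - differential A B f x (cov_deriv A g (extend A x v) x u)"

definition tension_field ::
    "('m, 'a::euclidean_space) chart set \<Rightarrow> ('m, 'a) metric \<Rightarrow>
     ('k, 'b::euclidean_space) chart set \<Rightarrow> ('k, 'b) metric \<Rightarrow> ('m \<Rightarrow> 'k) \<Rightarrow>
     'm \<Rightarrow> ('k, 'b) tvec" where
  "tension_field A g B h f x = metric_trace A g x (nabla_differential A g B h f x)"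

definition harmonic_map ::
    "('m, 'a::euclidean_space) chart set \<Rightarrow> ('m, 'a) metric \<Rightarrow>
     ('k, 'b::euclidean_space) chart set \<Rightarrow> ('k, 'b) metric \<Rightarrow> ('m \<Rightarrow> 'k) \<Rightarrow> bool" where
  "harmonic_map A g B h f \<longleftrightarrow> smooth_map A B f \<and> (\<forall>x\<in>points A. tension_field A g B h f x = 0)"


subsection \<open>The generalised Cheeger-Gromoll metric\<close>

text \<open>
  The connection map \<open>K : TTM \<rightarrow> TM\<close>. In the charts induced by \<open>c\<close>, a tangent vector \<open>w\<close> of \<open>TM\<close> at
  \<open>(x, v)\<close> has components \<open>(a, b)\<close> and \<open>K w\<close> has component \<open>b + \<Gamma> a v\<close>. The
  lemma \<open>connection_map_differential\<close> is the characteristic property \<open>K (d\<sigma> u) = \<nabla>\<^sub>u \<sigma>\<close>.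
\<close>

definition connection_map ::
    "('m, 'a::euclidean_space) chart set \<Rightarrow> ('m, 'a) metric \<Rightarrow> 'm \<times> ('m, 'a) tvec \<Rightarrow>
     ('m \<times> ('m, 'a) tvec, 'a \<times> 'a) tvec \<Rightarrow> ('m, 'a) tvec" where
  "connection_map A g e w =
     (\<lambda>c. if c \<in> charts_at A (fst e)
          then snd (w (tangent_chart A c)) +
               christoffel A g c (cmap c (fst e)) (fst (w (tangent_chart A c))) (snd e c)
          else 0)"

lemma connection_map_differential:
  assumes A: "smooth_atlas A" and \<sigma>: "smooth_field A (points A) \<sigma>" and x: "x \<in> points A"
  shows "connection_map A g (x, \<sigma> x) (differential A (tangent_bundle A) (\<lambda>y. (y, \<sigma> y)) x u) =
    cov_deriv A g \<sigma> x u"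
proof
  fix d
  let ?w = "differential A (tangent_bundle A) (\<lambda>y. (y, \<sigma> y)) x u"
  show "connection_map A g (x, \<sigma> x) ?w d = cov_deriv A g \<sigma> x u d"
  proof (cases "d \<in> charts_at A x")
    case d: True
    define c where "c = (SOME c. c \<in> charts_at A x)"
    have c: "c \<in> charts_at A x" using chosen_chart[OF x] by (simp add: c_def)
    have "tangent_chart A d \<in> charts_at (tangent_bundle A) (x, \<sigma> x)"
      using d \<sigma> x by (auto simp: charts_at_def tangent_bundle_def tangent_chart_def smooth_field_def)
    then have "?w (tangent_chart A d) =
        frechet_derivative (\<lambda>y. ((cmap d \<circ> cinv c) y, ((\<lambda>y. \<sigma> y d) \<circ> cinv c) y)) (at (cmap c x)) (u c)"
      by (simp add: differential_def dir_deriv_def Let_def c_def[symmetric] tangent_chart_def comp_def)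
    also have "\<dots> = (frechet_derivative (cmap d \<circ> cinv c) (at (cmap c x)) (u c),
        frechet_derivative ((\<lambda>y. \<sigma> y d) \<circ> cinv c) (at (cmap c x)) (u c))"
      by (rule fun_cong[OF frechet_derivative_at, symmetric], rule has_derivative_Pair)
        (use chart_change_derivative[OF A c d] component_differentiable[OF A c d \<sigma>] in
          \<open>simp_all add: frechet_derivative_works comp_def\<close>)
    finally show ?thesis
      using d by (simp add: connection_map_def cov_deriv_def cov_deriv_along_def differential_def
        dir_deriv_def Let_def c_def[symmetric])
  qed (simp add: connection_map_def cov_deriv_def cov_deriv_along_def)
qed

definition omega :: "('m, 'a) metric \<Rightarrow> 'm \<Rightarrow> ('m, 'a) tvec \<Rightarrow> real" where
  "omega g x v = inverse (1 + g x v v)"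

definition cheeger_gromoll ::
    "('m, 'a::euclidean_space) chart set \<Rightarrow> ('m, 'a) metric \<Rightarrow> real \<Rightarrow> real \<Rightarrow>
     ('m \<times> ('m, 'a) tvec, 'a \<times> 'a) metric" where
  "cheeger_gromoll A g p q = (\<lambda>(x, v) w w'.
     let d\<pi> = differential (tangent_bundle A) A fst (x, v); K = connection_map A g (x, v)
     in g x (d\<pi> w) (d\<pi> w')
        + omega g x v powr p * (g x (K w) (K w') + q * g x (K w) v * g x (K w') v))"

definition grad_half_norm_sq ::
    "('m, 'a::euclidean_space) chart set \<Rightarrow> ('m, 'a) metric \<Rightarrow> ('m \<Rightarrow> ('m, 'a) tvec) \<Rightarrow>
     'm \<Rightarrow> ('m, 'a) tvec" where
  "grad_half_norm_sq A g \<sigma> = gradient A g (\<lambda>y. g y (\<sigma> y) (\<sigma> y) / 2)"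

end

theory Submission
  imports Defs
begin

text \<open>
  In the bundle chart over a chart of \<open>M\<close>, write \<open>K\<close>, \<open>L\<close> for the vertical parts of the tangent
  vectors \<open>(a, b)\<close>, \<open>(a', b')\<close> of \<open>TM\<close> at \<open>v\<close>, and \<open>\<omega> = (1 + |v|\<^sup>2)\<^sup>-\<^sup>1\<close>. The Levi-Civita connection
  of the generalised Cheeger-Gromoll metric differs from the derivative taken separately in the
  horizontal and in the vertical part by the horizontal term \<open>\<omega>\<^sup>p (R(v, L) a + R(v, K) a') / 2\<close> and
  by the vertical term \<open>N(K, L) - R(a, a') v / 2\<close>, where
  \<open>N(K, L) = - p \<omega> (\<langle>K, v\<rangle> L + \<langle>L, v\<rangle> K) + \<mu> v\<close> and
  \<open>\<mu> (1 + q |v|\<^sup>2) = (p \<omega> + q) \<langle>K, L\<rangle> + p q \<omega> \<langle>K, v\<rangle> \<langle>L, v\<rangle>\<close>.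
  The vertical part of \<open>d\<sigma>(e\<^sub>i)\<close> is \<open>\<nabla>\<^bsub>e\<^sub>i\<^esub>\<sigma>\<close>, so the horizontal part of the tension field
  is \<open>\<omega>\<^sup>p \<Sum>\<^sub>i R(\<sigma>, \<nabla>\<^bsub>e\<^sub>i\<^esub>\<sigma>) e\<^sub>i\<close> and its vertical part is
  \<open>- \<nabla>\<^sup>*\<nabla>\<sigma> + \<Sum>\<^sub>i N(\<nabla>\<^bsub>e\<^sub>i\<^esub>\<sigma>, \<nabla>\<^bsub>e\<^sub>i\<^esub>\<sigma>)\<close>; the curvature term drops out of the trace by
  antisymmetry. The connection is verified by its defining properties, so no manifold structure on
  \<open>TM\<close> beyond its charts is needed.
\<close>

subsection \<open>Calculus of smooth functions\<close>

text \<open>Much of the length comes from choice: \<open>dir_deriv\<close>,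
  \<open>metric_trace\<close>, \<open>extend\<close>, \<open>gradient\<close> and
  \<open>christoffel\<close> rest on a chosen chart, basis or extension, or on a definite
  description. Each is replaced by a formula valid in every chart, so that the theorem becomes an
  identity between components at a point. Pair symmetry of the Riemann tensor is what lets the
  horizontal curvature term and half the vertical one cancel in metric compatibility. It rests on
  the symmetry of second derivatives of the metric, hence the calculus of iterated derivatives
  below. Christoffel symbols are given only point by point, so their smoothness has to be proved
  before they can be differentiated. The two equations separate although the chart components of the
  tension field do not: the second component is the vertical part minus a Christoffel term in the
  horizontal part. This system is triangular, so vanishing can be read off one part after the
  other.\<close>

lemma frechet_derivative_eqI:
  assumes "(f has_derivative f') (at x)"
  shows "frechet_derivative f (at x) = f'"
  using frechet_derivative_at[OF assms] by simp

text \<open>The two functions have the same derivatives at \<open>x\<close>, and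
  \<open>frechet_derivative\<close> chooses among these, so the choices agree even where no
  derivative exists.\<close>

lemma frechet_derivative_cong_open:
  assumes "open S" "x \<in> S" "\<And>y. y \<in> S \<Longrightarrow> f y = g y"
  shows "frechet_derivative f (at x) = frechet_derivative g (at x)"
proof -
  have "(f has_derivative D) (at x) \<longleftrightarrow> (g has_derivative D) (at x)" for D
    by (rule iffI; erule has_derivative_transform_within_open[OF _ assms(1,2)]) (simp_all add: assms(3))
  then show ?thesis unfolding frechet_derivative_def by simp
qed

lemma differentiable_cong_open:
  assumes "open S" "x \<in> S" "\<And>y. y \<in> S \<Longrightarrow> f y = g y" "f differentiable (at x)"
  shows "g differentiable (at x)"
  using assms(4) has_derivative_transform_within_open[OF _ assms(1,2), of f _ UNIV g] assms(3)
  unfolding differentiable_def by (metis)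

lemma Ck_on_subset: "Ck_on k f S \<Longrightarrow> T \<subseteq> S \<Longrightarrow> Ck_on k f T"
  by (induction k arbitrary: f) (auto intro: continuous_on_subset)

lemma Ck_on_Suc_imp: "Ck_on (Suc k) f S \<Longrightarrow> Ck_on k f S"
proof (induction k arbitrary: f)
  case 0
  then show ?case
    by (auto intro!: continuous_at_imp_continuous_on differentiable_imp_continuous_within)
next
  case (Suc k)
  then show ?case by (metis Ck_on.simps(2))
qed

lemma Ck_on_cong:
  assumes "open S" "\<And>x. x \<in> S \<Longrightarrow> f x = g x"
  shows "Ck_on k f S = Ck_on k g S"
  using assms(2)
proof (induction k arbitrary: f g)
  case 0
  then show ?case by (simp cong: continuous_on_cong)
next
  case (Suc k)
  have 1: "(f differentiable (at x)) = (g differentiable (at x))" if "x \<in> S" for x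
    using differentiable_cong_open[OF assms(1) that] Suc.prems by metis
  have 2: "frechet_derivative f (at x) = frechet_derivative g (at x)" if "x \<in> S" for x
    using frechet_derivative_cong_open[OF assms(1) that] Suc.prems by metis
  have "Ck_on k (\<lambda>x. frechet_derivative f (at x) v) S = Ck_on k (\<lambda>x. frechet_derivative g (at x) v) S" for v
    by (rule Suc.IH) (simp add: 2)
  then show ?case using 1 by simp
qed

text \<open>Lets the usual derivative rules drive the closure proofs: an explicit derivative
  replaces the chosen one, with which it agrees on the open set.\<close>

lemma Ck_on_SucI:
  assumes "open S" "\<And>x. x \<in> S \<Longrightarrow> (f has_derivative f' x) (at x)" "\<And>v. Ck_on k (\<lambda>x. f' x v) S"
  shows "Ck_on (Suc k) f S"
proof -
  have "Ck_on k (\<lambda>x. frechet_derivative f (at x) v) S" for v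
    using Ck_on_cong[OF assms(1), of "\<lambda>x. frechet_derivative f (at x) v" "\<lambda>x. f' x v"] assms(2,3)
    by (metis frechet_derivative_eqI)
  moreover have "f differentiable (at x)" if "x \<in> S" for x
    using assms(2)[OF that] by (rule differentiableI)
  ultimately show ?thesis by simp
qed

lemma Ck_on_has_derivative:
  assumes "Ck_on (Suc k) f S" "x \<in> S"
  shows "(f has_derivative frechet_derivative f (at x)) (at x)"
  using assms by (simp flip: frechet_derivative_works)

lemma Ck_on_const: "open S \<Longrightarrow> Ck_on k (\<lambda>x. c) S"
  by (induction k arbitrary: c) (auto intro!: Ck_on_SucI[where f' = "\<lambda>x v. 0"] simp del: Ck_on.simps(2))

lemma Ck_on_bounded_linear:
  assumes "bounded_linear L" "open S" "Ck_on k f S"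
  shows "Ck_on k (\<lambda>x. L (f x)) S"
  using assms(3)
proof (induction k arbitrary: f)
  case 0
  then show ?case using assms(1) by (simp add: bounded_linear.continuous_on)
next
  case (Suc k)
  show ?case
    by (rule Ck_on_SucI[OF assms(2) bounded_linear.has_derivative[OF assms(1) Ck_on_has_derivative]])
      (use Suc in auto)
qed

lemma Ck_on_add:
  assumes "open S" "Ck_on k f S" "Ck_on k g S"
  shows "Ck_on k (\<lambda>x. f x + g x) S"
  using assms(2,3)
proof (induction k arbitrary: f g)
  case 0
  then show ?case by (simp add: continuous_on_add)
next
  case (Suc k)
  show ?case
    by (rule Ck_on_SucI[OF assms(1) has_derivative_add[OF Ck_on_has_derivative Ck_on_has_derivative]])
      (use Suc in auto)
qed

lemma Ck_on_bilinear:
  assumes "bounded_bilinear B" "open S" "Ck_on k f S" "Ck_on k g S"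
  shows "Ck_on k (\<lambda>x. B (f x) (g x)) S"
  using assms(3,4)
proof (induction k arbitrary: f g)
  case 0
  then show ?case using assms(1) by (simp add: bounded_bilinear.continuous_on)
next
  case (Suc k)
  \<comment> \<open>In the product rule one factor stays undifferentiated; its order is lowered to
    \<open>k\<close> to fit the induction hypothesis.\<close>
  note IH = Suc.IH[OF _ Ck_on_Suc_imp[OF Suc.prems(2)]] Suc.IH[OF Ck_on_Suc_imp[OF Suc.prems(1)]]
  show ?case
    by (rule Ck_on_SucI[OF assms(2) bounded_bilinear.FDERIV[OF assms(1) Ck_on_has_derivative Ck_on_has_derivative]])
      (use Suc.prems IH in \<open>auto intro!: Ck_on_add[OF assms(2)]\<close>)
qed

lemma Ck_on_sum:
  assumes "open S" "\<And>i. i \<in> I \<Longrightarrow> Ck_on k (f i) S"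
  shows "Ck_on k (\<lambda>x. \<Sum>i\<in>I. f i x) S"
  using assms(2)
  by (induction I rule: infinite_finite_induct) (auto intro!: Ck_on_const Ck_on_add assms(1))

lemma linear_eq_sum_Basis:
  fixes L :: "'a::euclidean_space \<Rightarrow> 'b::real_vector"
  assumes "linear L"
  shows "L u = (\<Sum>b\<in>Basis. (u \<bullet> b) *\<^sub>R L b)"
proof -
  have "L (\<Sum>b\<in>Basis. (u \<bullet> b) *\<^sub>R b) = (\<Sum>b\<in>Basis. (u \<bullet> b) *\<^sub>R L b)"
    using assms by (simp add: linear_sum linear_scale)
  then show ?thesis by (simp add: euclidean_representation)
qed

lemma Ck_on_compose:
  fixes g :: "'c::real_normed_vector \<Rightarrow> 'a::euclidean_space" and f :: "'a \<Rightarrow> 'b::real_normed_vector"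
  assumes "open S" "open T" "g ` S \<subseteq> T" "Ck_on k f T" "Ck_on k g S"
  shows "Ck_on k (\<lambda>x. f (g x)) S"
  using assms(4,5)
proof (induction k arbitrary: f)
  case 0
  then show ?case using continuous_on_compose2[of T f S g] assms(3) by simp
next
  case (Suc k)
  have lin: "linear (frechet_derivative f (at (g x)))" if "x \<in> S" for x
    using Ck_on_has_derivative[OF Suc.prems(1)] that assms(3)
    by (auto intro!: has_derivative_linear)
  show ?case
  proof (rule Ck_on_SucI[OF assms(1)])
    fix x assume x: "x \<in> S"
    show "((\<lambda>x. f (g x)) has_derivative (\<lambda>v. frechet_derivative f (at (g x)) (frechet_derivative g (at x) v))) (at x)"
      using has_derivative_compose[OF Ck_on_has_derivative[OF Suc.prems(2) x] Ck_on_has_derivative[OF Suc.prems(1)]]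
        x assms(3) by auto
  next
    fix v
    \<comment> \<open>\<open>Ck_on\<close> controls derivatives along fixed vectors only, so the
      moving direction is expanded in the basis.\<close>
    have "Ck_on k (\<lambda>x. \<Sum>b\<in>Basis. (frechet_derivative g (at x) v \<bullet> b) *\<^sub>R frechet_derivative f (at (g x)) b) S"
      using Suc.prems Ck_on_Suc_imp[OF Suc.prems(2)]
      by (intro Ck_on_sum assms(1) Ck_on_bilinear[OF bounded_bilinear_scaleR]
          Ck_on_bounded_linear[OF bounded_linear_inner_left] Suc.IH) auto
    then show "Ck_on k (\<lambda>x. frechet_derivative f (at (g x)) (frechet_derivative g (at x) v)) S"
      by (subst Ck_on_cong[OF assms(1) linear_eq_sum_Basis[OF lin]])
  qed
qed

section \<open>Closure properties of smooth functions\<close>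

lemma smooth_on_subset: "smooth_on f S \<Longrightarrow> T \<subseteq> S \<Longrightarrow> smooth_on f T"
  unfolding smooth_on_def by (blast intro: Ck_on_subset)

lemma smooth_on_cong:
  assumes "open S" "\<And>x. x \<in> S \<Longrightarrow> f x = g x"
  shows "smooth_on f S = smooth_on g S"
  unfolding smooth_on_def using Ck_on_cong[OF assms] by simp

lemma smooth_on_frechet_derivative:
  assumes "smooth_on f S"
  shows "smooth_on (\<lambda>x. frechet_derivative f (at x) v) S"
  using assms unfolding smooth_on_def by (metis Ck_on.simps(2))

lemma smooth_on_continuous_on: "smooth_on f S \<Longrightarrow> continuous_on S f"
  unfolding smooth_on_def by (metis Ck_on.simps(1))

lemma smooth_on_const: "open S \<Longrightarrow> smooth_on (\<lambda>x. c) S"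
  by (simp add: smooth_on_def Ck_on_const)

lemma smooth_on_bounded_linear:
  "bounded_linear L \<Longrightarrow> open S \<Longrightarrow> smooth_on f S \<Longrightarrow> smooth_on (\<lambda>x. L (f x)) S"
  by (simp add: smooth_on_def Ck_on_bounded_linear)

lemma smooth_on_id: "open S \<Longrightarrow> smooth_on (\<lambda>x. x) S"
  unfolding smooth_on_def
proof
  fix k assume "open S"
  then show "Ck_on k (\<lambda>x. x) S"
    by (cases k) (auto intro!: Ck_on_SucI[where f' = "\<lambda>x v. v"] Ck_on_const simp del: Ck_on.simps(2))
qed

lemma smooth_on_add:
  "open S \<Longrightarrow> smooth_on f S \<Longrightarrow> smooth_on g S \<Longrightarrow> smooth_on (\<lambda>x. f x + g x) S"
  by (simp add: smooth_on_def Ck_on_add)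

lemma smooth_on_sum:
  "open S \<Longrightarrow> (\<And>i. i \<in> I \<Longrightarrow> smooth_on (f i) S) \<Longrightarrow> smooth_on (\<lambda>x. \<Sum>i\<in>I. f i x) S"
  by (simp add: smooth_on_def Ck_on_sum)

lemma smooth_on_bilinear:
  "bounded_bilinear B \<Longrightarrow> open S \<Longrightarrow> smooth_on f S \<Longrightarrow> smooth_on g S \<Longrightarrow> smooth_on (\<lambda>x. B (f x) (g x)) S"
  by (simp add: smooth_on_def Ck_on_bilinear)

lemmas smooth_on_scaleR = smooth_on_bilinear[OF bounded_bilinear_scaleR]

lemma smooth_on_diff:
  assumes "open S" "smooth_on f S" "smooth_on g S"
  shows "smooth_on (\<lambda>x. f x - g x) S"
  using smooth_on_add[OF assms(1,2) smooth_on_bounded_linear[OF _ assms(1,3), of uminus]]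
  by (simp add: bounded_linear_minus bounded_linear_ident)

lemma smooth_on_Pair:
  assumes "open S" "smooth_on f S" "smooth_on g S"
  shows "smooth_on (\<lambda>x. (f x, g x)) S"
  using smooth_on_add[OF assms(1) smooth_on_bounded_linear[OF bounded_linear_Pair assms(1,2)]
      smooth_on_bounded_linear[OF bounded_linear_Pair assms(1,3)],
      OF bounded_linear_ident bounded_linear_zero bounded_linear_zero bounded_linear_ident]
  by simp

lemma smooth_on_compose:
  fixes g :: "'c::real_normed_vector \<Rightarrow> 'a::euclidean_space"
  assumes "open S" "open T" "g ` S \<subseteq> T" "smooth_on f T" "smooth_on g S"
  shows "smooth_on (\<lambda>x. f (g x)) S"
  using assms by (simp add: smooth_on_def Ck_on_compose)

lemma smooth_on_powr:
  fixes f :: "'a::real_normed_vector \<Rightarrow> real"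
  assumes "open S" "smooth_on f S" "\<And>x. x \<in> S \<Longrightarrow> f x > 0"
  shows "smooth_on (\<lambda>x. f x powr a) S"
proof -
  \<comment> \<open>The functions \<open>c * x powr a\<close> are closed under differentiation once
    factor and exponent may both vary, so the induction generalises over both.\<close>
  have "Ck_on k (\<lambda>x::real. c * x powr a) {0<..}" for k c and a :: real
  proof (induction k arbitrary: a c)
    case 0
    show ?case by (auto intro!: continuous_intros)
  next
    case (Suc k)
    show ?case
    proof (rule Ck_on_SucI[where f' = "\<lambda>x v. (c * a * v) * x powr (a - 1)"])
      fix x :: real assume x: "x \<in> {0<..}"
      then have "((\<lambda>x. c * x powr a) has_field_derivative c * (a * x powr (a - 1))) (at x)"
        by (auto intro!: derivative_eq_intros)
      then show "((\<lambda>x. c * x powr a) has_derivative (\<lambda>v. (c * a * v) * x powr (a - 1))) (at x)"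
        unfolding has_field_derivative_def by (rule has_derivative_eq_rhs) (simp add: fun_eq_iff)
    qed (auto intro: Suc)
  qed
  from this[of _ 1] have "smooth_on (\<lambda>x::real. x powr a) {0<..}" by (simp add: smooth_on_def)
  then show ?thesis using assms(3)
    by (intro smooth_on_compose[OF assms(1) open_greaterThan[of 0] _ _ assms(2)]) auto
qed

section \<open>Point-dependent linear maps with moving arguments\<close>

text \<open>Metric components, Jacobians and Christoffel symbols are smooth for fixed arguments;
  this lets the arguments move with the point, by expanding them in the basis.\<close>

lemma smooth_on_linear_family:
  fixes Y :: "'c::real_normed_vector \<Rightarrow> 'x::euclidean_space" and a :: "'c \<Rightarrow> 'a::euclidean_space"
  assumes "open S" "open W" and lin: "\<And>y. y \<in> S \<Longrightarrow> linear (L y)" and L: "\<And>u. smooth_on (\<lambda>y. L y u) S"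
    and Y: "smooth_on Y W" "Y ` W \<subseteq> S" and a: "smooth_on a W"
  shows "smooth_on (\<lambda>x. L (Y x) (a x)) W"
proof -
  have "smooth_on (\<lambda>x. \<Sum>b\<in>Basis. (a x \<bullet> b) *\<^sub>R L (Y x) b) W"
    by (intro smooth_on_sum smooth_on_scaleR assms(2) smooth_on_compose[OF assms(2,1) Y(2) L Y(1)]
        smooth_on_bounded_linear[OF bounded_linear_inner_left] a)
  moreover have "L (Y x) (a x) = (\<Sum>b\<in>Basis. (a x \<bullet> b) *\<^sub>R L (Y x) b)" if "x \<in> W" for x
    using Y(2) that by (intro linear_eq_sum_Basis lin) auto
  ultimately show ?thesis
    by (simp only: smooth_on_cong[OF assms(2), of "\<lambda>x. L (Y x) (a x)"])
qed

text \<open>A product rule that needs no norm on the space of linear maps: differentiability is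
  asked for each fixed argument, and finite dimension does the rest.\<close>

lemma has_derivative_linear_family:
  fixes Y :: "'c::real_normed_vector \<Rightarrow> 'x::real_normed_vector" and a :: "'c \<Rightarrow> 'a::euclidean_space"
    and L :: "'x \<Rightarrow> 'a \<Rightarrow> 'b::real_normed_vector"
  assumes S: "open S" "Y x \<in> S" and lin: "\<And>y. y \<in> S \<Longrightarrow> linear (L y)"
    and L: "\<And>u. ((\<lambda>y. L y u) has_derivative D u) (at (Y x))"
    and Y: "(Y has_derivative Y') (at x)" and a: "(a has_derivative a') (at x)"
  shows "((\<lambda>x. L (Y x) (a x)) has_derivative (\<lambda>w. D (a x) (Y' w) + L (Y x) (a' w))) (at x)"
proof -
  \<comment> \<open>\<open>L y\<close> is linear only for \<open>y\<close> in \<open>S\<close>,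
    hence the neighbourhood \<open>W\<close> that \<open>Y\<close> maps into
    \<open>S\<close>.\<close>
  have "(Y \<longlongrightarrow> Y x) (at x)" using has_derivative_continuous[OF Y] by (simp add: isCont_def)
  then have "\<forall>\<^sub>F z in at x. Y z \<in> S" using S by (rule topological_tendstoD)
  then obtain W where W: "open W" "x \<in> W" "\<And>z. z \<in> W \<Longrightarrow> Y z \<in> S"
    using S(2) UNIV_I unfolding eventually_at_topological by metis
  \<comment> \<open>Linearity of \<open>D\<close> in \<open>u\<close> follows from that of
    \<open>L\<close> by uniqueness of derivatives.\<close>
  have Dsum: "D u w = (\<Sum>b\<in>Basis. (u \<bullet> b) *\<^sub>R D b w)" for u w
  proof -
    have "((\<lambda>y. \<Sum>b\<in>Basis. (u \<bullet> b) *\<^sub>R L y b) has_derivative (\<lambda>w. \<Sum>b\<in>Basis. (u \<bullet> b) *\<^sub>R D b w)) (at (Y x))"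
      by (intro has_derivative_sum has_derivative_scaleR_right L)
    then have "((\<lambda>y. L y u) has_derivative (\<lambda>w. \<Sum>b\<in>Basis. (u \<bullet> b) *\<^sub>R D b w)) (at (Y x))"
      by (rule has_derivative_transform_within_open[OF _ S]) (metis lin linear_eq_sum_Basis)
    from has_derivative_unique[OF L this] show ?thesis by metis
  qed
  have "((\<lambda>x. \<Sum>b\<in>Basis. (a x \<bullet> b) *\<^sub>R L (Y x) b) has_derivative
      (\<lambda>w. \<Sum>b\<in>Basis. (a x \<bullet> b) *\<^sub>R D b (Y' w) + (a' w \<bullet> b) *\<^sub>R L (Y x) b)) (at x)"
    by (intro has_derivative_sum has_derivative_scaleR has_derivative_inner_left a
        has_derivative_compose[OF Y L])
  moreover have "(\<Sum>b\<in>Basis. (a x \<bullet> b) *\<^sub>R D b (Y' w) + (a' w \<bullet> b) *\<^sub>R L (Y x) b)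
      = D (a x) (Y' w) + L (Y x) (a' w)" for w
    by (simp add: sum.distrib Dsum[of "a x"] linear_eq_sum_Basis[OF lin[OF S(2)], of "a' w"])
  ultimately have "((\<lambda>x. \<Sum>b\<in>Basis. (a x \<bullet> b) *\<^sub>R L (Y x) b) has_derivative
      (\<lambda>w. D (a x) (Y' w) + L (Y x) (a' w))) (at x)" by simp
  then show ?thesis
    by (rule has_derivative_transform_within_open[OF _ W(1,2)])
      (rule linear_eq_sum_Basis[symmetric], simp add: W(3) lin)
qed

text \<open>Both mixed second derivatives are limits of the same second difference quotient.\<close>

lemma second_difference:
  fixes f :: "'a::real_normed_vector \<Rightarrow> real"
  assumes f: "smooth_on f S" and t: "t > 0"
    and S: "\<And>r s. 0 \<le> r \<Longrightarrow> r \<le> t \<Longrightarrow> 0 \<le> s \<Longrightarrow> s \<le> t \<Longrightarrow> x + r *\<^sub>R v + s *\<^sub>R w \<in> S"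
  shows "\<exists>r s. 0 < r \<and> r < t \<and> 0 < s \<and> s < t \<and>
    f (x + t *\<^sub>R v + t *\<^sub>R w) - f (x + t *\<^sub>R v) - f (x + t *\<^sub>R w) + f x =
    t * t * frechet_derivative (\<lambda>y. frechet_derivative f (at y) v) (at (x + r *\<^sub>R v + s *\<^sub>R w)) w"
proof -
  define F where "F y = frechet_derivative f (at y) v" for y
  have F: "smooth_on F S" unfolding F_def by (rule smooth_on_frechet_derivative[OF f])
  \<comment> \<open>The second difference is the increment of \<open>\<phi>\<close> from 0 to
    \<open>t\<close>. The mean value theorem gives \<open>r\<close>; applied once more, to the
    derivative in the direction \<open>v\<close> along \<open>w\<close>, it gives
    \<open>s\<close>.\<close>
  define \<phi> where "\<phi> r = f (x + r *\<^sub>R v + t *\<^sub>R w) - f (x + r *\<^sub>R v)" for r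
  have lin: "linear (frechet_derivative f (at y))" "linear (frechet_derivative F (at y))" if "y \<in> S" for y
    using f F that by (auto intro!: has_derivative_linear smooth_on_has_derivative)
  have \<phi>: "(\<phi> has_derivative (\<lambda>h. h * (F (x + r *\<^sub>R v + t *\<^sub>R w) - F (x + r *\<^sub>R v)))) (at r)"
    if "0 \<le> r" "r \<le> t" for r
  proof -
    have m: "x + r *\<^sub>R v + t *\<^sub>R w \<in> S" "x + r *\<^sub>R v \<in> S" using S[of r t] S[of r 0] that t by auto
    have "(\<phi> has_derivative (\<lambda>h. frechet_derivative f (at (x + r *\<^sub>R v + t *\<^sub>R w)) (h *\<^sub>R v)
        - frechet_derivative f (at (x + r *\<^sub>R v)) (h *\<^sub>R v))) (at r)"
      unfolding \<phi>_def
      by (intro has_derivative_diff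
          has_derivative_compose[of "\<lambda>r. x + r *\<^sub>R v + t *\<^sub>R w", OF _ smooth_on_has_derivative[OF f m(1)]]
          has_derivative_compose[of "\<lambda>r. x + r *\<^sub>R v", OF _ smooth_on_has_derivative[OF f m(2)]])
        (auto intro!: derivative_eq_intros)
    then show ?thesis
      by (simp add: linear_scale[OF lin(1)] m F_def right_diff_distrib)
  qed
  obtain r where r: "0 < r" "r < t" "\<phi> t - \<phi> 0 = t * (F (x + r *\<^sub>R v + t *\<^sub>R w) - F (x + r *\<^sub>R v))"
    using mvt_simple[OF t has_derivative_at_withinI[OF \<phi>]] by auto
  define \<psi> where "\<psi> s = F (x + r *\<^sub>R v + s *\<^sub>R w)" for s
  have \<psi>: "(\<psi> has_derivative (\<lambda>h. h * frechet_derivative F (at (x + r *\<^sub>R v + s *\<^sub>R w)) w)) (at s)"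
    if "0 \<le> s" "s \<le> t" for s
  proof -
    have m: "x + r *\<^sub>R v + s *\<^sub>R w \<in> S" using S[of r s] that r by auto
    have "(\<psi> has_derivative (\<lambda>h. frechet_derivative F (at (x + r *\<^sub>R v + s *\<^sub>R w)) (h *\<^sub>R w))) (at s)"
      unfolding \<psi>_def
      by (rule has_derivative_compose[of "\<lambda>s. x + r *\<^sub>R v + s *\<^sub>R w", OF _ smooth_on_has_derivative[OF F m]])
        (auto intro!: derivative_eq_intros)
    then show ?thesis by (simp add: linear_scale[OF lin(2)] m)
  qed
  obtain s where s: "0 < s" "s < t" "\<psi> t - \<psi> 0 = t * frechet_derivative F (at (x + r *\<^sub>R v + s *\<^sub>R w)) w"
    using mvt_simple[OF t has_derivative_at_withinI[OF \<psi>]] by auto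
  have "f (x + t *\<^sub>R v + t *\<^sub>R w) - f (x + t *\<^sub>R v) - f (x + t *\<^sub>R w) + f x = \<phi> t - \<phi> 0"
    by (simp add: \<phi>_def)
  also have "\<dots> = t * (\<psi> t - \<psi> 0)" using r(3) by (simp add: \<psi>_def)
  also have "\<dots> = t * t * frechet_derivative F (at (x + r *\<^sub>R v + s *\<^sub>R w)) w" using s(3) by simp
  finally show ?thesis using r s unfolding F_def by blast
qed

lemma frechet_derivative_symmetric_real:
  fixes f :: "'a::real_normed_vector \<Rightarrow> real"
  assumes f: "smooth_on f S" and S: "open S" "x \<in> S"
  shows "frechet_derivative (\<lambda>y. frechet_derivative f (at y) v) (at x) w =
    frechet_derivative (\<lambda>y. frechet_derivative f (at y) w) (at x) v"
proof (rule ccontr)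
  define P where "P v w y = frechet_derivative (\<lambda>y. frechet_derivative f (at y) v) (at y) w" for v w y
  assume "\<not> ?thesis"
  \<comment> \<open>Half the gap is the tolerance: near \<open>x\<close> each mixed derivative stays
    within it of its value at \<open>x\<close>, so the two cannot take a common value there.\<close>
  then have ne: "\<bar>P v w x - P w v x\<bar> / 2 > 0" by (simp add: P_def)
  have cont: "continuous_on S (P v w)" for v w
    unfolding P_def by (intro smooth_on_continuous_on smooth_on_frechet_derivative f)
  have "\<exists>d>0. \<forall>y. dist y x < d \<longrightarrow> y \<in> S \<and> dist (P v w y) (P v w x) < \<bar>P v w x - P w v x\<bar> / 2
      \<and> dist (P w v y) (P w v x) < \<bar>P v w x - P w v x\<bar> / 2"
  proof -
    have "isCont (P v w) x" "isCont (P w v) x" using cont S continuous_on_eq_continuous_at by blast+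
    then have "\<forall>\<^sub>F y in nhds x. dist (P v w y) (P v w x) < \<bar>P v w x - P w v x\<bar> / 2"
        "\<forall>\<^sub>F y in nhds x. dist (P w v y) (P w v x) < \<bar>P v w x - P w v x\<bar> / 2"
      using ne tendsto_at_iff_tendsto_nhds tendstoD unfolding isCont_def by blast+
    moreover have "\<forall>\<^sub>F y in nhds x. y \<in> S" using S by (rule eventually_nhds_in_open)
    ultimately have "\<forall>\<^sub>F y in nhds x. y \<in> S \<and> dist (P v w y) (P v w x) < \<bar>P v w x - P w v x\<bar> / 2
      \<and> dist (P w v y) (P w v x) < \<bar>P v w x - P w v x\<bar> / 2" by eventually_elim simp
    then show ?thesis unfolding eventually_nhds_metric .
  qed
  then obtain d where d: "d > 0" and dS: "\<And>y. dist y x < d \<Longrightarrow> y \<in> S"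
    and dP: "\<And>y. dist y x < d \<Longrightarrow> dist (P v w y) (P v w x) < \<bar>P v w x - P w v x\<bar> / 2"
      "\<And>y. dist y x < d \<Longrightarrow> dist (P w v y) (P w v x) < \<bar>P v w x - P w v x\<bar> / 2"
    by blast
  \<comment> \<open>Small enough that the parallelogram spanned by \<open>t *\<^sub>R v\<close> and
    \<open>t *\<^sub>R w\<close> at \<open>x\<close> stays within distance \<open>d\<close>; the
    summand 1 keeps the denominator positive when both vectors vanish.\<close>
  define t where "t = d / (norm v + norm w + 1)"
  have pos: "norm v + norm w + 1 > 0" by (simp add: add_nonneg_pos)
  then have t: "t > 0" using d by (simp add: t_def)
  have near: "dist (x + r *\<^sub>R v + s *\<^sub>R w) x < d" if "0 \<le> r" "r \<le> t" "0 \<le> s" "s \<le> t" for r s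
  proof -
    have "dist (x + r *\<^sub>R v + s *\<^sub>R w) x \<le> r * norm v + s * norm w"
      using that norm_triangle_ineq[of "r *\<^sub>R v" "s *\<^sub>R w"] by (simp add: dist_norm)
    also have "\<dots> \<le> t * norm v + t * norm w" using that by (intro add_mono mult_right_mono) auto
    also have "\<dots> < t * (norm v + norm w + 1)" using t by (simp add: distrib_left)
    also have "\<dots> = d" using pos by (simp add: t_def)
    finally show ?thesis .
  qed
  obtain r s where rs: "0 < r" "r < t" "0 < s" "s < t"
    "f (x + t *\<^sub>R v + t *\<^sub>R w) - f (x + t *\<^sub>R v) - f (x + t *\<^sub>R w) + f x = t * t * P v w (x + r *\<^sub>R v + s *\<^sub>R w)"
    using second_difference[OF f t, of x v w] dS[OF near] unfolding P_def by blast
  have in': "x + r *\<^sub>R w + s *\<^sub>R v \<in> S" if "0 \<le> r" "r \<le> t" "0 \<le> s" "s \<le> t" for r s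
    using dS[OF near[of s r]] that by (simp add: add_ac)
  obtain r' s' where rs': "0 < r'" "r' < t" "0 < s'" "s' < t"
    "f (x + t *\<^sub>R w + t *\<^sub>R v) - f (x + t *\<^sub>R w) - f (x + t *\<^sub>R v) + f x = t * t * P w v (x + r' *\<^sub>R w + s' *\<^sub>R v)"
    using second_difference[OF f t in'] unfolding P_def by blast
  have eq: "x + r' *\<^sub>R w + s' *\<^sub>R v = x + s' *\<^sub>R v + r' *\<^sub>R w"
    "x + t *\<^sub>R w + t *\<^sub>R v = x + t *\<^sub>R v + t *\<^sub>R w"
    by (simp_all add: add_ac)
  have "t * t * P v w (x + r *\<^sub>R v + s *\<^sub>R w) = t * t * P w v (x + s' *\<^sub>R v + r' *\<^sub>R w)"
    using rs(5) rs'(5)[unfolded eq] by linarith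
  then have "P v w (x + r *\<^sub>R v + s *\<^sub>R w) = P w v (x + s' *\<^sub>R v + r' *\<^sub>R w)" using t by simp
  moreover have "dist (P v w (x + r *\<^sub>R v + s *\<^sub>R w)) (P v w x) < \<bar>P v w x - P w v x\<bar> / 2"
    by (rule dP(1), rule near) (use rs in auto)
  moreover have "dist (P w v (x + s' *\<^sub>R v + r' *\<^sub>R w)) (P w v x) < \<bar>P v w x - P w v x\<bar> / 2"
    by (rule dP(2), rule near) (use rs' in auto)
  ultimately show False unfolding dist_real_def by argo
qed

lemma frechet_derivative_symmetric:
  fixes f :: "'a::real_normed_vector \<Rightarrow> 'b::euclidean_space"
  assumes f: "smooth_on f S" and S: "open S" "x \<in> S"
  shows "frechet_derivative (\<lambda>y. frechet_derivative f (at y) v) (at x) w =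
    frechet_derivative (\<lambda>y. frechet_derivative f (at y) w) (at x) v"
proof (rule euclidean_eqI)
  fix b :: 'b
  have D: "frechet_derivative (\<lambda>y. F y \<bullet> b) (at y) u = frechet_derivative F (at y) u \<bullet> b"
    if "smooth_on F S" "y \<in> S" for F :: "'a \<Rightarrow> 'b" and y u
    by (rule fun_cong[OF frechet_derivative_eqI], rule has_derivative_inner_left)
      (rule smooth_on_has_derivative[OF that])
  have *: "frechet_derivative (\<lambda>y. frechet_derivative (\<lambda>y. f y \<bullet> b) (at y) u) (at x) z =
      frechet_derivative (\<lambda>y. frechet_derivative f (at y) u) (at x) z \<bullet> b" for u z
    using D[OF smooth_on_frechet_derivative[OF f] S(2)]
      frechet_derivative_cong_open[OF S, of "\<lambda>y. frechet_derivative (\<lambda>y. f y \<bullet> b) (at y) u"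
        "\<lambda>y. frechet_derivative f (at y) u \<bullet> b"] D[OF f] by metis
  show "frechet_derivative (\<lambda>y. frechet_derivative f (at y) v) (at x) w \<bullet> b =
    frechet_derivative (\<lambda>y. frechet_derivative f (at y) w) (at x) v \<bullet> b"
    using frechet_derivative_symmetric_real[OF smooth_on_bounded_linear[OF bounded_linear_inner_left S(1) f] S, of b v w]
    by (simp add: *)
qed

text \<open>Two uses of the linear case: the first frees the first argument, and the second treats
  the point together with that argument as the base point.\<close>

lemma has_derivative_bilinear_family:
  fixes Y :: "'c::real_normed_vector \<Rightarrow> 'x::real_normed_vector"
    and a :: "'c \<Rightarrow> 'a::euclidean_space" and b :: "'c \<Rightarrow> 'b::euclidean_space"
    and B :: "'x \<Rightarrow> 'a \<Rightarrow> 'b \<Rightarrow> 'd::real_normed_vector"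
  assumes S: "open S" "Y x \<in> S" and lin: "\<And>y. y \<in> S \<Longrightarrow> bilinear (B y)"
    and B: "\<And>u v. ((\<lambda>y. B y u v) has_derivative D u v) (at (Y x))"
    and Y: "(Y has_derivative Y') (at x)" and a: "(a has_derivative a') (at x)"
    and b: "(b has_derivative b') (at x)"
  shows "((\<lambda>x. B (Y x) (a x) (b x)) has_derivative
    (\<lambda>w. D (a x) (b x) (Y' w) + B (Y x) (a' w) (b x) + B (Y x) (a x) (b' w))) (at x)"
proof -
  have 1: "((\<lambda>p. B (fst p) (snd p) v) has_derivative (\<lambda>w. D (a x) v (fst w) + B (Y x) (snd w) v)) (at (Y x, a x))" for v
    using has_derivative_linear_family[of S fst "(Y x, a x)" "\<lambda>y u. B y u v" "\<lambda>u. D u v" fst snd snd] S lin B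
    by (auto simp: bilinear_def intro: derivative_intros bounded_linear_imp_has_derivative bounded_linear_fst bounded_linear_snd)
  have "((\<lambda>x. (\<lambda>p v. B (fst p) (snd p) v) (Y x, a x) (b x)) has_derivative
    (\<lambda>w. (D (a x) (b x) (fst (Y' w, a' w)) + B (Y x) (snd (Y' w, a' w)) (b x)) + B (fst (Y x, a x)) (snd (Y x, a x)) (b' w))) (at x)"
    by (rule has_derivative_linear_family[of "S \<times> UNIV" "\<lambda>x. (Y x, a x)" x "\<lambda>p v. B (fst p) (snd p) v"
        "\<lambda>v w. D (a x) v (fst w) + B (Y x) (snd w) v", OF _ _ _ 1 has_derivative_Pair[OF Y a] b])
      (use S lin in \<open>auto simp: bilinear_def intro: open_Times\<close>)
  then show ?thesis by simp
qed

lemma smooth_on_bilinear_family: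
  fixes Y :: "'c::euclidean_space \<Rightarrow> 'x::euclidean_space"
    and a :: "'c \<Rightarrow> 'a::euclidean_space" and b :: "'c \<Rightarrow> 'b::euclidean_space"
    and B :: "'x \<Rightarrow> 'a \<Rightarrow> 'b \<Rightarrow> 'd::real_normed_vector"
  assumes S: "open S" "open W" and lin: "\<And>y. y \<in> S \<Longrightarrow> bilinear (B y)"
    and B: "\<And>u v. smooth_on (\<lambda>y. B y u v) S"
    and Y: "smooth_on Y W" "Y ` W \<subseteq> S" and a: "smooth_on a W" and b: "smooth_on b W"
  shows "smooth_on (\<lambda>x. B (Y x) (a x) (b x)) W"
proof -
  have "smooth_on (\<lambda>x. B (Y x) (a x) v) W" for v
    by (rule smooth_on_linear_family[OF S _ B Y a]) (use lin in \<open>auto simp: bilinear_def\<close>)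
  from smooth_on_linear_family[where L = "\<lambda>x. B (Y x) (a x)" and Y = "\<lambda>x. x",
      OF S(2) S(2) _ this smooth_on_id[OF S(2)] _ b]
  show ?thesis using lin Y(2) by (auto simp: bilinear_def)
qed

lemma bilinear_simps:
  assumes "bilinear B"
  shows "B (x + y) z = B x z + B y z" "B z (x + y) = B z x + B z y" "B (x - y) z = B x z - B y z"
    "B z (x - y) = B z x - B z y" "B (- x) z = - B x z" "B z (- x) = - B z x"
    "B (r *\<^sub>R x) z = r *\<^sub>R B x z" "B z (r *\<^sub>R x) = r *\<^sub>R B z x" "B 0 z = 0" "B z 0 = 0"
    "B (\<Sum>i\<in>I. f i) z = (\<Sum>i\<in>I. B (f i) z)" "B z (\<Sum>i\<in>I. f i) = (\<Sum>i\<in>I. B z (f i))"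
proof -
  have 1: "linear (\<lambda>x. B x z)" "linear (B z)" for z using assms by (auto simp: bilinear_def)
  show "B (\<Sum>i\<in>I. f i) z = (\<Sum>i\<in>I. B (f i) z)" "B z (\<Sum>i\<in>I. f i) = (\<Sum>i\<in>I. B z (f i))"
    by (fact linear_sum[OF 1(1)] linear_sum[OF 1(2)])+
qed (simp_all add: assms bilinear_ladd bilinear_radd bilinear_lsub bilinear_rsub bilinear_lneg bilinear_rneg
      bilinear_lmul bilinear_rmul bilinear_lzero bilinear_rzero)


subsection \<open>Riemannian geometry in a chart\<close>

text \<open>One chart in isolation, with \<open>m\<close> the metric components and \<open>G\<close>
  the Christoffel symbols. Smoothness is asked of \<open>m\<close> only, since
  \<open>christoffel\<close> is specified point by point; for \<open>G\<close> it is derived in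
  \<open>G_smooth\<close>.\<close>

locale riemannian_chart =
  fixes S :: "'a::euclidean_space set" and m :: "'a \<Rightarrow> 'a \<Rightarrow> 'a \<Rightarrow> real" and G :: "'a \<Rightarrow> 'a \<Rightarrow> 'a \<Rightarrow> 'a"
  assumes open_S: "open S"
    and m_sym: "y \<in> S \<Longrightarrow> m y u v = m y v u"
    and m_bilinear: "y \<in> S \<Longrightarrow> bilinear (m y)"
    and m_pos: "y \<in> S \<Longrightarrow> u \<noteq> 0 \<Longrightarrow> m y u u > 0"
    and m_smooth: "smooth_on (\<lambda>y. m y u v) S"
    and G_bilinear: "y \<in> S \<Longrightarrow> bilinear (G y)"
    and G_sym: "y \<in> S \<Longrightarrow> G y u v = G y v u"
    and G_compat: "y \<in> S \<Longrightarrow> frechet_derivative (\<lambda>z. m z u v) (at y) w = m y (G y w u) v + m y u (G y w v)"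
begin

lemmas m_simps = bilinear_simps[OF m_bilinear]
lemmas G_simps = bilinear_simps[OF G_bilinear]

lemma m_nonneg: "y \<in> S \<Longrightarrow> m y u u \<ge> 0"
  using m_pos[of y u] m_simps(9)[of y 0] by (cases "u = 0") (auto simp: less_imp_le)

lemma m_eqI:
  assumes y: "y \<in> S" and eq: "\<And>z. m y u z = m y v z"
  shows "u = v"
  using m_pos[OF y, of "u - v"] eq[of "u - v"] by (auto simp: m_simps(3)[OF y])

text \<open>Compatibility absorbs the derivative of the metric components, so that covariant
  derivatives of \<open>a\<close> and \<open>b\<close> appear in their place.\<close>

lemma has_derivative_m:
  assumes "Y x \<in> S" "(Y has_derivative Y') (at x)" "(a has_derivative a') (at x)" "(b has_derivative b') (at x)"
  shows "((\<lambda>x. m (Y x) (a x) (b x)) has_derivative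
    (\<lambda>w. m (Y x) (a' w + G (Y x) (Y' w) (a x)) (b x) + m (Y x) (a x) (b' w + G (Y x) (Y' w) (b x)))) (at x)"
proof -
  have "((\<lambda>y. m y u v) has_derivative (\<lambda>w. m (Y x) (G (Y x) w u) v + m (Y x) u (G (Y x) w v))) (at (Y x))" for u v
    using smooth_on_has_derivative[OF m_smooth assms(1), of u v] G_compat[OF assms(1)]
    by (metis (no_types, lifting) ext)
  from has_derivative_bilinear_family[OF open_S assms(1) m_bilinear this assms(2-4)]
  show ?thesis by (simp add: m_simps[OF assms(1)] add_ac)
qed

lemma smooth_on_m:
  fixes Y :: "'c::euclidean_space \<Rightarrow> 'a"
  assumes "open W" "smooth_on Y W" "Y ` W \<subseteq> S" "smooth_on a W" "smooth_on b W"
  shows "smooth_on (\<lambda>x. m (Y x) (a x) (b x)) W"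
  by (rule smooth_on_bilinear_family[OF open_S assms(1) m_bilinear m_smooth assms(2-5)])

section \<open>Orthonormal frames and traces\<close>

definition ortho :: "'a \<Rightarrow> (nat \<Rightarrow> 'a) \<Rightarrow> bool" where
  "ortho y e \<longleftrightarrow> (\<forall>i\<in>{1..DIM('a)}. \<forall>j\<in>{1..DIM('a)}. m y (e i) (e j) = (if i = j then 1 else 0))"

lemma gram_schmidt:
  "\<exists>E :: nat \<Rightarrow> 'a \<Rightarrow> 'a. (\<forall>i\<in>{1..DIM('a)}. smooth_on (E i) S) \<and> (\<forall>y\<in>S. ortho y (\<lambda>i. E i y))"
proof -
  obtain bs :: "nat \<Rightarrow> 'a" where bs: "bij_betw bs {1..DIM('a)} Basis"
    using ex_bij_betw_nat_finite_1[OF finite_Basis] by blast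
  \<comment> \<open>Gram-Schmidt runs at all points of the chart at once. The span clause keeps the
    next basis vector outside the span of the vectors already built, so its orthogonal remainder
    never vanishes.\<close>
  have "k \<le> DIM('a) \<Longrightarrow> \<exists>E :: nat \<Rightarrow> 'a \<Rightarrow> 'a. (\<forall>i\<in>{1..k}. smooth_on (E i) S) \<and>
      (\<forall>y\<in>S. \<forall>i\<in>{1..k}. \<forall>j\<in>{1..k}. m y (E i y) (E j y) = (if i = j then 1 else 0)) \<and>
      (\<forall>y\<in>S. \<forall>i\<in>{1..k}. E i y \<in> span (bs ` {1..k}))" for k
  proof (induction k)
    case 0
    show ?case by simp
  next
    case (Suc k)
    then obtain E where sm: "\<And>i. i \<in> {1..k} \<Longrightarrow> smooth_on (E i) S"
      and on: "\<And>y i j. y \<in> S \<Longrightarrow> i \<in> {1..k} \<Longrightarrow> j \<in> {1..k} \<Longrightarrow> m y (E i y) (E j y) = (if i = j then 1 else 0)"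
      and sp: "\<And>y i. y \<in> S \<Longrightarrow> i \<in> {1..k} \<Longrightarrow> E i y \<in> span (bs ` {1..k})"
      by (metis Suc_leD)
    define b where "b = bs (Suc k)"
    define F where "F y = b - (\<Sum>j\<in>{1..k}. m y b (E j y) *\<^sub>R E j y)" for y
    \<comment> \<open>The reciprocal length, written as a real power so that
      \<open>smooth_on_powr\<close> yields its smoothness.\<close>
    define N where "N y = m y (F y) (F y) powr (-1/2)" for y
    define E' where "E' i = (if i = Suc k then (\<lambda>y. N y *\<^sub>R F y) else E i)" for i
    have FE: "m y (F y) (E i y) = 0" if "y \<in> S" "i \<in> {1..k}" for y i
    proof -
      have "m y (F y) (E i y) = m y b (E i y) - (\<Sum>j\<in>{1..k}. m y b (E j y) * m y (E j y) (E i y))"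
        by (simp add: F_def m_simps[OF that(1)])
      also have "(\<Sum>j\<in>{1..k}. m y b (E j y) * m y (E j y) (E i y)) = (\<Sum>j\<in>{1..k}. if j = i then m y b (E j y) else 0)"
        by (intro sum.cong refl) (use on[OF that(1)] that(2) in auto)
      finally show ?thesis using that by (simp add: sum.delta)
    qed
    have F0: "F y \<noteq> 0" if y: "y \<in> S" for y
    proof
      assume "F y = 0"
      then have "b = (\<Sum>j\<in>{1..k}. m y b (E j y) *\<^sub>R E j y)" by (simp add: F_def)
      moreover have "\<dots> \<in> span (bs ` {1..k})" using sp[OF y] by (intro span_sum span_scale) auto
      ultimately have "b \<in> span (bs ` {1..k})" by metis
      moreover have "bs ` {1..k} \<subseteq> Basis - {b}"
      proof -
        have "bs i \<noteq> b" "bs i \<in> Basis" if "i \<in> {1..k}" for i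
          using inj_onD[OF bij_betw_imp_inj_on[OF bs], of i "Suc k"] bij_betw_apply[OF bs, of i] that Suc.prems
          by (auto simp: b_def)
        then show ?thesis by blast
      qed
      moreover have "b \<in> Basis" unfolding b_def using bij_betw_apply[OF bs] Suc.prems by simp
      ultimately have "b \<in> Basis" "b \<in> span (Basis - {b})" using span_mono by blast+
      then show False using independent_Basis unfolding dependent_def by blast
    qed
    have Fsm: "smooth_on F S"
      unfolding F_def using sm
      by (auto intro!: smooth_on_diff smooth_on_const smooth_on_sum smooth_on_scaleR smooth_on_m smooth_on_id open_S)
    have Nsm: "smooth_on N S"
      unfolding N_def using m_pos F0
      by (intro smooth_on_powr smooth_on_m open_S Fsm smooth_on_id) auto
    have "smooth_on (E' i) S" if "i \<in> {1..Suc k}" for i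
      using that sm[of i] by (auto simp: E'_def intro!: smooth_on_scaleR open_S Nsm Fsm)
    moreover have "m y (E' i y) (E' j y) = (if i = j then 1 else 0)"
      if y: "y \<in> S" and "i \<in> {1..Suc k}" "j \<in> {1..Suc k}" for y i j
    proof -
      have "N y * N y * m y (F y) (F y) = 1"
        using m_pos[OF y F0[OF y]] unfolding N_def powr_add[symmetric] by (simp add: powr_minus)
      moreover have "m y (E i y) (F y) = 0" if "i \<in> {1..k}" for i
        using FE[OF y that] m_sym[OF y] by metis
      ultimately show ?thesis
        using that FE[OF y] on[OF y, of i j] by (auto simp: E'_def m_simps[OF y] mult_ac)
    qed
    moreover have "E' i y \<in> span (bs ` {1..Suc k})" if y: "y \<in> S" and i: "i \<in> {1..Suc k}" for y i
    proof -
      have sp': "E i y \<in> span (bs ` {1..Suc k})" if "i \<in> {1..k}" for i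
        using sp[OF y that] span_mono[OF image_mono[of "{1..k}" "{1..Suc k}" bs]] by auto
      have "F y \<in> span (bs ` {1..Suc k})"
        unfolding F_def b_def by (intro span_diff span_sum span_scale sp') (auto intro: span_base)
      then show ?thesis using sp' i by (auto simp: E'_def intro: span_scale)
    qed
    ultimately show ?case by blast
  qed
  from this[of "DIM('a)"] show ?thesis unfolding ortho_def by blast
qed

text \<open>Orthonormal vectors are independent, and \<open>DIM('a)\<close> independent vectors
  span; the right-hand side is linear in \<open>u\<close> and fixes each of them.\<close>

lemma ortho_expand:
  assumes y: "y \<in> S" and e: "ortho y e"
  shows "u = (\<Sum>i=1..DIM('a). m y u (e i) *\<^sub>R e i)"
proof -
  let ?I = "{1..DIM('a)}"
  have on: "m y (e i) (e j) = (if i = j then 1 else 0)" if "i \<in> ?I" "j \<in> ?I" for i j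
    using e that by (simp add: ortho_def)
  have inj: "inj_on e ?I"
    using on by (intro inj_onI) (metis zero_neq_one)
  have "independent (e ` ?I)"
  proof (rule independent_if_scalars_zero)
    fix f x assume 0: "(\<Sum>x\<in>e ` ?I. f x *\<^sub>R x) = 0" and "x \<in> e ` ?I"
    then obtain j where j: "j \<in> ?I" "x = e j" by auto
    have "m y (\<Sum>x\<in>e ` ?I. f x *\<^sub>R x) (e j) = 0" unfolding 0 by (simp add: m_simps[OF y])
    then have "0 = m y (\<Sum>i\<in>?I. f (e i) *\<^sub>R e i) (e j)"
      by (simp only: sum.reindex[OF inj] comp_def)
    also have "\<dots> = (\<Sum>i\<in>?I. if i = j then f (e i) else 0)"
      unfolding m_simps[OF y] using on j by (intro sum.cong) auto
    also have "\<dots> = f x" using j by (simp add: sum.delta)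
    finally show "f x = 0" by simp
  qed simp
  then have span: "span (e ` ?I) = UNIV"
    using card_image[OF inj] by (metis card_eq_dim dim_UNIV card_atLeastAtMost diff_Suc_1 finite_atLeastAtMost
        finite_imageI order_refl subset_UNIV top.extremum_uniqueI)
  define T where "T u = (\<Sum>i\<in>?I. m y u (e i) *\<^sub>R e i)" for u
  have T: "linear T"
    by (rule linearI) (simp_all add: T_def m_simps[OF y] scaleR_left_distrib sum.distrib scaleR_right.sum)
  have "T x = x" if "x \<in> e ` ?I" for x
  proof -
    from that obtain j where j: "j \<in> ?I" "x = e j" by blast
    have "T x = (\<Sum>i\<in>?I. if i = j then e i else 0)"
      unfolding T_def using on j by (intro sum.cong) auto
    then show ?thesis using j by (simp add: sum.delta)
  qed
  then have "T u = u"
    using linear_eq_on_span[OF T linear_ident, of "e ` ?I" u] span by simp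
  then show ?thesis by (simp add: T_def)
qed

text \<open>Bridges the basis chosen inside \<open>metric_trace\<close> and the arbitrary frames of
  the theorem.\<close>

lemma ortho_trace_unique:
  fixes \<beta> :: "'a \<Rightarrow> 'a \<Rightarrow> 'b::real_vector"
  assumes y: "y \<in> S" and e: "ortho y e" and f: "ortho y f" and \<beta>: "bilinear \<beta>"
  shows "(\<Sum>i=1..DIM('a). \<beta> (e i) (e i)) = (\<Sum>i=1..DIM('a). \<beta> (f i) (f i))"
proof -
  let ?I = "{1..DIM('a)}"
  have "(\<Sum>i\<in>?I. \<beta> (e i) (e i)) = (\<Sum>i\<in>?I. \<beta> (e i) (\<Sum>j\<in>?I. m y (e i) (f j) *\<^sub>R f j))"
    by (intro sum.cong refl arg_cong2[where f = \<beta>] ortho_expand[OF y f])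
  also have "\<dots> = (\<Sum>i\<in>?I. \<Sum>j\<in>?I. m y (e i) (f j) *\<^sub>R \<beta> (e i) (f j))"
    by (simp add: bilinear_simps[OF \<beta>])
  also have "\<dots> = (\<Sum>j\<in>?I. \<Sum>i\<in>?I. m y (e i) (f j) *\<^sub>R \<beta> (e i) (f j))" by (rule sum.swap)
  also have "\<dots> = (\<Sum>j\<in>?I. \<beta> (\<Sum>i\<in>?I. m y (f j) (e i) *\<^sub>R e i) (f j))"
    by (simp add: bilinear_simps[OF \<beta>] m_sym[OF y])
  also have "\<dots> = (\<Sum>j\<in>?I. \<beta> (f j) (f j))"
    by (intro sum.cong refl arg_cong2[where f = \<beta>] ortho_expand[OF y e, symmetric])
  finally show ?thesis .
qed

text \<open>By the Koszul formula, the coefficients of \<open>G\<close> in a smooth orthonormal frame are smooth.\<close>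

lemma G_smooth: "smooth_on (\<lambda>y. G y w u) S"
proof -
  obtain E :: "nat \<Rightarrow> 'a \<Rightarrow> 'a" where E: "\<And>i. i \<in> {1..DIM('a)} \<Longrightarrow> smooth_on (E i) S" "\<And>y. y \<in> S \<Longrightarrow> ortho y (\<lambda>i. E i y)"
    using gram_schmidt by blast
  define D where "D w u v y = frechet_derivative (\<lambda>z. m z u v) (at y) w" for w u v y
  define K where "K y z = (1/2) *\<^sub>R (D w u z y + D u w z y - D z w u y)" for y z
  have K: "K y z = m y (G y w u) z" if "y \<in> S" for y z
    using G_sym[OF that, of z u] G_sym[OF that, of u w] G_sym[OF that, of z w]
      m_sym[OF that, of w "G y u z"] m_sym[OF that, of u "G y w z"]
    by (simp add: K_def D_def G_compat[OF that] field_simps)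
  have Ks: "smooth_on (\<lambda>y. K y z) S" for z
    unfolding K_def D_def
    by (intro smooth_on_scaleR smooth_on_diff smooth_on_add smooth_on_frechet_derivative m_smooth smooth_on_const open_S)
  have "linear (K y)" if "y \<in> S" for y
    using m_bilinear[OF that] unfolding bilinear_def K[OF that, abs_def] by blast
  then have "smooth_on (\<lambda>y. K y (E i y)) S" if "i \<in> {1..DIM('a)}" for i
    by (intro smooth_on_linear_family[OF open_S open_S _ Ks smooth_on_id[OF open_S] _ E(1)[OF that]]) auto
  then have "smooth_on (\<lambda>y. \<Sum>i=1..DIM('a). K y (E i y) *\<^sub>R E i y) S"
    using E(1) by (intro smooth_on_sum smooth_on_scaleR open_S) auto
  moreover have "G y w u = (\<Sum>i=1..DIM('a). K y (E i y) *\<^sub>R E i y)" if "y \<in> S" for y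
    unfolding K[OF that] by (rule ortho_expand[OF that E(2)[OF that]])
  ultimately show ?thesis by (simp only: smooth_on_cong[OF open_S, of "\<lambda>y. G y w u"])
qed

section \<open>Derivatives of the Christoffel symbols; the curvature tensor and its
  symmetries\<close>

definition DG :: "'a \<Rightarrow> 'a \<Rightarrow> 'a \<Rightarrow> 'a \<Rightarrow> 'a" where
  "DG y w u v = frechet_derivative (\<lambda>z. G z u v) (at y) w"

lemma has_derivative_G_const: "y \<in> S \<Longrightarrow> ((\<lambda>z. G z u v) has_derivative (\<lambda>w. DG y w u v)) (at y)"
  unfolding DG_def by (rule smooth_on_has_derivative[OF G_smooth])

lemma has_derivative_G:
  assumes "Y x \<in> S" "(Y has_derivative Y') (at x)" "(a has_derivative a') (at x)" "(b has_derivative b') (at x)"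
  shows "((\<lambda>x. G (Y x) (a x) (b x)) has_derivative
    (\<lambda>w. DG (Y x) (Y' w) (a x) (b x) + G (Y x) (a' w) (b x) + G (Y x) (a x) (b' w))) (at x)"
  by (rule has_derivative_bilinear_family[OF open_S assms(1) G_bilinear has_derivative_G_const[OF assms(1)] assms(2-4)])

lemma smooth_on_G:
  fixes Y :: "'c::euclidean_space \<Rightarrow> 'a"
  assumes "open W" "smooth_on Y W" "Y ` W \<subseteq> S" "smooth_on a W" "smooth_on b W"
  shows "smooth_on (\<lambda>x. G (Y x) (a x) (b x)) W"
  by (rule smooth_on_bilinear_family[OF open_S assms(1) G_bilinear G_smooth assms(2-5)])

lemma DG_eqI:
  assumes y: "y \<in> S" and f: "(f has_derivative f') (at y)" "\<And>z. z \<in> S \<Longrightarrow> f z = G z u v"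
  shows "DG y w u v = f' w"
  using has_derivative_unique[OF has_derivative_G_const[OF y]
      has_derivative_transform_within_open[OF f(1) open_S y f(2)]] by metis

lemma DG_sym: "y \<in> S \<Longrightarrow> DG y w u v = DG y w v u"
  by (rule DG_eqI[OF _ has_derivative_G_const]) (simp_all add: G_sym)

lemma DG_linear:
  assumes y: "y \<in> S"
  shows "linear (\<lambda>w. DG y w u v)" "linear (\<lambda>u. DG y w u v)" "linear (\<lambda>v. DG y w u v)"
proof -
  show "linear (\<lambda>w. DG y w u v)" by (rule has_derivative_linear[OF has_derivative_G_const[OF y]])
  show 2: "linear (\<lambda>u. DG y w u v)" for v
    by (rule linearI; rule DG_eqI[OF y])
      (auto intro!: derivative_eq_intros has_derivative_G_const[OF y] simp: G_simps)
  show "linear (\<lambda>v. DG y w u v)" using 2[of u] by (simp add: DG_sym[OF y, of w u])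
qed

lemma DG_simps:
  assumes y: "y \<in> S"
  shows "DG y (a + b) u v = DG y a u v + DG y b u v" "DG y w (a + b) v = DG y w a v + DG y w b v"
    "DG y w u (a + b) = DG y w u a + DG y w u b"
    "DG y (r *\<^sub>R a) u v = r *\<^sub>R DG y a u v" "DG y w (r *\<^sub>R a) v = r *\<^sub>R DG y w a v"
    "DG y w u (r *\<^sub>R a) = r *\<^sub>R DG y w u a"
  using linear_add[OF DG_linear(1)[OF y]] linear_add[OF DG_linear(2)[OF y]] linear_add[OF DG_linear(3)[OF y]]
    linear_scale[OF DG_linear(1)[OF y]] linear_scale[OF DG_linear(2)[OF y]] linear_scale[OF DG_linear(3)[OF y]]
  by simp_all

text \<open>The coordinate formula for \<open>R(a, b) c\<close>, with the sign for which
  \<open>R(X, Y)\<close> is the commutator of covariant derivatives minus the derivative along the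
  bracket.\<close>

definition Riem :: "'a \<Rightarrow> 'a \<Rightarrow> 'a \<Rightarrow> 'a \<Rightarrow> 'a" where
  "Riem y a b c = DG y a b c - DG y b a c + G y a (G y b c) - G y b (G y a c)"

lemma Riem_simps:
  assumes y: "y \<in> S"
  shows "Riem y (a + b) u v = Riem y a u v + Riem y b u v" "Riem y w (a + b) v = Riem y w a v + Riem y w b v"
    "Riem y w u (a + b) = Riem y w u a + Riem y w u b"
    "Riem y (r *\<^sub>R a) u v = r *\<^sub>R Riem y a u v" "Riem y w (r *\<^sub>R a) v = r *\<^sub>R Riem y w a v"
    "Riem y w u (r *\<^sub>R a) = r *\<^sub>R Riem y w u a"
  unfolding Riem_def by (simp_all add: DG_simps[OF y] G_simps[OF y] algebra_simps)

lemma Riem_skew: "Riem y a b c = - Riem y b a c"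
  by (simp add: Riem_def)

lemma Riem_self: "Riem y a a c = 0"
  by (simp add: Riem_def)

text \<open>The terms cancel in pairs because the Christoffel symbols and their derivatives are
  symmetric.\<close>

lemma Riem_bianchi:
  assumes y: "y \<in> S"
  shows "Riem y a b c + Riem y b c a + Riem y c a b = 0"
  unfolding Riem_def
  using DG_sym[OF y, of a b c] DG_sym[OF y, of b c a] DG_sym[OF y, of c a b]
  by (simp add: G_sym[OF y, of c b] G_sym[OF y, of c a] G_sym[OF y, of b a])

text \<open>Twice the left-hand side is the commutator of the second derivatives of
  \<open>m z c c\<close> in the directions \<open>a\<close> and \<open>b\<close>, which is zero; the
  products of first-order terms cancel by symmetry of \<open>m\<close>.\<close>

lemma m_Riem_self:
  assumes y: "y \<in> S"
  shows "m y (Riem y a b c) c = 0"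
proof -
  have D1: "frechet_derivative (\<lambda>z. m z c c) (at z) b = 2 * m z (G z b c) c" if "z \<in> S" for z b
    using m_sym[OF that, of c "G z b c"] by (simp add: G_compat[OF that])
  have D2: "frechet_derivative (\<lambda>z. frechet_derivative (\<lambda>z. m z c c) (at z) b) (at y) a =
      2 * (m y (DG y a b c + G y a (G y b c)) c + m y (G y b c) (G y a c))" for a b
  proof -
    have "((\<lambda>z. 2 * m z (G z b c) c) has_derivative
      (\<lambda>a. 2 * (m y (DG y a b c + G y a (G y b c)) c + m y (G y b c) (0 + G y a c)))) (at y)"
      by (intro has_derivative_mult_right has_derivative_m[OF _ has_derivative_ident] has_derivative_G_const y
          has_derivative_const)
    then have "((\<lambda>z. frechet_derivative (\<lambda>z. m z c c) (at z) b) has_derivative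
      (\<lambda>a. 2 * (m y (DG y a b c + G y a (G y b c)) c + m y (G y b c) (0 + G y a c)))) (at y)"
      by (rule has_derivative_transform_within_open[OF _ open_S y]) (simp add: D1)
    from frechet_derivative_eqI[OF this] show ?thesis by simp
  qed
  show ?thesis
    using frechet_derivative_symmetric_real[OF m_smooth open_S y, of c c a b] m_sym[OF y, of "G y a c" "G y b c"]
    unfolding D2 Riem_def by (simp add: m_simps[OF y])
qed

lemma m_Riem_skew:
  assumes y: "y \<in> S"
  shows "m y (Riem y a b c) d = - m y (Riem y a b d) c"
  using m_Riem_self[OF y, of a b "c + d"] m_Riem_self[OF y, of a b c] m_Riem_self[OF y, of a b d]
  by (simp add: Riem_simps[OF y] m_simps[OF y])

text \<open>Four cyclically rotated Bianchi identities, combined with skewness in each pair of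
  arguments, leave only the two sides.\<close>

lemma m_Riem_pair:
  assumes y: "y \<in> S"
  shows "m y (Riem y a b c) d = m y (Riem y c d a) b"
proof -
  define R where "R a b c d = m y (Riem y a b c) d" for a b c d
  have s1: "R a b c d = - R b a c d" for a b c d
    unfolding R_def by (subst Riem_skew) (simp add: m_simps[OF y])
  have s2: "R a b c d = - R a b d c" for a b c d
    unfolding R_def by (rule m_Riem_skew[OF y])
  have b: "R a b c d + R b c a d + R c a b d = 0" for a b c d
    using arg_cong[OF Riem_bianchi[OF y, of a b c], of "\<lambda>u. m y u d"]
    unfolding R_def by (simp add: m_simps[OF y])
  show ?thesis
    using b[of a b c d] b[of b c d a] b[of c d a b] b[of d a b c]
      s1[of a c b d] s1[of b d c a]  s2[of a b c d] s2[of c d a b] s2[of b c a d] s2[of d a b c]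
      s1[of c a b d] s2[of c a b d] s2[of b d c a] s1[of d b c a] s2[of d b c a] s2[of a c d b] s2[of a c b d]
      s1[of a d c b] s1[of d a c b] s1[of a b c d] s1[of a b d c]
    unfolding R_def[symmetric] by argo
qed

end

subsection \<open>The Levi-Civita connection of the generalised Cheeger-Gromoll metric\<close>

locale cheeger_gromoll_chart = riemannian_chart S m G
  for S :: "'a::euclidean_space set" and m G +
  fixes p q :: real
  assumes q_nonneg: "q \<ge> 0"
begin

text \<open>With \<open>vert\<close> and \<open>cg\<close>, the coordinate form of
  \<open>omega\<close>, \<open>connection_map\<close> and \<open>cheeger_gromoll\<close>; the match
  is made in \<open>omega_chart\<close>, \<open>connection_map_coord_vec\<close> and
  \<open>metric_comp_tangent_bundle\<close>.\<close>

definition om :: "'a \<Rightarrow> 'a \<Rightarrow> real" where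
  "om y v = inverse (1 + m y v v)"

definition vert :: "'a \<times> 'a \<Rightarrow> 'a \<times> 'a \<Rightarrow> 'a" where
  "vert e w = snd w + G (fst e) (fst w) (snd e)"

definition cg :: "'a \<times> 'a \<Rightarrow> 'a \<times> 'a \<Rightarrow> 'a \<times> 'a \<Rightarrow> real" where
  "cg e w w' = m (fst e) (fst w) (fst w') + om (fst e) (snd e) powr p *
    (m (fst e) (vert e w) (vert e w') + q * m (fst e) (vert e w) (snd e) * m (fst e) (vert e w') (snd e))"

text \<open>
  Differentiating horizontal and vertical components separately with \<open>G\<close> gives a connection on the
  tangent bundle whose torsion is the curvature of \<open>G\<close>, and for which \<open>cg\<close> is not parallel because
  of the weight and of the term in \<open>q\<close>. Solving the Koszul formula for the difference to the
  Levi-Civita connection of \<open>cg\<close> yields \<open>N\<close> (from the derivative of \<open>cg\<close>), and \<open>H\<close> together with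
  the curvature term of \<open>cg_vert\<close> (from the torsion).
\<close>

definition N :: "'a \<Rightarrow> 'a \<Rightarrow> 'a \<Rightarrow> 'a \<Rightarrow> 'a" where
  "N y v k l = - (p * om y v) *\<^sub>R (m y k v *\<^sub>R l + m y l v *\<^sub>R k)
    + (1 / (1 + q * m y v v) * ((p * om y v + q) * m y k l + p * q * om y v * m y k v * m y l v)) *\<^sub>R v"

definition H :: "'a \<Rightarrow> 'a \<Rightarrow> 'a \<Rightarrow> 'a \<Rightarrow> 'a \<Rightarrow> 'a \<Rightarrow> 'a" where
  "H y v a k b l = (om y v powr p / 2) *\<^sub>R (Riem y v l a + Riem y v k b)"

text \<open>The derivative of \<open>vert e u\<close> along \<open>w\<close>, for constant \<open>u\<close>, covariant with respect to \<open>G\<close>.\<close>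

definition dvert :: "'a \<times> 'a \<Rightarrow> 'a \<times> 'a \<Rightarrow> 'a \<times> 'a \<Rightarrow> 'a" where
  "dvert e w u = DG (fst e) (fst w) (fst u) (snd e) + G (fst e) (fst u) (snd w)
    + G (fst e) (fst w) (vert e u)"

definition cg_hor :: "'a \<times> 'a \<Rightarrow> 'a \<times> 'a \<Rightarrow> 'a \<times> 'a \<Rightarrow> 'a" where
  "cg_hor e w u = G (fst e) (fst w) (fst u) + H (fst e) (snd e) (fst w) (vert e w) (fst u) (vert e u)"

definition cg_vert :: "'a \<times> 'a \<Rightarrow> 'a \<times> 'a \<Rightarrow> 'a \<times> 'a \<Rightarrow> 'a" where
  "cg_vert e w u = dvert e w u - (1/2) *\<^sub>R Riem (fst e) (fst w) (fst u) (snd e) + N (fst e) (snd e) (vert e w) (vert e u)"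

text \<open>Returns from horizontal and vertical parts to chart components; the subtraction undoes
  the term that \<open>vert\<close> adds, as \<open>vert_cg_conn\<close> records.\<close>

definition cg_conn :: "'a \<times> 'a \<Rightarrow> 'a \<times> 'a \<Rightarrow> 'a \<times> 'a \<Rightarrow> 'a \<times> 'a" where
  "cg_conn e w u = (cg_hor e w u, cg_vert e w u - G (fst e) (cg_hor e w u) (snd e))"

section \<open>Positivity, symmetry and bilinearity\<close>

lemma om_pos: "y \<in> S \<Longrightarrow> om y v > 0"
  using m_nonneg[of y v] by (simp add: om_def add_pos_nonneg)

lemma denom_pos: "y \<in> S \<Longrightarrow> 1 + q * m y v v > 0"
  using m_nonneg[of y v] q_nonneg by (simp add: add_pos_nonneg)

lemma vert_cg_conn: "vert e (cg_conn e w u) = cg_vert e w u"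
  by (simp add: vert_def cg_conn_def)

lemma vert_simps:
  assumes "fst e \<in> S"
  shows "vert e (w + u) = vert e w + vert e u" "vert e (r *\<^sub>R w) = r *\<^sub>R vert e w"
  by (simp_all add: vert_def G_simps[OF assms] algebra_simps)

lemma cg_bilinear:
  assumes "fst e \<in> S"
  shows "bilinear (cg e)"
  unfolding bilinear_def
  by (intro conjI allI linearI)
    (simp_all add: cg_def vert_simps[OF assms] m_simps[OF assms] algebra_simps)

lemma cg_sym: "fst e \<in> S \<Longrightarrow> cg e w u = cg e u w"
  by (simp add: cg_def m_sym[of "fst e" "fst w"] m_sym[of "fst e" "vert e w" "vert e u"])

lemma cg_pos:
  assumes e: "fst e \<in> S" and w: "w \<noteq> 0"
  shows "cg e w w > 0"
proof -
  let ?k = "vert e w"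
  have o: "om (fst e) (snd e) powr p > 0" using om_pos[OF e, of "snd e"] by simp
  have q: "q * m (fst e) ?k (snd e) * m (fst e) ?k (snd e) \<ge> 0"
    using q_nonneg by (simp add: mult.assoc)
  show ?thesis
  proof (cases "fst w = 0")
    case True
    then have "?k \<noteq> 0" using w by (auto simp: vert_def G_simps[OF e] prod_eq_iff)
    then have "m (fst e) ?k ?k + q * m (fst e) ?k (snd e) * m (fst e) ?k (snd e) > 0"
      using m_pos[OF e, of ?k] q by (intro add_pos_nonneg) auto
    then show ?thesis
      unfolding cg_def using o True by (simp add: m_simps[OF e])
  next
    case False
    have "m (fst e) ?k ?k + q * m (fst e) ?k (snd e) * m (fst e) ?k (snd e) \<ge> 0"
      using m_nonneg[OF e, of ?k] q by (rule add_nonneg_nonneg)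
    then show ?thesis
      unfolding cg_def using m_pos[OF e False] o by (intro add_pos_nonneg mult_nonneg_nonneg) auto
  qed
qed

text \<open>Exchanging \<open>w\<close> and \<open>u\<close> changes \<open>dvert\<close> by exactly
  the curvature term, so subtracting half of it symmetrises.\<close>

lemma dvert_Riem_sym:
  assumes e: "fst e \<in> S"
  shows "dvert e w u - (1/2) *\<^sub>R Riem (fst e) (fst w) (fst u) (snd e) =
    dvert e u w - (1/2) *\<^sub>R Riem (fst e) (fst u) (fst w) (snd e)"
proof -
  have "dvert e w u = dvert e u w + Riem (fst e) (fst w) (fst u) (snd e)"
    by (simp add: dvert_def Riem_def vert_def G_simps[OF e])
  moreover have "X - (1/2) *\<^sub>R X = (1/2) *\<^sub>R X" for X :: 'a
    using scaleR_left_diff_distrib[of 1 "1/2" X] by simp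
  ultimately show ?thesis
    by (simp add: Riem_skew[of _ "fst u" "fst w"])
qed

lemma N_sym: "y \<in> S \<Longrightarrow> N y v k l = N y v l k"
  by (simp add: N_def m_sym[of y k l] mult_ac add_ac)

lemma cg_conn_sym: "fst e \<in> S \<Longrightarrow> cg_conn e w u = cg_conn e u w"
  using dvert_Riem_sym[of e w u]
  by (simp add: cg_conn_def cg_hor_def cg_vert_def N_sym[of _ _ "vert e w"] G_sym[of _ "fst w"] H_def add_ac)

lemma N_linear: "y \<in> S \<Longrightarrow> linear (N y v k)"
  by (rule linearI)
    (simp_all add: N_def m_simps divide_inverse_commute algebra_simps)

lemma cg_conn_bilinear:
  assumes e: "fst e \<in> S"
  shows "bilinear (cg_conn e)"
proof -
  have hor: "linear (cg_hor e w)" for w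
    by (rule linearI) (simp_all add: cg_hor_def H_def vert_simps[OF e] Riem_simps[OF e] G_simps[OF e] algebra_simps)
  have vert: "linear (cg_vert e w)" for w
    by (rule linearI) (simp_all add: cg_vert_def dvert_def vert_simps[OF e] Riem_simps[OF e] G_simps[OF e]
        DG_simps[OF e] linear_add[OF N_linear[OF e]] linear_scale[OF N_linear[OF e]] algebra_simps)
  have lin: "linear (cg_conn e w)" for w
    by (rule linearI) (simp_all add: cg_conn_def linear_add[OF hor] linear_add[OF vert] linear_scale[OF hor]
        linear_scale[OF vert] G_simps[OF e] algebra_simps)
  moreover have "linear (\<lambda>w. cg_conn e w u)" for u
    using lin[of u] by (simp add: cg_conn_sym[OF e, of _ u])
  ultimately show ?thesis by (simp add: bilinear_def)
qed

section \<open>Compatibility of the connection with the metric\<close>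

text \<open>The left-hand side pairs \<open>N\<close> with \<open>z\<close> in the fibre metric
  without its weight. There \<open>v\<close> paired with \<open>z\<close> gives
  \<open>(1 + q * m y v v) * m y z v\<close>, and the denominator in \<open>N\<close> is chosen to
  cancel this factor.\<close>

lemma N_inner:
  assumes y: "y \<in> S"
  shows "m y (N y v k l) z + q * m y (N y v k l) v * m y z v =
    - p * om y v * (m y k v * m y l z + m y l v * m y k z)
    + m y z v * (p * om y v * m y k l - p * q * om y v * m y k v * m y l v + q * m y k l)"
proof -
  define \<mu> where "\<mu> = 1 / (1 + q * m y v v) * ((p * om y v + q) * m y k l + p * q * om y v * m y k v * m y l v)"
  have "\<mu> * (1 + q * m y v v) = (p * om y v + q) * m y k l + p * q * om y v * m y k v * m y l v"
    using denom_pos[OF y, of v] by (simp add: \<mu>_def)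
  moreover have N: "N y v k l = - (p * om y v) *\<^sub>R (m y k v *\<^sub>R l + m y l v *\<^sub>R k) + \<mu> *\<^sub>R v"
    by (simp add: N_def \<mu>_def)
  have "m y (N y v k l) z + q * m y (N y v k l) v * m y z v =
    - p * om y v * (m y k v * m y l z + m y l v * m y k z) + m y z v * (\<mu> * (1 + q * m y v v)
      - 2 * p * q * om y v * m y k v * m y l v)"
    unfolding N by (simp add: m_simps[OF y] m_sym[OF y, of v z] algebra_simps)
  ultimately show ?thesis by (simp add: algebra_simps)
qed

text \<open>The two terms in \<open>k\<close> cancel by skewness. Pair symmetry moves the remaining
  ones to the form in which the curvature part of \<open>cg_vert\<close> contributes to
  compatibility, with the opposite sign.\<close>

lemma H_inner:
  assumes y: "y \<in> S"
  shows "m y (H y v a k b l) c + m y b (H y v a k c j) =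
    om y v powr p / 2 * (m y (Riem y a b v) j + m y l (Riem y a c v))"
proof -
  have "m y (Riem y v l a) c = m y l (Riem y a c v)"
    using m_Riem_pair[OF y, of v l a c] m_sym[OF y] by metis
  moreover have "m y b (Riem y v j a) = m y (Riem y a b v) j"
    using m_Riem_pair[OF y, of v j a b] m_sym[OF y] by metis
  moreover have "m y b (Riem y v k c) = - m y (Riem y v k b) c"
    using m_Riem_skew[OF y, of v k c b] m_sym[OF y] by metis
  ultimately show ?thesis
    by (simp add: H_def m_simps[OF y] algebra_simps)
qed

lemma has_derivative_vert:
  assumes e: "fst e \<in> S"
  shows "((\<lambda>e. vert e u) has_derivative (\<lambda>w. dvert e w u - G (fst e) (fst w) (vert e u))) (at e)"
proof -
  have "((\<lambda>e. snd u + G (fst e) (fst u) (snd e)) has_derivative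
      (\<lambda>w. 0 + (DG (fst e) (fst w) (fst u) (snd e) + G (fst e) 0 (snd e) + G (fst e) (fst u) (snd w)))) (at e)"
    by (intro has_derivative_add has_derivative_const has_derivative_G e
        bounded_linear_imp_has_derivative bounded_linear_fst bounded_linear_snd)
  then show ?thesis by (simp add: vert_def dvert_def G_simps[OF e])
qed

lemma has_derivative_m_snd:
  assumes e: "fst e \<in> S" and a: "(a has_derivative a') (at e)" and b: "(b has_derivative b') (at e)"
  shows "((\<lambda>e. m (fst e) (a e) (b e)) has_derivative
    (\<lambda>w. m (fst e) (a' w + G (fst e) (fst w) (a e)) (b e) + m (fst e) (a e) (b' w + G (fst e) (fst w) (b e)))) (at e)"
  by (rule has_derivative_m[where Y = fst and x = e, OF e _ a b]) (rule bounded_linear_imp_has_derivative[OF bounded_linear_fst])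

text \<open>The norm of \<open>v\<close> is constant in horizontal directions, so only
  \<open>vert e w\<close> enters. The derivative of \<open>om\<close> carries the square of
  \<open>om\<close>, which turns the power \<open>p - 1\<close> into one extra factor
  \<open>om\<close>.\<close>

lemma has_derivative_om_powr:
  assumes e: "fst e \<in> S"
  shows "((\<lambda>e. om (fst e) (snd e) powr p) has_derivative
    (\<lambda>w. - 2 * p * om (fst e) (snd e) * om (fst e) (snd e) powr p * m (fst e) (vert e w) (snd e))) (at e)"
proof -
  let ?o = "om (fst e) (snd e)"
  have pos: "1 + m (fst e) (snd e) (snd e) > 0" using m_nonneg[OF e] by (simp add: add_pos_nonneg)
  have "((\<lambda>e. m (fst e) (snd e) (snd e)) has_derivative
    (\<lambda>w. m (fst e) (snd w + G (fst e) (fst w) (snd e)) (snd e) + m (fst e) (snd e) (snd w + G (fst e) (fst w) (snd e)))) (at e)"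
    by (rule has_derivative_m_snd[OF e]) (rule bounded_linear_imp_has_derivative[OF bounded_linear_snd])+
  then have r: "((\<lambda>e. 1 + m (fst e) (snd e) (snd e)) has_derivative (\<lambda>w. 2 * m (fst e) (vert e w) (snd e))) (at e)"
    by (auto intro!: derivative_eq_intros simp: vert_def m_sym[OF e, of "snd e"])
  have "((\<lambda>e. om (fst e) (snd e)) has_derivative
      (\<lambda>w. - (inverse (1 + m (fst e) (snd e) (snd e)) * (2 * m (fst e) (vert e w) (snd e)) * inverse (1 + m (fst e) (snd e) (snd e))))) (at e)"
    unfolding om_def by (rule Deriv.has_derivative_inverse[OF _ r]) (use pos in simp)
  then have o: "((\<lambda>e. om (fst e) (snd e)) has_derivative (\<lambda>w. - (?o * (2 * m (fst e) (vert e w) (snd e)) * ?o))) (at e)"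
    by (simp add: om_def)
  have "((\<lambda>z. z powr p) has_derivative (\<lambda>h. p * ?o powr (p - 1) * h)) (at ?o)"
    using has_real_derivative_powr[OF om_pos[OF e]] by (simp add: has_field_derivative_def)
  from has_derivative_compose[OF o this]
  have "((\<lambda>e. om (fst e) (snd e) powr p) has_derivative
      (\<lambda>w. p * ?o powr (p - 1) * - (?o * (2 * m (fst e) (vert e w) (snd e)) * ?o))) (at e)" .
  moreover have "?o powr (p - 1) = ?o powr p / ?o" using om_pos[OF e, of "snd e"] by (simp add: powr_diff)
  ultimately show ?thesis using om_pos[OF e, of "snd e"] by (simp add: field_simps)
qed

lemma cg_compat:
  assumes e: "fst e \<in> S"
  shows "((\<lambda>e. cg e u z) has_derivative (\<lambda>w. cg e (cg_conn e w u) z + cg e u (cg_conn e w z))) (at e)"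
proof -
  let ?y = "fst e" and ?v = "snd e"
  let ?k = "\<lambda>w. vert e w" and ?o = "om (fst e) (snd e)"
  have snd: "(snd has_derivative snd) (at e)" by (rule bounded_linear_imp_has_derivative[OF bounded_linear_snd])
  have mK: "((\<lambda>e. m (fst e) (vert e u) (vert e z)) has_derivative
      (\<lambda>w. m ?y (dvert e w u) (?k z) + m ?y (?k u) (dvert e w z))) (at e)" for u z
    using has_derivative_m_snd[OF e has_derivative_vert[OF e, of u] has_derivative_vert[OF e, of z]] by simp
  have mv: "((\<lambda>e. m (fst e) (vert e u) (snd e)) has_derivative
      (\<lambda>w. m ?y (dvert e w u) ?v + m ?y (?k u) (?k w))) (at e)" for u
    using has_derivative_m_snd[OF e has_derivative_vert[OF e, of u] snd] by (simp add: vert_def)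
  have D: "((\<lambda>e. cg e u z) has_derivative (\<lambda>w.
      (m ?y (G ?y (fst w) (fst u)) (fst z) + m ?y (fst u) (G ?y (fst w) (fst z)))
      + (?o powr p * ((m ?y (dvert e w u) (?k z) + m ?y (?k u) (dvert e w z))
          + ((q * m ?y (?k u) ?v) * (m ?y (dvert e w z) ?v + m ?y (?k z) (?k w))
            + (q * (m ?y (dvert e w u) ?v + m ?y (?k u) (?k w))) * m ?y (?k z) ?v))
        + (- 2 * p * ?o * ?o powr p * m ?y (?k w) ?v)
          * (m ?y (?k u) (?k z) + q * m ?y (?k u) ?v * m ?y (?k z) ?v)))) (at e)"
    unfolding cg_def
    using has_derivative_m_snd[OF e has_derivative_const has_derivative_const, of "fst u" "fst z"]
    by (intro has_derivative_add has_derivative_mult has_derivative_mult_right has_derivative_om_powr e mK mv) simp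
  show ?thesis
  proof (rule has_derivative_eq_rhs[OF D], rule ext)
    fix w
    \<comment> \<open>The curvature part of \<open>cg_vert\<close> is orthogonal to
      \<open>v\<close>, hence invisible to the term with \<open>q\<close>.\<close>
    have Rv: "m ?y (Riem ?y a b ?v) ?v = 0" for a b by (rule m_Riem_self[OF e])
    have cg1: "cg e (cg_conn e w u) z = m ?y (G ?y (fst w) (fst u)) (fst z)
      + m ?y (H ?y ?v (fst w) (?k w) (fst u) (?k u)) (fst z)
      + ?o powr p * (m ?y (dvert e w u) (?k z) - m ?y (Riem ?y (fst w) (fst u) ?v) (?k z) / 2
        + q * m ?y (dvert e w u) ?v * m ?y (?k z) ?v
        + (m ?y (N ?y ?v (?k w) (?k u)) (?k z) + q * m ?y (N ?y ?v (?k w) (?k u)) ?v * m ?y (?k z) ?v))" for u z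
      unfolding cg_def vert_cg_conn
      by (simp add: cg_conn_def cg_hor_def cg_vert_def m_simps[OF e] Rv algebra_simps)
    have sym: "m ?y (fst u) b = m ?y b (fst u)" "m ?y (?k u) b = m ?y b (?k u)" for b
      by (rule m_sym[OF e])+
    \<comment> \<open>Solved for one of the two \<open>H\<close> terms; after substitution only
      curvature terms remain, which cancel the halves in \<open>cg1\<close>.\<close>
    have H: "m ?y (H ?y ?v (fst w) (?k w) (fst z) (?k z)) (fst u) =
      ?o powr p / 2 * (m ?y (Riem ?y (fst w) (fst u) ?v) (?k z) + m ?y (Riem ?y (fst w) (fst z) ?v) (?k u))
      - m ?y (H ?y ?v (fst w) (?k w) (fst u) (?k u)) (fst z)"
      using H_inner[OF e, of ?v "fst w" "?k w" "fst u" "?k u" "fst z" "?k z"] unfolding sym by linarith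
    show "(m ?y (G ?y (fst w) (fst u)) (fst z) + m ?y (fst u) (G ?y (fst w) (fst z)))
      + (?o powr p * ((m ?y (dvert e w u) (?k z) + m ?y (?k u) (dvert e w z))
          + ((q * m ?y (?k u) ?v) * (m ?y (dvert e w z) ?v + m ?y (?k z) (?k w))
            + (q * (m ?y (dvert e w u) ?v + m ?y (?k u) (?k w))) * m ?y (?k z) ?v))
        + (- 2 * p * ?o * ?o powr p * m ?y (?k w) ?v)
          * (m ?y (?k u) (?k z) + q * m ?y (?k u) ?v * m ?y (?k z) ?v))
      = cg e (cg_conn e w u) z + cg e u (cg_conn e w z)"
      unfolding cg_sym[OF e, of u] cg1 N_inner[OF e]
      by (simp add: sym H m_sym[OF e, of "?k z" "?k w"] algebra_simps)
  qed
qed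

end

subsection \<open>Chart representations of fields and derivatives\<close>

abbreviation transition :: "('m, 'a) chart \<Rightarrow> ('m, 'a) chart \<Rightarrow> 'a \<Rightarrow> 'a" where
  "transition c d \<equiv> cmap d \<circ> cinv c"

abbreviation jac :: "('m, 'a::euclidean_space) chart \<Rightarrow> ('m, 'a) chart \<Rightarrow> 'a \<Rightarrow> 'a \<Rightarrow> 'a" where
  "jac c d y \<equiv> frechet_derivative (transition c d) (at y)"

abbreviation hess :: "('m, 'a::euclidean_space) chart \<Rightarrow> ('m, 'a) chart \<Rightarrow> 'a \<Rightarrow> 'a \<Rightarrow> 'a \<Rightarrow> 'a" where
  "hess c d y w u \<equiv> frechet_derivative (\<lambda>z. jac c d z u) (at y) w"

definition field_rep :: "('m, 'a) chart \<Rightarrow> ('m \<Rightarrow> ('m, 'a) tvec) \<Rightarrow> 'a \<Rightarrow> 'a" where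
  "field_rep d V y = V (cinv d y) d"

text \<open>The predicate inside \<open>manifold_topology\<close>. As \<open>topology\<close> is an
  abstract constructor, \<open>openin\<close> agrees with it only once the axioms of a topology are
  checked, in \<open>openin_manifold_topology\<close>.\<close>

definition mopen :: "('m, 'a::euclidean_space) chart set \<Rightarrow> 'm set \<Rightarrow> bool" where
  "mopen A W \<longleftrightarrow> W \<subseteq> points A \<and> (\<forall>c\<in>A. open (cmap c ` (cdom c \<inter> W)))"

locale atlas =
  fixes A :: "('m, 'a::euclidean_space) chart set"
  assumes atlas: "smooth_atlas A"
begin

lemma inj_chart: "c \<in> A \<Longrightarrow> inj_on (cmap c) (cdom c)"
  using atlas by (simp add: smooth_atlas_def)

lemma open_overlap: "c \<in> A \<Longrightarrow> d \<in> A \<Longrightarrow> open (cmap c ` (cdom c \<inter> cdom d))"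
  using atlas by (simp add: smooth_atlas_def)

lemma open_chart: "c \<in> A \<Longrightarrow> open (cmap c ` cdom c)"
  using open_overlap[of c c] by simp

lemma smooth_transition:
  "c \<in> A \<Longrightarrow> d \<in> A \<Longrightarrow> smooth_on (transition c d) (cmap c ` (cdom c \<inter> cdom d))"
  using atlas by (simp add: smooth_atlas_def)

lemma charts_atD: "c \<in> charts_at A x \<Longrightarrow> c \<in> A" "c \<in> charts_at A x \<Longrightarrow> x \<in> cdom c"
  by (simp_all add: charts_at_def)

lemma cinv_in: "y \<in> cmap c ` cdom c \<Longrightarrow> cinv c y \<in> cdom c"
  unfolding cinv_def by (rule inv_into_into)

lemma cmap_cinv: "y \<in> cmap c ` cdom c \<Longrightarrow> cmap c (cinv c y) = y"
  unfolding cinv_def by (rule f_inv_into_f)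

lemma cinv_cmap': "c \<in> A \<Longrightarrow> x \<in> cdom c \<Longrightarrow> cinv c (cmap c x) = x"
  by (rule cinv_cmap[OF atlas]) (simp add: charts_at_def)

lemma charts_at_cinv: "c \<in> A \<Longrightarrow> y \<in> cmap c ` cdom c \<Longrightarrow> c \<in> charts_at A (cinv c y)"
  by (simp add: charts_at_def cinv_in)

lemma mopen_inter_chart:
  assumes "mopen A W" "c \<in> A" "d \<in> A"
  shows "open (cmap c ` (cdom c \<inter> cdom d \<inter> W))"
proof -
  have "cmap c ` (cdom c \<inter> cdom d \<inter> W) = cmap c ` (cdom c \<inter> cdom d) \<inter> cmap c ` (cdom c \<inter> W)"
    using inj_onD[OF inj_chart[OF assms(2)]] by blast
  then show ?thesis using assms open_overlap[OF assms(2,3)] by (simp add: mopen_def open_Int)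
qed

lemma openin_manifold_topology: "openin (manifold_topology A) W \<longleftrightarrow> mopen A W"
proof -
  have "istopology (mopen A)"
    unfolding istopology_def
  proof (intro conjI allI impI)
    fix V W assume VW: "mopen A V" "mopen A W"
    have "open (cmap c ` (cdom c \<inter> (V \<inter> W)))" if "c \<in> A" for c
    proof -
      have "cmap c ` (cdom c \<inter> (V \<inter> W)) = cmap c ` (cdom c \<inter> V) \<inter> cmap c ` (cdom c \<inter> W)"
        using inj_onD[OF inj_chart[OF that]] by blast
      then show ?thesis using VW that by (simp add: mopen_def open_Int)
    qed
    then show "mopen A (V \<inter> W)" using VW by (auto simp: mopen_def)
  next
    fix K assume K: "\<forall>W\<in>K. mopen A W"
    have "cmap c ` (cdom c \<inter> \<Union> K) = (\<Union>W\<in>K. cmap c ` (cdom c \<inter> W))" for c :: "('m, 'a) chart"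
      by blast
    moreover have "open (\<Union>W\<in>K. cmap c ` (cdom c \<inter> W))" if "c \<in> A" for c
      using K that by (intro open_UN) (simp add: mopen_def)
    moreover have "\<Union> K \<subseteq> points A" using K by (auto simp: mopen_def)
    ultimately show "mopen A (\<Union> K)" by (simp add: mopen_def)
  qed
  moreover have "manifold_topology A = topology (mopen A)"
    unfolding manifold_topology_def mopen_def by (rule refl)
  ultimately show ?thesis by (simp add: topology_inverse')
qed

lemma mopen_cdom: "d \<in> A \<Longrightarrow> mopen A (cdom d)"
  using open_overlap by (auto simp: mopen_def points_def)

lemma mopen_points: "mopen A (points A)"
proof -
  have "cdom c \<inter> points A = cdom c" if "c \<in> A" for c using that by (auto simp: points_def)
  then show ?thesis using open_chart by (simp add: mopen_def)
qed

section \<open>Transition maps and tangent vectors\<close>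

lemma has_derivative_transition:
  "c \<in> charts_at A x \<Longrightarrow> d \<in> charts_at A x \<Longrightarrow> (transition c d has_derivative jac c d (cmap c x)) (at (cmap c x))"
  by (rule chart_change_derivative[OF atlas])

lemma linear_jac: "c \<in> charts_at A x \<Longrightarrow> d \<in> charts_at A x \<Longrightarrow> linear (jac c d (cmap c x))"
  by (rule has_derivative_linear[OF has_derivative_transition])

lemma jac_inverse:
  assumes "c \<in> charts_at A x" "d \<in> charts_at A x"
  shows "jac c d (cmap c x) (jac d c (cmap d x) u) = u"
  using chart_change_cocycle[OF atlas assms(2,1,2)] chart_change_self[OF atlas assms(2)] by simp

lemma has_derivative_jac:
  assumes "c \<in> charts_at A x" "d \<in> charts_at A x"
  shows "((\<lambda>z. jac c d z u) has_derivative (\<lambda>w. hess c d (cmap c x) w u)) (at (cmap c x))"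
  using assms charts_atD
  by (intro smooth_on_has_derivative[of _ "cmap c ` (cdom c \<inter> cdom d)"] smooth_on_frechet_derivative smooth_transition)
    auto

lemma hess_sym:
  assumes "c \<in> charts_at A x" "d \<in> charts_at A x"
  shows "hess c d (cmap c x) w u = hess c d (cmap c x) u w"
  using assms charts_atD
  by (intro frechet_derivative_symmetric[of _ "cmap c ` (cdom c \<inter> cdom d)"] smooth_transition open_overlap)
    auto

lemma tangent_comp:
  assumes "c \<in> charts_at A x" "d \<in> charts_at A x" "v \<in> tangent_space A x"
  shows "v d = jac c d (cmap c x) (v c)"
  using assms unfolding tangent_space_def by blast

lemma tangent_outside: "v \<in> tangent_space A x \<Longrightarrow> d \<notin> charts_at A x \<Longrightarrow> v d = 0"
  unfolding tangent_space_def by blast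

lemma tangentI:
  assumes "\<And>c. c \<notin> charts_at A x \<Longrightarrow> v c = 0"
    and "\<And>c d. c \<in> charts_at A x \<Longrightarrow> d \<in> charts_at A x \<Longrightarrow> v d = jac c d (cmap c x) (v c)"
  shows "v \<in> tangent_space A x"
  using assms unfolding tangent_space_def by blast

lemma tangent_eqI:
  assumes "d \<in> charts_at A x" "v \<in> tangent_space A x" "w \<in> tangent_space A x" "v d = w d"
  shows "v = w"
  using tangent_eq_coord_vec[OF assms(1,2)] tangent_eq_coord_vec[OF assms(1,3)] assms(4) by metis

lemma tangent_comb:
  assumes x: "x \<in> points A" and v: "v \<in> tangent_space A x" "w \<in> tangent_space A x"
  shows "a *\<^sub>R v + b *\<^sub>R w \<in> tangent_space A x"
proof -
  obtain c where c: "c \<in> charts_at A x" using chosen_chart[OF x] by blast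
  have "coord_vec A c x (a *\<^sub>R v c + b *\<^sub>R w c) = a *\<^sub>R v + b *\<^sub>R w"
    by (simp add: coord_vec_linear[OF atlas c] tangent_eq_coord_vec[OF c] v)
  then show ?thesis using coord_vec_tangent(1)[OF atlas c] by metis
qed

lemma tangent_zero: "x \<in> points A \<Longrightarrow> 0 \<in> tangent_space A x"
  by (rule tangentI) (simp_all add: linear_0[OF linear_jac])

lemma tangent_add: "x \<in> points A \<Longrightarrow> v \<in> tangent_space A x \<Longrightarrow> w \<in> tangent_space A x \<Longrightarrow> v + w \<in> tangent_space A x"
  using tangent_comb[of x v w 1 1] by simp

lemma tangent_diff: "x \<in> points A \<Longrightarrow> v \<in> tangent_space A x \<Longrightarrow> w \<in> tangent_space A x \<Longrightarrow> v - w \<in> tangent_space A x"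
  using tangent_comb[of x v w 1 "-1"] by simp

lemma tangent_scaleR: "x \<in> points A \<Longrightarrow> v \<in> tangent_space A x \<Longrightarrow> a *\<^sub>R v \<in> tangent_space A x"
  using tangent_comb[of x v v a 0] by simp

lemma tangent_sum:
  "x \<in> points A \<Longrightarrow> (\<And>i. i \<in> I \<Longrightarrow> f i \<in> tangent_space A x) \<Longrightarrow> (\<Sum>i\<in>I. f i) \<in> tangent_space A x"
  by (induction I rule: infinite_finite_induct) (auto intro: tangent_zero tangent_add)

lemma points_charts: "d \<in> charts_at A x \<Longrightarrow> x \<in> points A"
  by (auto simp: charts_at_def points_def)

text \<open>Removes the chosen chart from \<open>dir_deriv\<close>: the chain rule through the
  transition map contributes the Jacobian by which the components of \<open>u\<close>
  transform.\<close>

lemma dir_deriv_chart: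
  assumes d: "d \<in> charts_at A x" and u: "u \<in> tangent_space A x"
    and F: "((\<lambda>y. F (cinv d y)) has_derivative D) (at (cmap d x))"
  shows "dir_deriv A F x u = D (u d)"
proof -
  define c where "c = (SOME c. c \<in> charts_at A x)"
  have c: "c \<in> charts_at A x" unfolding c_def by (rule chosen_chart[OF points_charts[OF d]])
  let ?S = "cmap c ` (cdom c \<inter> cdom d)"
  have "((\<lambda>z. (\<lambda>y. F (cinv d y)) (transition c d z)) has_derivative (\<lambda>w. D (jac c d (cmap c x) w))) (at (cmap c x))"
    by (rule has_derivative_compose[OF has_derivative_transition[OF c d]])
      (use F c d in \<open>simp add: cinv_cmap[OF atlas]\<close>)
  then have "(F \<circ> cinv c has_derivative (\<lambda>w. D (jac c d (cmap c x) w))) (at (cmap c x))"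
  proof (rule has_derivative_transform_within_open)
    show "open ?S" "cmap c x \<in> ?S" using open_overlap c d by (auto simp: charts_at_def)
    fix y assume "y \<in> ?S"
    then show "F (cinv d (transition c d y)) = (F \<circ> cinv c) y"
      using c d by (auto simp: charts_at_def cinv_cmap')
  qed
  from frechet_derivative_eqI[OF this] show ?thesis
    by (simp add: dir_deriv_def Let_def c_def[symmetric] tangent_comp[OF c d u])
qed

lemma differential_id:
  assumes d: "d \<in> charts_at A x" and u: "u \<in> tangent_space A x"
  shows "differential A A (\<lambda>x. x) x u d = u d"
proof -
  have "((\<lambda>y. cmap d (cinv d y)) has_derivative (\<lambda>u. u)) (at (cmap d x))"
    by (rule has_derivative_transform_within_open[OF has_derivative_ident, of "cmap d ` cdom d"])
      (use d open_chart in \<open>auto simp: charts_at_def cmap_cinv\<close>)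
  from dir_deriv_chart[OF d u this] show ?thesis using d by (simp add: differential_def)
qed

section \<open>Smooth vector fields in charts\<close>

lemma smooth_field_rep: "smooth_field A W V \<Longrightarrow> d \<in> A \<Longrightarrow> smooth_on (field_rep d V) (cmap d ` (cdom d \<inter> W))"
  by (simp add: smooth_field_def field_rep_def[abs_def])

lemma smooth_field_tangent: "smooth_field A W V \<Longrightarrow> x \<in> W \<Longrightarrow> V x \<in> tangent_space A x"
  by (simp add: smooth_field_def)

lemma smooth_fieldI:
  assumes "\<And>x. x \<in> W \<Longrightarrow> V x \<in> tangent_space A x"
    and "\<And>c. c \<in> A \<Longrightarrow> smooth_on (field_rep c V) (cmap c ` (cdom c \<inter> W))"
  shows "smooth_field A W V"
  using assms by (simp add: smooth_field_def field_rep_def[abs_def])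

lemma field_rep_cmap: "d \<in> charts_at A x \<Longrightarrow> field_rep d V (cmap d x) = V x d"
  by (simp add: field_rep_def cinv_cmap[OF atlas])

lemma smooth_field_subset:
  assumes "smooth_field A W V" "mopen A W'" "W' \<subseteq> W"
  shows "smooth_field A W' V"
proof (rule smooth_fieldI)
  fix c assume c: "c \<in> A"
  show "smooth_on (field_rep c V) (cmap c ` (cdom c \<inter> W'))"
    by (rule smooth_on_subset[OF smooth_field_rep[OF assms(1) c]]) (use assms(3) in auto)
qed (use assms in \<open>auto simp: smooth_field_def\<close>)

lemma has_derivative_field_rep:
  assumes V: "smooth_field A W V" and x: "x \<in> W" "d \<in> charts_at A x"
  shows "(field_rep d V has_derivative frechet_derivative (field_rep d V) (at (cmap d x))) (at (cmap d x))"
  using x charts_atD by (intro smooth_on_has_derivative[OF smooth_field_rep[OF V]]) auto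

text \<open>The source of both kinds of local fields used later, constant-component extensions and
  orthonormal frames.\<close>

lemma smooth_field_coord:
  assumes d: "d \<in> A" and E: "smooth_on E (cmap d ` cdom d)"
  shows "smooth_field A (cdom d) (\<lambda>y. coord_vec A d y (E (cmap d y)))"
proof (rule smooth_fieldI)
  fix x assume "x \<in> cdom d"
  then show "coord_vec A d x (E (cmap d x)) \<in> tangent_space A x"
    using d by (intro coord_vec_tangent[OF atlas]) (simp add: charts_at_def)
next
  fix c assume c: "c \<in> A"
  let ?O = "cmap c ` (cdom c \<inter> cdom d)" and ?P = "cmap d ` (cdom d \<inter> cdom c)"
  have in_P: "transition c d z \<in> ?P" if "z \<in> ?O" for z using that c by (auto simp: cinv_cmap')
  have P: "open ?P" by (rule open_overlap[OF d c])
  have sm: "smooth_on (\<lambda>y. jac d c y (E y)) ?P"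
  proof (rule smooth_on_linear_family[where L = "jac d c" and a = E, OF P P _ _ smooth_on_id[OF P]])
    fix y assume "y \<in> ?P"
    then obtain x where "x \<in> cdom d" "x \<in> cdom c" "y = cmap d x" by blast
    then show "linear (jac d c y)" using linear_jac[of d x c] c d by (simp add: charts_at_def)
  next
    show "smooth_on (\<lambda>y. jac d c y u) ?P" for u
      by (intro smooth_on_frechet_derivative smooth_transition c d)
    show "smooth_on E ?P" by (rule smooth_on_subset[OF E]) auto
  qed simp
  have "smooth_on (\<lambda>z. jac d c (transition c d z) (E (transition c d z))) ?O"
    by (rule smooth_on_compose[OF open_overlap[OF c d] P _ sm smooth_transition[OF c d]]) (use in_P in auto)
  moreover have "field_rep c (\<lambda>y. coord_vec A d y (E (cmap d y))) z = jac d c (transition c d z) (E (transition c d z))"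
    if "z \<in> ?O" for z
    using that c by (auto simp: field_rep_def coord_vec_def charts_at_def cinv_cmap')
  ultimately show "smooth_on (field_rep c (\<lambda>y. coord_vec A d y (E (cmap d y)))) ?O"
    by (simp only: smooth_on_cong[OF open_overlap[OF c d], of "field_rep c (\<lambda>y. coord_vec A d y (E (cmap d y)))"])
qed

lemma smooth_field_extend:
  assumes "x \<in> points A" "v \<in> tangent_space A x"
  shows "\<exists>W. mopen A W \<and> x \<in> W \<and> smooth_field A W (extend A x v) \<and> extend A x v x = v"
proof -
  define c where "c = (SOME c. c \<in> charts_at A x)"
  have c: "c \<in> charts_at A x" unfolding c_def by (rule chosen_chart[OF assms(1)])
  have "extend A x v = (\<lambda>y. coord_vec A c y (v c))"
    unfolding extend_def Let_def c_def by (rule refl)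
  then show ?thesis
    using smooth_field_coord[OF charts_atD(1)[OF c] smooth_on_const[OF open_chart[OF charts_atD(1)[OF c]]], of "v c"]
      mopen_cdom[OF charts_atD(1)[OF c]] charts_atD(2)[OF c] tangent_eq_coord_vec[OF c assms(2)]
    by auto
qed

lemma field_rep_transition:
  assumes V: "smooth_field A W V" and W: "mopen A W" and cd: "c \<in> A" "d \<in> A"
    and z: "z \<in> cmap c ` (cdom c \<inter> cdom d \<inter> W)"
  shows "field_rep d V (transition c d z) = jac c d z (field_rep c V z)"
proof -
  obtain x where x: "x \<in> cdom c" "x \<in> cdom d" "x \<in> W" "z = cmap c x" using z by auto
  then have "c \<in> charts_at A x" "d \<in> charts_at A x" using cd by (auto simp: charts_at_def)
  then show ?thesis
    using x tangent_comp smooth_field_tangent[OF V x(3)] by (simp add: cinv_cmap[OF atlas] field_rep_def)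
qed

text \<open>The transformation law of components, differentiated. The \<open>hess\<close> term is
  the defect that the Christoffel symbols compensate.\<close>

lemma field_rep_derivative_transition:
  assumes V: "smooth_field A W V" and W: "mopen A W" and x: "x \<in> W"
    and c: "c \<in> charts_at A x" and d: "d \<in> charts_at A x"
  shows "frechet_derivative (field_rep d V) (at (cmap d x)) (jac c d (cmap c x) w) =
    hess c d (cmap c x) w (V x c) + jac c d (cmap c x) (frechet_derivative (field_rep c V) (at (cmap c x)) w)"
proof -
  let ?S = "cmap c ` (cdom c \<inter> cdom d \<inter> W)" and ?O = "cmap c ` (cdom c \<inter> cdom d)"
  have S: "open ?S" "cmap c x \<in> ?S" using mopen_inter_chart[OF W] x c d by (auto simp: charts_at_def)
  have O: "open ?O" "cmap c x \<in> ?O" using open_overlap x c d by (auto simp: charts_at_def)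
  have lin: "linear (jac c d y)" if "y \<in> ?O" for y
  proof -
    from that obtain x' where "x' \<in> cdom c" "x' \<in> cdom d" "y = cmap c x'" by blast
    then show ?thesis using linear_jac[of c x' d] c d by (simp add: charts_at_def)
  qed
  have "((\<lambda>z. field_rep d V (transition c d z)) has_derivative
      (\<lambda>w. frechet_derivative (field_rep d V) (at (cmap d x)) (jac c d (cmap c x) w))) (at (cmap c x))"
    using has_derivative_compose[OF has_derivative_transition[OF c d]] has_derivative_field_rep[OF V x d]
    by (simp add: cinv_cmap[OF atlas c])
  then have 1: "((\<lambda>z. jac c d z (field_rep c V z)) has_derivative
      (\<lambda>w. frechet_derivative (field_rep d V) (at (cmap d x)) (jac c d (cmap c x) w))) (at (cmap c x))"
    by (rule has_derivative_transform_within_open[OF _ S])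
      (rule field_rep_transition[OF V W charts_atD(1)[OF c] charts_atD(1)[OF d]])
  have 2: "((\<lambda>z. jac c d z (field_rep c V z)) has_derivative
      (\<lambda>w. hess c d (cmap c x) w (field_rep c V (cmap c x))
        + jac c d (cmap c x) (frechet_derivative (field_rep c V) (at (cmap c x)) w))) (at (cmap c x))"
    by (rule has_derivative_linear_family[OF O lin has_derivative_jac[OF c d] has_derivative_ident
        has_derivative_field_rep[OF V x c]])
  from has_derivative_unique[OF 1 2] show ?thesis
    by (simp add: fun_eq_iff field_rep_cmap[OF c])
qed

end


section \<open>Christoffel symbols and covariant derivatives under a change of chart\<close>

locale riemannian = atlas A for A :: "('m, 'a::euclidean_space) chart set" +
  fixes g :: "('m, 'a) metric"
  assumes M: "riemannian_manifold A g"
begin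

lemma levi_civita_christoffel:
  assumes "d \<in> A" "y \<in> cmap d ` cdom d"
  shows "is_levi_civita_at A g d y (christoffel A g d y)"
  using theI'[OF levi_civita_ex1[OF M assms], folded christoffel_def] .

lemma chart_riemannian:
  assumes d: "d \<in> A"
  shows "riemannian_chart (cmap d ` cdom d) (metric_comp A g d) (christoffel A g d)"
proof
  show "open (cmap d ` cdom d)" by (rule open_chart[OF d])
  show "smooth_on (\<lambda>y. metric_comp A g d y u v) (cmap d ` cdom d)" for u v
    using M d by (simp add: riemannian_manifold_def riemannian_metric_def)
  fix y assume y: "y \<in> cmap d ` cdom d"
  note ip = metric_comp_inner_product[OF M d y]
  show "metric_comp A g d y u v = metric_comp A g d y v u" for u v by (rule ip(1))
  show "u \<noteq> 0 \<Longrightarrow> metric_comp A g d y u u > 0" for u by (rule ip(3))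
  have lin: "linear (\<lambda>u. metric_comp A g d y u v)" for v
    using ip(2)[of 1 _ 1] ip(2)[of _ _ 0 0] by (auto intro!: linearI)
  moreover have "linear (metric_comp A g d y u)" for u using lin[of u] ip(1)[of _ u] by simp
  ultimately show "bilinear (metric_comp A g d y)" by (simp add: bilinear_def)
  show "bilinear (christoffel A g d y)" "christoffel A g d y u v = christoffel A g d y v u"
    "frechet_derivative (\<lambda>z. metric_comp A g d z u v) (at y) w =
        metric_comp A g d y (christoffel A g d y w u) v + metric_comp A g d y u (christoffel A g d y w v)" for u v w
    using levi_civita_christoffel[OF d y] by (simp_all add: is_levi_civita_at_def)
qed

lemma metric_chart:
  assumes "d \<in> charts_at A x" "u \<in> tangent_space A x" "v \<in> tangent_space A x"
  shows "g x u v = metric_comp A g d (cmap d x) (u d) (v d)"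
  using assms by (simp add: metric_comp_def cinv_cmap[OF atlas] tangent_eq_coord_vec)

lemma metric_comp_transition:
  assumes c: "c \<in> charts_at A x" and d: "d \<in> charts_at A x"
  shows "metric_comp A g c (cmap c x) u v =
    metric_comp A g d (cmap d x) (jac c d (cmap c x) u) (jac c d (cmap c x) v)"
proof -
  have "coord_vec A c x u d = jac c d (cmap c x) u" for u using d by (simp add: coord_vec_def)
  then show ?thesis
    using metric_chart[OF d coord_vec_tangent(1)[OF atlas c] coord_vec_tangent(1)[OF atlas c]]
    by (simp add: metric_comp_def[of _ _ c] cinv_cmap[OF atlas c])
qed

text \<open>
  The right-hand side, pulled back by the Jacobian, satisfies the conditions that determine the
  Christoffel symbols in the chart \<open>c\<close>.
\<close>

lemma christoffel_transition:
  assumes c: "c \<in> charts_at A x" and d: "d \<in> charts_at A x"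
  shows "jac c d (cmap c x) (christoffel A g c (cmap c x) u v) =
    christoffel A g d (cmap d x) (jac c d (cmap c x) u) (jac c d (cmap c x) v) + hess c d (cmap c x) u v"
proof -
  interpret C: riemannian_chart "cmap d ` cdom d" "metric_comp A g d" "christoffel A g d"
    by (rule chart_riemannian[OF charts_atD(1)[OF d]])
  let ?y = "cmap c x" and ?S = "cmap c ` (cdom c \<inter> cdom d)"
  have y: "cmap d x \<in> cmap d ` cdom d" and yc: "cmap c x \<in> cmap c ` cdom c"
    using c d by (auto simp: charts_at_def)
  have S: "open ?S" "?y \<in> ?S" using open_overlap c d by (auto simp: charts_at_def)
  define \<Gamma> where "\<Gamma> u v = christoffel A g d (cmap d x) (jac c d ?y u) (jac c d ?y v) + hess c d ?y u v" for u v
  define \<Gamma>' where "\<Gamma>' u v = jac d c (cmap d x) (\<Gamma> u v)" for u v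
  note lin = linear_jac[OF c d] linear_jac[OF d c] has_derivative_linear[OF has_derivative_jac[OF c d]]
  have inv: "jac c d ?y (\<Gamma>' u v) = \<Gamma> u v" for u v unfolding \<Gamma>'_def by (rule jac_inverse[OF c d])
  have sym: "\<Gamma> u v = \<Gamma> v u" for u v
    by (simp add: \<Gamma>_def hess_sym[OF c d, of u] C.G_sym[OF y, of "jac c d ?y u"])
  have lin1: "linear (\<lambda>u. \<Gamma> u v)" for v
    by (rule linearI)
      (simp_all add: \<Gamma>_def linear_add[OF lin(1)] linear_scale[OF lin(1)] linear_add[OF lin(3)] linear_scale[OF lin(3)]
        C.G_simps[OF y] scaleR_add_right)
  have lin1': "linear (\<lambda>u. \<Gamma>' u v)" for v
    using linear_compose[OF lin1 lin(2)] by (simp add: comp_def \<Gamma>'_def)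
  have sym': "\<Gamma>' u v = \<Gamma>' v u" for u v by (simp add: \<Gamma>'_def sym)
  have "linear (\<Gamma>' u)" for u
    using lin1'[of u] by (simp add: sym'[of _ u])
  then have bil: "bilinear \<Gamma>'" using lin1' by (simp add: bilinear_def)
  have "frechet_derivative (\<lambda>z. metric_comp A g c z u v) (at ?y) w =
    metric_comp A g c ?y (\<Gamma>' w u) v + metric_comp A g c ?y u (\<Gamma>' w v)" for u v w
  proof -
    have y': "transition c d ?y \<in> cmap d ` cdom d" using y by (simp add: cinv_cmap[OF atlas c])
    have "((\<lambda>z. metric_comp A g d (transition c d z) (jac c d z u) (jac c d z v)) has_derivative
      (\<lambda>w. metric_comp A g d (cmap d x) (hess c d ?y w u + christoffel A g d (cmap d x) (jac c d ?y w) (jac c d ?y u)) (jac c d ?y v)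
         + metric_comp A g d (cmap d x) (jac c d ?y u) (hess c d ?y w v + christoffel A g d (cmap d x) (jac c d ?y w) (jac c d ?y v)))) (at ?y)"
      using C.has_derivative_m[OF y' has_derivative_transition[OF c d] has_derivative_jac[OF c d] has_derivative_jac[OF c d]]
      by (simp add: cinv_cmap[OF atlas c])
    then have "((\<lambda>z. metric_comp A g c z u v) has_derivative
      (\<lambda>w. metric_comp A g d (cmap d x) (\<Gamma> w u) (jac c d ?y v) + metric_comp A g d (cmap d x) (jac c d ?y u) (\<Gamma> w v))) (at ?y)"
    proof (rule has_derivative_transform_within_open[OF has_derivative_eq_rhs S])
      fix z assume "z \<in> ?S"
      then obtain x' where x': "x' \<in> cdom c" "x' \<in> cdom d" "z = cmap c x'" by auto
      then have "c \<in> charts_at A x'" "d \<in> charts_at A x'" using c d by (auto simp: charts_at_def)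
      from metric_comp_transition[OF this, of u v]
      show "metric_comp A g d (transition c d z) (jac c d z u) (jac c d z v) = metric_comp A g c z u v"
        using x' cinv_cmap[OF atlas \<open>c \<in> charts_at A x'\<close>] by simp
    qed (simp add: \<Gamma>_def add.commute)
    from frechet_derivative_eqI[OF this] show ?thesis
      by (simp add: metric_comp_transition[OF c d] inv)
  qed
  with bil sym' have "is_levi_civita_at A g c ?y \<Gamma>'" by (simp add: is_levi_civita_at_def)
  with levi_civita_ex1[OF M charts_atD(1)[OF c] yc] levi_civita_christoffel[OF charts_atD(1)[OF c] yc]
  have "christoffel A g c ?y = \<Gamma>'" by blast
  then show ?thesis using inv by (simp add: \<Gamma>_def)
qed

lemma cov_deriv_chart:
  assumes d: "d \<in> charts_at A x" and u: "u \<in> tangent_space A x"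
    and V: "(field_rep d V has_derivative D) (at (cmap d x))"
  shows "cov_deriv A g V x u d = D (u d) + christoffel A g d (cmap d x) (u d) (V x d)"
  using dir_deriv_chart[OF d u, of "\<lambda>y. V y d"] V d
  by (simp add: cov_deriv_def cov_deriv_along_def differential_id[OF d u] field_rep_def[abs_def])

lemma cov_deriv_smooth:
  assumes V: "smooth_field A W V" and x: "x \<in> W" and d: "d \<in> charts_at A x" and u: "u \<in> tangent_space A x"
  shows "cov_deriv A g V x u d =
    frechet_derivative (field_rep d V) (at (cmap d x)) (u d) + christoffel A g d (cmap d x) (u d) (V x d)"
  by (rule cov_deriv_chart[OF d u has_derivative_field_rep[OF V x d]])

text \<open>The \<open>hess\<close> terms from the derivative of the components and from the law of
  the Christoffel symbols cancel.\<close>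

lemma cov_deriv_tangent:
  assumes V: "smooth_field A W V" and W: "mopen A W" and x: "x \<in> W" and u: "u \<in> tangent_space A x"
  shows "cov_deriv A g V x u \<in> tangent_space A x"
proof (rule tangentI)
  fix c d assume c: "c \<in> charts_at A x" and d: "d \<in> charts_at A x"
  show "cov_deriv A g V x u d = jac c d (cmap c x) (cov_deriv A g V x u c)"
    unfolding cov_deriv_smooth[OF V x c u] cov_deriv_smooth[OF V x d u] linear_add[OF linear_jac[OF c d]]
      christoffel_transition[OF c d] tangent_comp[OF c d u] field_rep_derivative_transition[OF V W x c d]
      tangent_comp[OF c d smooth_field_tangent[OF V x]]
    by (simp add: add_ac)
qed (simp add: cov_deriv_def cov_deriv_along_def)

lemma field_rep_nabla:
  assumes Y: "smooth_field A W Y" and Z: "smooth_field A W Z" and d: "d \<in> A" and y: "y \<in> cmap d ` (cdom d \<inter> W)"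
  shows "field_rep d (nabla A g Y Z) y =
    frechet_derivative (field_rep d Z) (at y) (field_rep d Y y) + christoffel A g d y (field_rep d Y y) (field_rep d Z y)"
proof -
  obtain x where x: "x \<in> cdom d" "x \<in> W" "y = cmap d x" using y by auto
  then have dx: "d \<in> charts_at A x" using d by (simp add: charts_at_def)
  show ?thesis
    unfolding x(3) field_rep_cmap[OF dx] nabla_def
    by (rule cov_deriv_smooth[OF Z x(2) dx smooth_field_tangent[OF Y x(2)]])
qed

lemma linear_frechet_field_rep:
  assumes "smooth_field A W V" "d \<in> A" "y \<in> cmap d ` (cdom d \<inter> W)"
  shows "linear (frechet_derivative (field_rep d V) (at y))"
  by (rule has_derivative_linear[OF smooth_on_has_derivative[OF smooth_field_rep[OF assms(1,2)] assms(3)]])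

text \<open>Allows covariant derivatives to be iterated, as \<open>curvature\<close> demands;
  smoothness of the Christoffel symbols enters here.\<close>

lemma smooth_field_nabla:
  assumes W: "mopen A W" and Y: "smooth_field A W Y" and Z: "smooth_field A W Z"
  shows "smooth_field A W (nabla A g Y Z)"
proof (rule smooth_fieldI)
  fix x assume "x \<in> W"
  then show "nabla A g Y Z x \<in> tangent_space A x"
    unfolding nabla_def by (intro cov_deriv_tangent[OF Z W] smooth_field_tangent[OF Y])
next
  fix c assume c: "c \<in> A"
  let ?O = "cmap c ` (cdom c \<inter> W)"
  interpret C: riemannian_chart "cmap c ` cdom c" "metric_comp A g c" "christoffel A g c"
    by (rule chart_riemannian[OF c])
  have O: "open ?O" using W c by (simp add: mopen_def)
  note sm = smooth_field_rep[OF Y c] smooth_field_rep[OF Z c]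
  have "smooth_on (\<lambda>y. frechet_derivative (field_rep c Z) (at y) (field_rep c Y y)) ?O"
    by (rule smooth_on_linear_family[OF O O linear_frechet_field_rep[OF Z c]
          smooth_on_frechet_derivative[OF sm(2)] smooth_on_id[OF O] _ sm(1)]) simp_all
  moreover have "smooth_on (\<lambda>y. christoffel A g c y (field_rep c Y y) (field_rep c Z y)) ?O"
    by (rule C.smooth_on_G[OF O smooth_on_id[OF O] _ sm]) auto
  ultimately have "smooth_on (\<lambda>y. frechet_derivative (field_rep c Z) (at y) (field_rep c Y y)
      + christoffel A g c y (field_rep c Y y) (field_rep c Z y)) ?O"
    by (rule smooth_on_add[OF O])
  then show "smooth_on (field_rep c (nabla A g Y Z)) ?O"
    by (simp only: smooth_on_cong[OF O field_rep_nabla[OF Y Z c]])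
qed

end

lemma sum_fun_apply: "(\<Sum>i\<in>I. f i) d = (\<Sum>i\<in>I. f i d)"
  by (induction I rule: infinite_finite_induct) simp_all

context riemannian
begin

abbreviation DGam :: "('m, 'a) chart \<Rightarrow> 'a \<Rightarrow> 'a \<Rightarrow> 'a \<Rightarrow> 'a \<Rightarrow> 'a" where
  "DGam d \<equiv> riemannian_chart.DG (christoffel A g d)"

abbreviation Rm :: "('m, 'a) chart \<Rightarrow> 'a \<Rightarrow> 'a \<Rightarrow> 'a \<Rightarrow> 'a \<Rightarrow> 'a" where
  "Rm d \<equiv> riemannian_chart.Riem (christoffel A g d)"

abbreviation D1 :: "('m, 'a) chart \<Rightarrow> ('m \<Rightarrow> ('m, 'a) tvec) \<Rightarrow> 'a \<Rightarrow> 'a \<Rightarrow> 'a" where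
  "D1 d V y \<equiv> frechet_derivative (field_rep d V) (at y)"

abbreviation D2 :: "('m, 'a) chart \<Rightarrow> ('m \<Rightarrow> ('m, 'a) tvec) \<Rightarrow> 'a \<Rightarrow> 'a \<Rightarrow> 'a \<Rightarrow> 'a" where
  "D2 d V y w u \<equiv> frechet_derivative (\<lambda>z. D1 d V z u) (at y) w"

abbreviation ortho_at :: "('m, 'a) chart \<Rightarrow> 'a \<Rightarrow> (nat \<Rightarrow> 'a) \<Rightarrow> bool" where
  "ortho_at d \<equiv> riemannian_chart.ortho (metric_comp A g d)"

section \<open>Curvature and second covariant derivatives in a chart\<close>

lemma D2_sym:
  assumes W: "mopen A W" and V: "smooth_field A W V" and x: "x \<in> W" and d: "d \<in> charts_at A x"
  shows "D2 d V (cmap d x) w u = D2 d V (cmap d x) u w"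
  using W x d charts_atD
  by (intro frechet_derivative_symmetric[OF smooth_field_rep[OF V]]) (auto simp: mopen_def simp del: split_paired_All)

lemma has_derivative_D1:
  assumes W: "mopen A W" and V: "smooth_field A W V" and x: "x \<in> W" and d: "d \<in> charts_at A x"
    and a: "(a has_derivative a') (at (cmap d x))"
  shows "((\<lambda>y. D1 d V y (a y)) has_derivative
    (\<lambda>w. D2 d V (cmap d x) w (a (cmap d x)) + D1 d V (cmap d x) (a' w))) (at (cmap d x))"
proof (rule has_derivative_linear_family[where L = "D1 d V" and Y = "\<lambda>y. y" and a = a and x = "cmap d x",
      OF _ _ linear_frechet_field_rep[OF V charts_atD(1)[OF d]] _ has_derivative_ident a])
  show "open (cmap d ` (cdom d \<inter> W))" using W charts_atD(1)[OF d] by (simp add: mopen_def)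
  show "cmap d x \<in> cmap d ` (cdom d \<inter> W)" using x charts_atD(2)[OF d] by blast
  then show "((\<lambda>y. D1 d V y u) has_derivative (\<lambda>w. D2 d V (cmap d x) w u)) (at (cmap d x))" for u
    by (rule smooth_on_has_derivative[OF smooth_on_frechet_derivative[OF smooth_field_rep[OF V charts_atD(1)[OF d]]]])
qed

lemma has_derivative_field_rep_nabla:
  assumes W: "mopen A W" and Y: "smooth_field A W Y" and Z: "smooth_field A W Z"
    and x: "x \<in> W" and d: "d \<in> charts_at A x"
  shows "(field_rep d (nabla A g Y Z) has_derivative (\<lambda>w.
      D2 d Z (cmap d x) w (Y x d) + D1 d Z (cmap d x) (D1 d Y (cmap d x) w)
      + (DGam d (cmap d x) w (Y x d) (Z x d) + christoffel A g d (cmap d x) (D1 d Y (cmap d x) w) (Z x d)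
        + christoffel A g d (cmap d x) (Y x d) (D1 d Z (cmap d x) w)))) (at (cmap d x))"
proof -
  interpret C: riemannian_chart "cmap d ` cdom d" "metric_comp A g d" "christoffel A g d"
    by (rule chart_riemannian[OF charts_atD(1)[OF d]])
  let ?y = "cmap d x" and ?S = "cmap d ` (cdom d \<inter> W)"
  have y: "?y \<in> cmap d ` cdom d" using charts_atD(2)[OF d] by blast
  have S: "open ?S" "?y \<in> ?S" using W charts_atD[OF d] x by (auto simp: mopen_def simp del: split_paired_All)
  have "((\<lambda>y. D1 d Z y (field_rep d Y y) + christoffel A g d y (field_rep d Y y) (field_rep d Z y)) has_derivative
    (\<lambda>w. D2 d Z ?y w (field_rep d Y ?y) + D1 d Z ?y (D1 d Y ?y w)
      + (DGam d ?y w (field_rep d Y ?y) (field_rep d Z ?y) + christoffel A g d ?y (D1 d Y ?y w) (field_rep d Z ?y)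
        + christoffel A g d ?y (field_rep d Y ?y) (D1 d Z ?y w)))) (at ?y)"
    by (intro has_derivative_add has_derivative_D1[OF W Z x d] has_derivative_field_rep[OF Y x d]
        C.has_derivative_G[OF y has_derivative_ident] has_derivative_field_rep[OF Z x d])
  then have "(field_rep d (nabla A g Y Z) has_derivative
    (\<lambda>w. D2 d Z ?y w (field_rep d Y ?y) + D1 d Z ?y (D1 d Y ?y w)
      + (DGam d ?y w (field_rep d Y ?y) (field_rep d Z ?y) + christoffel A g d ?y (D1 d Y ?y w) (field_rep d Z ?y)
        + christoffel A g d ?y (field_rep d Y ?y) (D1 d Z ?y w)))) (at ?y)"
    by (rule has_derivative_transform_within_open[OF _ S])
      (rule field_rep_nabla[OF Y Z charts_atD(1)[OF d], symmetric])
  then show ?thesis by (simp only: field_rep_cmap[OF d])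
qed

lemma lie_bracket_chart:
  assumes X: "smooth_field A W X" and Y: "smooth_field A W Y" and x: "x \<in> W" and d: "d \<in> charts_at A x"
  shows "lie_bracket A X Y x d = D1 d Y (cmap d x) (X x d) - D1 d X (cmap d x) (Y x d)"
  using dir_deriv_chart[OF d smooth_field_tangent[OF X x], of "\<lambda>y. Y y d"] has_derivative_field_rep[OF Y x d]
    dir_deriv_chart[OF d smooth_field_tangent[OF Y x], of "\<lambda>y. X y d"] has_derivative_field_rep[OF X x d] d
  by (simp add: lie_bracket_def field_rep_def[abs_def])

text \<open>By torsion-freeness the bracket is a difference of two covariant derivatives, already
  known to be tangent.\<close>

lemma lie_bracket_tangent:
  assumes W: "mopen A W" and X: "smooth_field A W X" and Y: "smooth_field A W Y" and x: "x \<in> W"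
  shows "lie_bracket A X Y x \<in> tangent_space A x"
proof -
  have xp: "x \<in> points A" using W x by (auto simp: mopen_def)
  show ?thesis
    unfolding nabla_torsion_free[of A g x X Y, OF M xp smooth_field_tangent[OF X x] smooth_field_tangent[OF Y x], symmetric]
    by (intro tangent_diff xp smooth_field_tangent[OF _ x] smooth_field_nabla W X Y)
qed

text \<open>Tensoriality: second derivatives of \<open>Z\<close> cancel by symmetry, and derivatives
  of \<open>X\<close> and \<open>Y\<close> cancel against the bracket term, so only values at
  \<open>x\<close> survive.\<close>

lemma curvature_chart:
  assumes W: "mopen A W" and X: "smooth_field A W X" and Y: "smooth_field A W Y" and Z: "smooth_field A W Z"
    and x: "x \<in> W" and d: "d \<in> charts_at A x"
  shows "curvature A g X Y Z x d = Rm d (cmap d x) (X x d) (Y x d) (Z x d)"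
proof -
  interpret C: riemannian_chart "cmap d ` cdom d" "metric_comp A g d" "christoffel A g d"
    by (rule chart_riemannian[OF charts_atD(1)[OF d]])
  let ?y = "cmap d x"
  have y: "?y \<in> cmap d ` cdom d" using charts_atD(2)[OF d] by blast
  note T = smooth_field_tangent[OF _ x]
  have lin: "linear (D1 d Z ?y)" by (rule has_derivative_linear[OF has_derivative_field_rep[OF Z x d]])
  have 1: "nabla A g X (nabla A g Y Z) x d =
      D2 d Z ?y (X x d) (Y x d) + D1 d Z ?y (D1 d Y ?y (X x d))
      + (DGam d ?y (X x d) (Y x d) (Z x d) + christoffel A g d ?y (D1 d Y ?y (X x d)) (Z x d)
        + christoffel A g d ?y (Y x d) (D1 d Z ?y (X x d)))
      + christoffel A g d ?y (X x d) (D1 d Z ?y (Y x d) + christoffel A g d ?y (Y x d) (Z x d))"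
    if X: "smooth_field A W X" and Y: "smooth_field A W Y" for X Y
    unfolding nabla_def[of _ _ X] cov_deriv_chart[OF d T[OF X] has_derivative_field_rep_nabla[OF W Y Z x d]]
    unfolding nabla_def cov_deriv_smooth[OF Z x d T[OF Y]] by (rule refl)
  have 2: "nabla A g (lie_bracket A X Y) Z x d = D1 d Z ?y (D1 d Y ?y (X x d) - D1 d X ?y (Y x d))
      + christoffel A g d ?y (D1 d Y ?y (X x d) - D1 d X ?y (Y x d)) (Z x d)"
    unfolding nabla_def cov_deriv_smooth[OF Z x d lie_bracket_tangent[OF W X Y x]] lie_bracket_chart[OF X Y x d]
    by (rule refl)
  show ?thesis
    unfolding curvature_def fun_diff_def 1[OF X Y] 1[OF Y X] 2 C.Riem_def
    by (simp add: linear_diff[OF lin] C.G_simps[OF y] D2_sym[OF W Z x d, of "X x d"])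
qed

text \<open>The derivative of \<open>extend A x v\<close> occurs in both terms of the definition and
  cancels, so the choice of extension leaves no trace.\<close>

lemma second_cov_deriv_chart:
  assumes V: "smooth_field A (points A) V" and d: "d \<in> charts_at A x"
    and u: "u \<in> tangent_space A x" and v: "v \<in> tangent_space A x"
  shows "second_cov_deriv A g V x u v d =
    D2 d V (cmap d x) (u d) (v d) + DGam d (cmap d x) (u d) (v d) (V x d)
      + christoffel A g d (cmap d x) (v d) (D1 d V (cmap d x) (u d))
      + christoffel A g d (cmap d x) (u d) (D1 d V (cmap d x) (v d) + christoffel A g d (cmap d x) (v d) (V x d))
      - D1 d V (cmap d x) (christoffel A g d (cmap d x) (u d) (v d))
      - christoffel A g d (cmap d x) (christoffel A g d (cmap d x) (u d) (v d)) (V x d)"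
proof -
  interpret C: riemannian_chart "cmap d ` cdom d" "metric_comp A g d" "christoffel A g d"
    by (rule chart_riemannian[OF charts_atD(1)[OF d]])
  let ?y = "cmap d x"
  have y: "?y \<in> cmap d ` cdom d" using charts_atD(2)[OF d] by blast
  have xp: "x \<in> points A" by (rule points_charts[OF d])
  obtain W where W: "mopen A W" and x: "x \<in> W" and E: "smooth_field A W (extend A x v)" and Ex: "extend A x v x = v"
    using smooth_field_extend[OF xp v] by blast
  have VW: "smooth_field A W V" using smooth_field_subset[OF V W] W by (simp add: mopen_def)
  have lin: "linear (D1 d V ?y)" by (rule has_derivative_linear[OF has_derivative_field_rep[OF VW x d]])
  have E': "cov_deriv A g (extend A x v) x u d = D1 d (extend A x v) ?y (u d) + christoffel A g d ?y (u d) (v d)"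
    using cov_deriv_smooth[OF E x d u] Ex by simp
  have n: "nabla A g (extend A x v) V x d = D1 d V ?y (v d) + christoffel A g d ?y (v d) (V x d)"
    unfolding nabla_def Ex by (rule cov_deriv_smooth[OF VW x d v])
  show ?thesis
    unfolding second_cov_deriv_def fun_diff_def cov_deriv_chart[OF d u has_derivative_field_rep_nabla[OF W E VW x d]]
      cov_deriv_smooth[OF VW x d cov_deriv_tangent[OF E W x u]] E' n Ex
    by (simp add: linear_add[OF lin] C.G_simps[OF y])
qed

section \<open>Traces and gradients in orthonormal bases\<close>

lemma ortho_chart:
  assumes d: "d \<in> charts_at A x" and b: "orthonormal_basis A g x b"
  shows "ortho_at d (cmap d x) (\<lambda>i. b i d)"
proof -
  interpret C: riemannian_chart "cmap d ` cdom d" "metric_comp A g d" "christoffel A g d"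
    by (rule chart_riemannian[OF charts_atD(1)[OF d]])
  show ?thesis
    unfolding C.ortho_def
  proof (intro ballI)
    fix i j assume ij: "i \<in> {1..DIM('a)}" "j \<in> {1..DIM('a)}"
    then have "b i \<in> tangent_space A x" "b j \<in> tangent_space A x" "g x (b i) (b j) = (if i = j then 1 else 0)"
      using b unfolding orthonormal_basis_def by blast+
    then show "metric_comp A g d (cmap d x) (b i d) (b j d) = (if i = j then 1 else 0)"
      using metric_chart[OF d] by metis
  qed
qed

lemma orthonormal_frame_exists:
  assumes "x \<in> points A"
  shows "\<exists>W e. x \<in> W \<and> orthonormal_frame A g W e"
proof -
  obtain d where dx: "d \<in> charts_at A x" using chosen_chart[OF assms] by blast
  note d = charts_atD(1)[OF dx]
  interpret C: riemannian_chart "cmap d ` cdom d" "metric_comp A g d" "christoffel A g d"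
    by (rule chart_riemannian[OF d])
  obtain E where E: "\<And>i. i \<in> {1..DIM('a)} \<Longrightarrow> smooth_on (E i) (cmap d ` cdom d)"
    "\<And>y. y \<in> cmap d ` cdom d \<Longrightarrow> C.ortho y (\<lambda>i. E i y)"
    using C.gram_schmidt by blast
  define e where "e i y = coord_vec A d y (E i (cmap d y))" for i y
  have "orthonormal_basis A g y (\<lambda>i. e i y)" if "y \<in> cdom d" for y
  proof -
    have dy: "d \<in> charts_at A y" using d that by (simp add: charts_at_def)
    note T = coord_vec_tangent[OF atlas dy]
    show ?thesis
      using E(2)[of "cmap d y"] that
      by (simp add: orthonormal_basis_def e_def T C.ortho_def metric_chart[OF dy])
  qed
  moreover have "smooth_field A (cdom d) (e i)" if "i \<in> {1..DIM('a)}" for i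
    using smooth_field_coord[OF d E(1)[OF that]] by (simp add: e_def[abs_def])
  ultimately have "orthonormal_frame A g (cdom d) e"
    by (simp add: orthonormal_frame_def openin_manifold_topology mopen_cdom[OF d])
  then show ?thesis using charts_atD(2)[OF dx] by blast
qed

text \<open>Names the basis chosen by \<open>metric_trace\<close>, so that all traces at a point are
  sums over one and the same basis.\<close>

definition onb :: "'m \<Rightarrow> nat \<Rightarrow> ('m, 'a) tvec" where
  "onb x = (SOME b. orthonormal_basis A g x b)"

lemma onb:
  assumes "x \<in> points A"
  shows "orthonormal_basis A g x (onb x)"
proof -
  have "\<exists>b. orthonormal_basis A g x b"
    using orthonormal_frame_exists[OF assms] unfolding orthonormal_frame_def by blast
  then show ?thesis unfolding onb_def by (rule someI_ex)
qed

lemma onb_tangent: "x \<in> points A \<Longrightarrow> i \<in> {1..DIM('a)} \<Longrightarrow> onb x i \<in> tangent_space A x"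
  using onb unfolding orthonormal_basis_def by blast

lemma metric_trace_onb: "metric_trace A g x \<beta> = (\<Sum>i = 1..DIM('a). \<beta> (onb x i) (onb x i))"
  by (simp add: metric_trace_def onb_def Let_def)

text \<open>By compatibility the derivative of half the squared norm along \<open>u\<close> is the
  inner product of \<open>V\<close> with its covariant derivative along \<open>u\<close>. The
  right-hand side represents this linear form, and nondegeneracy makes it the only vector that does,
  as the definite description requires.\<close>

lemma gradient_half_norm_sq:
  assumes V: "smooth_field A (points A) V" and x: "x \<in> points A"
  shows "grad_half_norm_sq A g V x =
    (\<Sum>i = 1..DIM('a). g x (cov_deriv A g V x (onb x i)) (V x) *\<^sub>R onb x i)"
proof -
  obtain d where d: "d \<in> charts_at A x" using chosen_chart[OF x] by blast
  interpret C: riemannian_chart "cmap d ` cdom d" "metric_comp A g d" "christoffel A g d"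
    by (rule chart_riemannian[OF charts_atD(1)[OF d]])
  let ?y = "cmap d x" and ?S = "cmap d ` cdom d" and ?m = "metric_comp A g d"
  let ?K = "\<lambda>u. D1 d V ?y u + christoffel A g d ?y u (V x d)"
  have y: "?y \<in> cmap d ` cdom d" using charts_atD(2)[OF d] by blast
  note Vx = smooth_field_tangent[OF V x]
  have K: "cov_deriv A g V x u d = ?K (u d)" if "u \<in> tangent_space A x" for u
    by (rule cov_deriv_smooth[OF V x d that])
  have gK: "g x (cov_deriv A g V x u) (V x) = ?m ?y (?K (u d)) (V x d)" if "u \<in> tangent_space A x" for u
    using metric_chart[OF d cov_deriv_tangent[OF V mopen_points x that] Vx] K[OF that] by simp
  have "((\<lambda>y. ?m y (field_rep d V y) (field_rep d V y)) has_derivative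
      (\<lambda>w. ?m ?y (D1 d V ?y w + christoffel A g d ?y w (field_rep d V ?y)) (field_rep d V ?y)
        + ?m ?y (field_rep d V ?y) (D1 d V ?y w + christoffel A g d ?y w (field_rep d V ?y)))) (at ?y)"
    by (rule C.has_derivative_m[OF y has_derivative_ident has_derivative_field_rep[OF V x d] has_derivative_field_rep[OF V x d]])
  then have D: "((\<lambda>y. ?m y (field_rep d V y) (field_rep d V y)) has_derivative
      (\<lambda>w. 2 * ?m ?y (?K w) (V x d))) (at ?y)"
    by (simp add: field_rep_cmap[OF d] C.m_sym[OF y, of "V x d"])
  have "((\<lambda>y. ?m y (field_rep d V y) (field_rep d V y) / 2) has_derivative
      (\<lambda>w. ?m ?y (?K w) (V x d))) (at ?y)"
    using has_derivative_mult_right[OF D, of "1/2"] by simp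
  then have "((\<lambda>y. g (cinv d y) (V (cinv d y)) (V (cinv d y)) / 2) has_derivative
      (\<lambda>w. ?m ?y (?K w) (V x d))) (at ?y)"
  proof (rule has_derivative_transform_within_open[OF _ C.open_S y])
    fix z assume z: "z \<in> ?S"
    have dz: "d \<in> charts_at A (cinv d z)" by (rule charts_at_cinv[OF charts_atD(1)[OF d] z])
    have "V (cinv d z) \<in> tangent_space A (cinv d z)" using smooth_field_tangent[OF V points_charts[OF dz]] .
    from metric_chart[OF dz this this]
    show "?m z (field_rep d V z) (field_rep d V z) / 2 = g (cinv d z) (V (cinv d z)) (V (cinv d z)) / 2"
      by (simp add: field_rep_def cmap_cinv[OF z])
  qed
  from dir_deriv_chart[OF d _ this]
  have dir: "dir_deriv A (\<lambda>y. g y (V y) (V y) / 2) x u = ?m ?y (?K (u d)) (V x d)" if "u \<in> tangent_space A x" for u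
    using that by blast
  define v where "v = (\<Sum>i = 1..DIM('a). g x (cov_deriv A g V x (onb x i)) (V x) *\<^sub>R onb x i)"
  have v: "v \<in> tangent_space A x"
    unfolding v_def by (intro tangent_sum tangent_scaleR x onb_tangent)
  have vd: "v d = (\<Sum>i = 1..DIM('a). ?m ?y (?K (onb x i d)) (V x d) *\<^sub>R onb x i d)"
    unfolding v_def sum_fun_apply scaleR_fun_def by (intro sum.cong refl) (simp add: gK onb_tangent[OF x])
  have lin: "linear (D1 d V ?y)" by (rule has_derivative_linear[OF has_derivative_field_rep[OF V x d]])
  have linK: "linear (\<lambda>u. ?m ?y (?K u) (V x d))"
    by (rule linearI) (simp_all add: linear_add[OF lin] linear_scale[OF lin] C.G_simps[OF y] C.m_simps[OF y] algebra_simps)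
  have grad: "g x v u = dir_deriv A (\<lambda>y. g y (V y) (V y) / 2) x u" if u: "u \<in> tangent_space A x" for u
  proof -
    have "g x v u = (\<Sum>i = 1..DIM('a). ?m ?y (?K (onb x i d)) (V x d) * ?m ?y (u d) (onb x i d))"
      unfolding metric_chart[OF d v u] vd by (simp add: C.m_simps[OF y] C.m_sym[OF y, of "u d"])
    also have "\<dots> = (\<Sum>i = 1..DIM('a). ?m ?y (?K (?m ?y (u d) (onb x i d) *\<^sub>R onb x i d)) (V x d))"
      using linear_scale[OF linK] by (simp add: mult.commute)
    also have "\<dots> = ?m ?y (?K (\<Sum>i = 1..DIM('a). ?m ?y (u d) (onb x i d) *\<^sub>R onb x i d)) (V x d)"
      by (rule linear_sum[OF linK, symmetric])
    also have "\<dots> = ?m ?y (?K (u d)) (V x d)"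
      using C.ortho_expand[OF y ortho_chart[OF d onb[OF x]], of "u d"] by simp
    finally show ?thesis using dir[OF u] by simp
  qed
  have "v' = v" if v': "v' \<in> tangent_space A x" "\<forall>u\<in>tangent_space A x. g x v' u = dir_deriv A (\<lambda>y. g y (V y) (V y) / 2) x u" for v'
  proof (rule tangent_eqI[OF d v'(1) v], rule C.m_eqI[OF y])
    fix z
    note T = coord_vec_tangent[OF atlas d, of z]
    have "g x v' (coord_vec A d x z) = g x v (coord_vec A d x z)" using v'(2) grad T(1) by simp
    then show "?m ?y (v' d) z = ?m ?y (v d) z"
      using metric_chart[OF d v'(1) T(1)] metric_chart[OF d v T(1)] T(2) by simp
  qed
  then show ?thesis
    unfolding grad_half_norm_sq_def gradient_def v_def[symmetric]
    by (intro the_equality) (use v grad in blast)+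
qed

text \<open>In a chart the summand depends only on the value of \<open>e i\<close> at
  \<open>x\<close> and is the diagonal of a bilinear map, so its trace may be taken in the chosen
  basis.\<close>

lemma curvature_trace_frame:
  assumes V: "smooth_field A (points A) V" and e: "orthonormal_frame A g W e" and x: "x \<in> W" and d: "d \<in> charts_at A x"
  shows "(\<Sum>i = 1..DIM('a). curvature A g V (nabla A g (e i) V) (e i) x) d =
    (\<Sum>i = 1..DIM('a). Rm d (cmap d x) (V x d) (cov_deriv A g V x (onb x i) d) (onb x i d))"
proof -
  interpret C: riemannian_chart "cmap d ` cdom d" "metric_comp A g d" "christoffel A g d"
    by (rule chart_riemannian[OF charts_atD(1)[OF d]])
  let ?y = "cmap d x" and ?s = "V x d"
  have y: "?y \<in> cmap d ` cdom d" using charts_atD(2)[OF d] by blast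
  have W: "mopen A W" using e by (simp add: orthonormal_frame_def openin_manifold_topology)
  have xp: "x \<in> points A" by (rule points_charts[OF d])
  have VW: "smooth_field A W V" using smooth_field_subset[OF V W] W by (simp add: mopen_def)
  have es: "smooth_field A W (e i)" if "i \<in> {1..DIM('a)}" for i using e that by (simp add: orthonormal_frame_def)
  have lin: "linear (D1 d V ?y)" by (rule has_derivative_linear[OF has_derivative_field_rep[OF V xp d]])
  define \<beta> where "\<beta> u v = Rm d ?y ?s (D1 d V ?y u + christoffel A g d ?y u ?s) v" for u v
  have \<beta>: "bilinear \<beta>"
    unfolding bilinear_def \<beta>_def
    by (intro conjI allI linearI) (simp_all add: C.Riem_simps[OF y] linear_add[OF lin] linear_scale[OF lin] C.G_simps[OF y] algebra_simps)
  have K: "cov_deriv A g V x u d = D1 d V ?y (u d) + christoffel A g d ?y (u d) ?s" if "u \<in> tangent_space A x" for u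
    by (rule cov_deriv_smooth[OF V xp d that])
  have "(\<Sum>i = 1..DIM('a). curvature A g V (nabla A g (e i) V) (e i) x) d = (\<Sum>i = 1..DIM('a). \<beta> (e i x d) (e i x d))"
    unfolding sum_fun_apply
  proof (intro sum.cong refl)
    fix i assume "i \<in> {1..DIM('a)}"
    note ei = es[OF this]
    have "nabla A g (e i) V x d = D1 d V ?y (e i x d) + christoffel A g d ?y (e i x d) ?s"
      unfolding nabla_def by (rule K[OF smooth_field_tangent[OF ei x]])
    then show "curvature A g V (nabla A g (e i) V) (e i) x d = \<beta> (e i x d) (e i x d)"
      by (simp only: curvature_chart[OF W VW smooth_field_nabla[OF W ei VW] ei x d] \<beta>_def)
  qed
  also have "\<dots> = (\<Sum>i = 1..DIM('a). \<beta> (onb x i d) (onb x i d))"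
    using e x by (intro C.ortho_trace_unique[OF y _ _ \<beta>] ortho_chart[OF d] onb xp) (simp add: orthonormal_frame_def)
  also have "\<dots> = (\<Sum>i = 1..DIM('a). Rm d ?y ?s (cov_deriv A g V x (onb x i) d) (onb x i d))"
    unfolding \<beta>_def by (intro sum.cong refl) (simp add: K onb_tangent[OF xp])
  finally show ?thesis .
qed

lemma curvature_outside: "d \<notin> charts_at A x \<Longrightarrow> curvature A g X Y Z x d = 0"
  by (simp add: curvature_def nabla_def cov_deriv_def cov_deriv_along_def)

end

subsection \<open>The tangent bundle\<close>

text \<open>The difference \<open>T\<close> is symmetric in its first two arguments and skew in its
  last two; six alternating swaps return to the start with the opposite sign.\<close>

lemma levi_civita_unique:
  fixes B :: "'v \<Rightarrow> 'v \<Rightarrow> real" and \<Gamma> \<Gamma>' :: "'v \<Rightarrow> 'v \<Rightarrow> 'v"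
  assumes sym: "\<And>u v. B u v = B v u" and nondeg: "\<And>u v. (\<And>z. B u z = B v z) \<Longrightarrow> u = v"
    and \<Gamma>: "\<And>u v. \<Gamma> u v = \<Gamma> v u" and \<Gamma>': "\<And>u v. \<Gamma>' u v = \<Gamma>' v u"
    and compat: "\<And>u v w. B (\<Gamma> w u) v + B u (\<Gamma> w v) = B (\<Gamma>' w u) v + B u (\<Gamma>' w v)"
  shows "\<Gamma> w u = \<Gamma>' w u"
proof (rule nondeg)
  fix v
  define T where "T w u v = B (\<Gamma> w u) v - B (\<Gamma>' w u) v" for w u v
  have 1: "T w u v = T u w v" for w u v by (simp add: T_def \<Gamma>[of w] \<Gamma>'[of w])
  have 2: "T w u v = - T w v u" for w u v
    using compat[of w u v] sym[of u "\<Gamma> w v"] sym[of u "\<Gamma>' w v"] by (simp add: T_def)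
  have "T w u v = 0"
    using 2[of w u v] 1[of w v u] 2[of v w u] 1[of v u w] 2[of u v w] 1[of u w v] by linarith
  then show "B (\<Gamma> w u) v = B (\<Gamma>' w u) v" by (simp add: T_def)
qed

context atlas
begin

lemma cdom_tangent_chart: "cdom (tangent_chart A d) = {(x, v). x \<in> cdom d \<and> v \<in> tangent_space A x}"
  by (simp add: tangent_chart_def)

lemma cmap_tangent_chart: "cmap (tangent_chart A d) (x, v) = (cmap d x, v d)"
  by (simp add: tangent_chart_def)

lemma charts_at_tangent_bundle:
  assumes "v \<in> tangent_space A x"
  shows "charts_at (tangent_bundle A) (x, v) = tangent_chart A ` charts_at A x"
  unfolding charts_at_def tangent_bundle_def using assms by (auto simp: cdom_tangent_chart simp del: split_paired_All split_paired_Ex)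

lemma cinv_tangent_chart:
  assumes d: "d \<in> charts_at A x"
  shows "cinv (tangent_chart A d) (cmap d x, w) = (x, coord_vec A d x w)"
proof -
  have "inj_on (cmap (tangent_chart A d)) (cdom (tangent_chart A d))"
  proof (rule inj_onI)
    fix e e' assume "e \<in> cdom (tangent_chart A d)" "e' \<in> cdom (tangent_chart A d)"
      and eq: "cmap (tangent_chart A d) e = cmap (tangent_chart A d) e'"
    then obtain y v y' v' where e: "e = (y, v)" "e' = (y', v')" "y \<in> cdom d" "y' \<in> cdom d"
      "v \<in> tangent_space A y" "v' \<in> tangent_space A y'"
      by (auto simp: cdom_tangent_chart)
    then have "y = y'" "v d = v' d"
      using eq inj_onD[OF inj_chart[OF charts_atD(1)[OF d]]] by (simp_all add: cmap_tangent_chart)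
    moreover have "d \<in> charts_at A y" using e(3) charts_atD(1)[OF d] by (simp add: charts_at_def)
    ultimately show "e = e'" using e tangent_eqI[of d y v v'] by simp
  qed
  then show ?thesis
    unfolding cinv_def
    by (rule inv_into_f_eq)
      (simp_all add: cmap_tangent_chart cdom_tangent_chart charts_atD[OF d] coord_vec_tangent[OF atlas d])
qed

lemma transition_tangent_chart:
  assumes "y \<in> cmap c ` (cdom c \<inter> cdom d)" "c \<in> A" "d \<in> A"
  shows "transition (tangent_chart A c) (tangent_chart A d) (y, w) = (transition c d y, jac c d y w)"
proof -
  obtain x where x: "x \<in> cdom c" "x \<in> cdom d" "y = cmap c x" using assms(1) by blast
  then have c: "c \<in> charts_at A x" and d: "d \<in> charts_at A x" using assms by (simp_all add: charts_at_def)
  show ?thesis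
    using d by (simp add: x(3) cinv_tangent_chart[OF c] cmap_tangent_chart coord_vec_def cinv_cmap[OF atlas c])
qed

text \<open>Fibre components transform by the Jacobian, which varies with the base point; this is
  the origin of the \<open>hess\<close> term.\<close>

lemma has_derivative_transition_tangent_chart:
  assumes c: "c \<in> charts_at A x" and d: "d \<in> charts_at A x"
  shows "(transition (tangent_chart A c) (tangent_chart A d) has_derivative
    (\<lambda>w. (jac c d (cmap c x) (fst w), hess c d (cmap c x) (fst w) v + jac c d (cmap c x) (snd w)))) (at (cmap c x, v))"
proof -
  let ?O = "cmap c ` (cdom c \<inter> cdom d)"
  have O: "open ?O" "cmap c x \<in> ?O" using open_overlap c d by (auto simp: charts_at_def)
  have lin: "linear (jac c d y)" if "y \<in> ?O" for y
  proof -
    from that obtain x' where "x' \<in> cdom c" "x' \<in> cdom d" "y = cmap c x'" by blast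
    then show ?thesis using linear_jac[of c x' d] c d by (simp add: charts_at_def)
  qed
  have fst: "(fst has_derivative fst) (at (cmap c x, v))" and snd: "(snd has_derivative snd) (at (cmap c x, v))"
    by (rule bounded_linear_imp_has_derivative, rule bounded_linear_fst bounded_linear_snd)+
  have 1: "((\<lambda>e. transition c d (fst e)) has_derivative (\<lambda>w. jac c d (cmap c x) (fst w))) (at (cmap c x, v))"
    by (rule has_derivative_compose[OF fst]) (simp only: fst_conv, rule has_derivative_transition[OF c d])
  have 2: "((\<lambda>e. jac c d (fst e) (snd e)) has_derivative
      (\<lambda>w. hess c d (cmap c x) (fst w) v + jac c d (cmap c x) (snd w))) (at (cmap c x, v))"
    using has_derivative_linear_family[where L = "jac c d" and Y = fst and a = snd and x = "(cmap c x, v)"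
        and D = "\<lambda>u w. hess c d (cmap c x) w u", OF O(1) _ lin _ fst snd]
      has_derivative_jac[OF c d] O(2) by simp
  show ?thesis
    by (rule has_derivative_transform_within_open[OF has_derivative_Pair[OF 1 2], of "?O \<times> UNIV"])
      (use O charts_atD(1)[OF c] charts_atD(1)[OF d] in \<open>auto simp: open_Times transition_tangent_chart simp del: comp_apply\<close>)
qed

lemma coord_vec_tangent_bundle:
  assumes d: "d \<in> charts_at A x" and c: "c \<in> charts_at A x" and v: "v \<in> tangent_space A x"
  shows "coord_vec (tangent_bundle A) (tangent_chart A d) (x, v) w (tangent_chart A c) =
    (jac d c (cmap d x) (fst w), hess d c (cmap d x) (fst w) (v d) + jac d c (cmap d x) (snd w))"
proof -
  have "tangent_chart A c \<in> charts_at (tangent_bundle A) (x, v)"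
    using c by (simp add: charts_at_tangent_bundle[OF v])
  then show ?thesis
    by (simp add: coord_vec_def cmap_tangent_chart
        frechet_derivative_eqI[OF has_derivative_transition_tangent_chart[OF d c]])
qed

lemma differential_projection:
  assumes d: "d \<in> charts_at A x" and v: "v \<in> tangent_space A x"
  shows "differential (tangent_bundle A) A fst (x, v)
    (coord_vec (tangent_bundle A) (tangent_chart A d) (x, v) w) = coord_vec A d x (fst w)"
proof
  fix c
  show "differential (tangent_bundle A) A fst (x, v)
    (coord_vec (tangent_bundle A) (tangent_chart A d) (x, v) w) c = coord_vec A d x (fst w) c"
  proof (cases "c \<in> charts_at A x")
    case c: True
    \<comment> \<open>\<open>dir_deriv_chart\<close> presupposes a smooth atlas, so for the bundle
      the chosen chart is treated directly: it lies over some chart \<open>b\<close> of the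
      base.\<close>
    define k where "k = (SOME k. k \<in> charts_at (tangent_bundle A) (x, v))"
    have "k \<in> charts_at (tangent_bundle A) (x, v)"
      unfolding k_def by (rule someI[of _ "tangent_chart A d"]) (simp add: charts_at_tangent_bundle[OF v] d)
    then obtain b where b: "b \<in> charts_at A x" "k = tangent_chart A b"
      unfolding charts_at_tangent_bundle[OF v] by blast
    let ?O = "cmap b ` (cdom b \<inter> cdom c)"
    have O: "open ?O" "cmap b x \<in> ?O" using open_overlap b c by (auto simp: charts_at_def)
    have fst: "(fst has_derivative fst) (at (cmap b x, v b))"
      by (rule bounded_linear_imp_has_derivative, rule bounded_linear_fst)
    have "((\<lambda>e. transition b c (fst e)) has_derivative (\<lambda>w. jac b c (cmap b x) (fst w))) (at (cmap b x, v b))"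
      by (rule has_derivative_compose[OF fst]) (simp only: fst_conv, rule has_derivative_transition[OF b(1) c])
    then have "((\<lambda>e. cmap c (fst e)) \<circ> cinv k has_derivative (\<lambda>w. jac b c (cmap b x) (fst w))) (at (cmap b x, v b))"
    proof (rule has_derivative_transform_within_open[where s = "?O \<times> UNIV"])
      fix e assume "e \<in> ?O \<times> (UNIV :: 'a set)"
      then obtain y w where y: "y \<in> cdom b" "e = (cmap b y, w)" by blast
      then have "b \<in> charts_at A y" using b by (simp add: charts_at_def)
      then show "transition b c (fst e) = ((\<lambda>e. cmap c (fst e)) \<circ> cinv k) e"
        by (simp add: b y cinv_tangent_chart cinv_cmap[OF atlas])
    qed (use O in \<open>auto simp: open_Times\<close>)
    from frechet_derivative_eqI[OF this]
    have "differential (tangent_bundle A) A fst (x, v)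
        (coord_vec (tangent_bundle A) (tangent_chart A d) (x, v) w) c = jac b c (cmap b x) (jac d b (cmap d x) (fst w))"
      using c by (simp add: differential_def dir_deriv_def Let_def k_def[symmetric])
        (simp add: b cmap_tangent_chart coord_vec_tangent_bundle[OF d b(1) v])
    then show ?thesis
      using c by (simp only: chart_change_cocycle[OF atlas d b(1) c] coord_vec_def if_True)
  qed (simp add: differential_def coord_vec_def)
qed

end


context riemannian
begin

text \<open>The \<open>hess\<close> term of the bundle transition is the one in
  \<open>christoffel_transition\<close>, so the components given by \<open>connection_map\<close> in
  different charts fit together.\<close>

lemma connection_map_coord_vec:
  assumes d: "d \<in> charts_at A x" and v: "v \<in> tangent_space A x"
  shows "connection_map A g (x, v) (coord_vec (tangent_bundle A) (tangent_chart A d) (x, v) w) =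
    coord_vec A d x (snd w + christoffel A g d (cmap d x) (fst w) (v d))"
proof
  fix c
  show "connection_map A g (x, v) (coord_vec (tangent_bundle A) (tangent_chart A d) (x, v) w) c =
    coord_vec A d x (snd w + christoffel A g d (cmap d x) (fst w) (v d)) c"
  proof (cases "c \<in> charts_at A x")
    case c: True
    have "coord_vec A d x u c = jac d c (cmap d x) u" for u using c by (simp add: coord_vec_def)
    then show ?thesis
      using c christoffel_transition[OF d c, of "fst w" "v d"] linear_add[OF linear_jac[OF d c]]
        tangent_comp[OF d c v]
      by (simp add: connection_map_def coord_vec_tangent_bundle[OF d c v])
  qed (simp add: connection_map_def coord_vec_def)
qed

end


section \<open>A vector field as a map into the tangent bundle\<close>

locale cheeger_gromoll_bundle = riemannian A g
  for A :: "('m, 'a::euclidean_space) chart set" and g +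
  fixes p q :: real and \<sigma> :: "'m \<Rightarrow> ('m, 'a) tvec"
  assumes q_nonneg: "q \<ge> 0" and \<sigma>: "smooth_field A (points A) \<sigma>"
begin

abbreviation "TM \<equiv> tangent_bundle A"
abbreviation "h \<equiv> cheeger_gromoll A g p q"
abbreviation "sect \<equiv> \<lambda>x. (x, \<sigma> x)"

lemma chart_cg: "d \<in> A \<Longrightarrow> cheeger_gromoll_chart (cmap d ` cdom d) (metric_comp A g d) (christoffel A g d) q"
  by (intro cheeger_gromoll_chart.intro chart_riemannian cheeger_gromoll_chart_axioms.intro q_nonneg)

abbreviation "om_at d \<equiv> cheeger_gromoll_chart.om (metric_comp A g d)"
abbreviation "N_at d \<equiv> cheeger_gromoll_chart.N (metric_comp A g d) p q"
abbreviation "H_at d \<equiv> cheeger_gromoll_chart.H (metric_comp A g d) (christoffel A g d) p"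
abbreviation "cg_at d \<equiv> cheeger_gromoll_chart.cg (metric_comp A g d) (christoffel A g d) p q"
abbreviation "cg_conn_at d \<equiv> cheeger_gromoll_chart.cg_conn (metric_comp A g d) (christoffel A g d) p q"

lemma omega_chart:
  assumes d: "d \<in> charts_at A x" and v: "v \<in> tangent_space A x"
  shows "omega g x v = om_at d (cmap d x) (v d)"
proof -
  interpret C: cheeger_gromoll_chart "cmap d ` cdom d" "metric_comp A g d" "christoffel A g d" p q
    by (rule chart_cg[OF charts_atD(1)[OF d]])
  show ?thesis by (simp add: omega_def C.om_def metric_chart[OF d v v])
qed

lemma metric_comp_tangent_bundle:
  assumes d: "d \<in> A" and e: "e \<in> (cmap d ` cdom d) \<times> UNIV"
  shows "metric_comp TM h (tangent_chart A d) e w w' = cg_at d e w w'"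
proof -
  interpret C: cheeger_gromoll_chart "cmap d ` cdom d" "metric_comp A g d" "christoffel A g d" p q
    by (rule chart_cg[OF d])
  obtain x v where x: "x \<in> cdom d" "e = (cmap d x, v)" using e by blast
  then have dx: "d \<in> charts_at A x" using d by (simp add: charts_at_def)
  note T = coord_vec_tangent[OF atlas dx]
  show ?thesis
    by (simp add: metric_comp_def[of TM] x(2) cinv_tangent_chart[OF dx] cheeger_gromoll_def Let_def
        differential_projection[OF dx T(1)] connection_map_coord_vec[OF dx T(1)] metric_chart[OF dx T(1) T(1)] T(2)
        omega_chart[OF dx T(1)] C.cg_def C.vert_def)
qed

text \<open>\<open>levi_civita_ex1\<close> asks for a Riemannian manifold, so the definite
  description is resolved by hand: \<open>C.cg_conn\<close> has the defining properties, and
  positivity of \<open>C.cg\<close> gives the nondegeneracy behind uniqueness.\<close>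

lemma christoffel_tangent_bundle:
  assumes d: "d \<in> A" and e: "e \<in> (cmap d ` cdom d) \<times> UNIV"
  shows "christoffel TM h (tangent_chart A d) e = cg_conn_at d e"
proof -
  interpret C: cheeger_gromoll_chart "cmap d ` cdom d" "metric_comp A g d" "christoffel A g d" p q
    by (rule chart_cg[OF d])
  let ?S = "(cmap d ` cdom d) \<times> (UNIV :: 'a set)"
  have S: "open ?S" by (intro open_Times C.open_S open_UNIV)
  have fe: "fst e \<in> cmap d ` cdom d" using e by auto
  note mc = metric_comp_tangent_bundle[OF d]
  have "frechet_derivative (\<lambda>z. metric_comp TM h (tangent_chart A d) z u v) (at e) =
      frechet_derivative (\<lambda>z. C.cg z u v) (at e)" for u v
    by (rule frechet_derivative_cong_open[OF S e mc])
  then have D: "frechet_derivative (\<lambda>z. metric_comp TM h (tangent_chart A d) z u v) (at e) w =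
      C.cg e (C.cg_conn e w u) v + C.cg e u (C.cg_conn e w v)" for u v w
    by (simp only: frechet_derivative_eqI[OF C.cg_compat[OF fe]])
  have lc: "is_levi_civita_at TM h (tangent_chart A d) e \<Gamma> \<longleftrightarrow> bilinear \<Gamma> \<and> (\<forall>u v. \<Gamma> u v = \<Gamma> v u) \<and>
     (\<forall>u v w. C.cg e (C.cg_conn e w u) v + C.cg e u (C.cg_conn e w v) = C.cg e (\<Gamma> w u) v + C.cg e u (\<Gamma> w v))" for \<Gamma>
    unfolding is_levi_civita_at_def D mc[OF e] by (rule refl)
  show ?thesis
    unfolding christoffel_def[of TM h]
  proof (rule the_equality)
    show "is_levi_civita_at TM h (tangent_chart A d) e (C.cg_conn e)"
      unfolding lc using C.cg_conn_bilinear[OF fe] C.cg_conn_sym[OF fe] by blast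
    fix \<Gamma> assume \<Gamma>: "is_levi_civita_at TM h (tangent_chart A d) e \<Gamma>"
    have nondeg: "u = v" if "\<And>z. C.cg e u z = C.cg e v z" for u v
    proof (rule ccontr)
      assume "u \<noteq> v"
      then have "C.cg e (u - v) (u - v) > 0" by (intro C.cg_pos fe) simp
      then show False using that[of "u - v"] by (simp add: bilinear_simps(3)[OF C.cg_bilinear[OF fe]])
    qed
    show "\<Gamma> = C.cg_conn e"
    proof (intro ext)
      fix w u
      have 1: "\<Gamma> u v = \<Gamma> v u" for u v using \<Gamma> unfolding lc by blast
      have 2: "C.cg e (C.cg_conn e w u) v + C.cg e u (C.cg_conn e w v) = C.cg e (\<Gamma> w u) v + C.cg e u (\<Gamma> w v)" for u v w
        using \<Gamma> unfolding lc by blast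
      show "\<Gamma> w u = C.cg_conn e w u"
        by (rule levi_civita_unique[of "C.cg e", OF C.cg_sym[OF fe] nondeg 1 C.cg_conn_sym[OF fe] 2[symmetric]])
    qed
  qed
qed

lemma sect_charts: "x \<in> points A \<Longrightarrow> charts_at TM (sect x) = tangent_chart A ` charts_at A x"
  by (rule charts_at_tangent_bundle[OF smooth_field_tangent[OF \<sigma>]])

lemma smooth_map_sect: "smooth_map A TM sect"
  unfolding smooth_map_def
proof (intro conjI ballI)
  show "sect \<in> points A \<rightarrow> points TM"
    using smooth_field_tangent[OF \<sigma>]
    by (auto simp: points_def tangent_bundle_def cdom_tangent_chart simp del: split_paired_All split_paired_Ex)
  fix c k assume c: "c \<in> A" and "k \<in> TM"
  then obtain d where d: "d \<in> A" "k = tangent_chart A d" by (auto simp: tangent_bundle_def simp del: split_paired_All split_paired_Ex)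
  let ?O = "cmap c ` (cdom c \<inter> cdom d)"
  have "x \<in> points A" if "x \<in> cdom d" for x using d that by (auto simp: points_def simp del: split_paired_All split_paired_Ex)
  then have dom: "cdom c \<inter> sect -` cdom k = cdom c \<inter> cdom d"
    using smooth_field_tangent[OF \<sigma>] by (auto simp: d cdom_tangent_chart)
  have O: "open ?O" by (rule open_overlap[OF c d(1)])
  then show "open (cmap c ` (cdom c \<inter> sect -` cdom k))" by (simp only: dom)
  have tr: "smooth_on (transition c d) ?O" by (rule smooth_transition[OF c d(1)])
  have "cdom d \<inter> points A = cdom d" using d by (auto simp: points_def simp del: split_paired_All split_paired_Ex)
  then have rep: "smooth_on (field_rep d \<sigma>) (cmap d ` cdom d)" using smooth_field_rep[OF \<sigma> d(1)] by simp
  have "smooth_on (\<lambda>y. (transition c d y, field_rep d \<sigma> (transition c d y))) ?O"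
    by (intro smooth_on_Pair O tr smooth_on_compose[OF O open_chart[OF d(1)] _ rep tr])
      (use c in \<open>auto simp: cinv_cmap'\<close>)
  moreover have "(cmap k \<circ> sect \<circ> cinv c) y = (transition c d y, field_rep d \<sigma> (transition c d y))" if "y \<in> ?O" for y
    using that c d by (auto simp: cmap_tangent_chart cinv_cmap' field_rep_def)
  ultimately have "smooth_on (cmap k \<circ> sect \<circ> cinv c) ?O"
    by (simp only: smooth_on_cong[OF O, of "cmap k \<circ> sect \<circ> cinv c"])
  then show "smooth_on (cmap k \<circ> sect \<circ> cinv c) (cmap c ` (cdom c \<inter> sect -` cdom k))"
    by (simp only: dom)
qed

lemma differential_sect:
  assumes d: "d \<in> charts_at A x" and u: "u \<in> tangent_space A x"
  shows "differential A TM sect x u (tangent_chart A d) = (u d, D1 d \<sigma> (cmap d x) (u d))"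
proof -
  have xp: "x \<in> points A" by (rule points_charts[OF d])
  have 1: "((\<lambda>y. cmap d (cinv d y)) has_derivative (\<lambda>u. u)) (at (cmap d x))"
    by (rule has_derivative_transform_within_open[OF has_derivative_ident, of "cmap d ` cdom d"])
      (use d open_chart in \<open>auto simp: charts_at_def cmap_cinv\<close>)
  have "((\<lambda>y. cmap (tangent_chart A d) (sect (cinv d y))) has_derivative (\<lambda>u. (u, D1 d \<sigma> (cmap d x) u))) (at (cmap d x))"
    using has_derivative_Pair[OF 1 has_derivative_field_rep[OF \<sigma> xp d]]
    by (simp add: cmap_tangent_chart field_rep_def[abs_def])
  from dir_deriv_chart[OF d u this] show ?thesis
    using d by (simp add: differential_def sect_charts[OF xp])
qed

lemma nabla_differential_sect:
  assumes d: "d \<in> charts_at A x" and u: "u \<in> tangent_space A x" and v: "v \<in> tangent_space A x"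
  defines "y \<equiv> cmap d x" and "K \<equiv> \<lambda>u. cov_deriv A g \<sigma> x u d"
  shows "nabla_differential A g TM h sect x u v (tangent_chart A d) =
    (H_at d y (\<sigma> x d) (u d) (K u) (v d) (K v),
     second_cov_deriv A g \<sigma> x u v d - (1/2) *\<^sub>R Rm d y (u d) (v d) (\<sigma> x d) + N_at d y (\<sigma> x d) (K u) (K v)
       - christoffel A g d y (H_at d y (\<sigma> x d) (u d) (K u) (v d) (K v)) (\<sigma> x d))"
proof -
  interpret C: cheeger_gromoll_chart "cmap d ` cdom d" "metric_comp A g d" "christoffel A g d" p q
    by (rule chart_cg[OF charts_atD(1)[OF d]])
  let ?D = "D1 d \<sigma> y" and ?G = "christoffel A g d y" and ?s = "\<sigma> x d"
  have y: "y \<in> cmap d ` cdom d" unfolding y_def using charts_atD(2)[OF d] by blast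
  have xp: "x \<in> points A" by (rule points_charts[OF d])
  obtain W where W: "mopen A W" and x: "x \<in> W" and E: "smooth_field A W (extend A x v)" and Ex: "extend A x v x = v"
    using smooth_field_extend[OF xp v] by blast
  let ?E = "extend A x v" and ?S = "cmap d ` (cdom d \<inter> W)"
  let ?DE = "D1 d ?E y (u d)"
  have Wp: "W \<subseteq> points A" using W by (simp add: mopen_def)
  have \<sigma>W: "smooth_field A W \<sigma>" by (rule smooth_field_subset[OF \<sigma> W Wp])
  have S: "open ?S" "y \<in> ?S" using W charts_atD[OF d] x by (auto simp: mopen_def y_def simp del: split_paired_All)
  have "((\<lambda>z. (field_rep d ?E z, D1 d \<sigma> z (field_rep d ?E z))) has_derivative
    (\<lambda>w. (D1 d ?E y w, D2 d \<sigma> y w (field_rep d ?E y) + ?D (D1 d ?E y w)))) (at y)"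
    unfolding y_def
    by (intro has_derivative_Pair has_derivative_field_rep[OF E x d] has_derivative_D1[OF W \<sigma>W x d])
  then have "((\<lambda>z. differential A TM sect (cinv d z) (?E (cinv d z)) (tangent_chart A d)) has_derivative
    (\<lambda>w. (D1 d ?E y w, D2 d \<sigma> y w (field_rep d ?E y) + ?D (D1 d ?E y w)))) (at y)"
  proof (rule has_derivative_transform_within_open[OF _ S])
    fix z assume "z \<in> ?S"
    then obtain x' where x': "x' \<in> cdom d" "x' \<in> W" "z = cmap d x'" by blast
    then have d': "d \<in> charts_at A x'" using charts_atD(1)[OF d] by (simp add: charts_at_def)
    show "(field_rep d ?E z, D1 d \<sigma> z (field_rep d ?E z)) =
        differential A TM sect (cinv d z) (?E (cinv d z)) (tangent_chart A d)"
      unfolding x'(3) cinv_cmap[OF atlas d'] differential_sect[OF d' smooth_field_tangent[OF E x'(2)]] field_rep_cmap[OF d']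
      by (rule refl)
  qed
  from dir_deriv_chart[OF d u this[unfolded y_def], folded y_def]
  have dir: "dir_deriv A (\<lambda>y. differential A TM sect y (?E y) (tangent_chart A d)) x u =
      (?DE, D2 d \<sigma> y (u d) (v d) + ?D ?DE)"
    by (simp add: y_def field_rep_cmap[OF d] Ex)
  have cE: "cov_deriv A g ?E x u d = ?DE + ?G (u d) (v d)"
    using cov_deriv_smooth[OF E x d u] Ex by (simp add: y_def)
  have lin: "linear ?D" unfolding y_def by (rule has_derivative_linear[OF has_derivative_field_rep[OF \<sigma> xp d]])
  \<comment> \<open>The coordinate form of \<open>connection_map_differential\<close>.\<close>
  have K: "C.vert (y, ?s) (u d, ?D (u d)) = K u" if "u \<in> tangent_space A x" for u
    unfolding K_def y_def cov_deriv_smooth[OF \<sigma> xp d that] by (simp add: C.vert_def)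
  have Kv: "K v = ?D (v d) + ?G (v d) ?s"
    unfolding K_def y_def by (rule cov_deriv_smooth[OF \<sigma> xp d v])
  have e: "(y, ?s) \<in> (cmap d ` cdom d) \<times> UNIV" using y by simp
  have "nabla_differential A g TM h sect x u v (tangent_chart A d) =
    (?DE, D2 d \<sigma> y (u d) (v d) + ?D ?DE) + C.cg_conn (y, ?s) (u d, ?D (u d)) (v d, ?D (v d))
      - (?DE + ?G (u d) (v d), ?D (?DE + ?G (u d) (v d)))"
    unfolding nabla_differential_def fun_diff_def cov_deriv_along_def Ex dir
      differential_sect[OF d cov_deriv_tangent[OF E W x u]] differential_sect[OF d u] differential_sect[OF d v] cE
    using d by (simp add: sect_charts[OF xp] cmap_tangent_chart y_def[symmetric] differential_sect[OF d cov_deriv_tangent[OF E W x u], folded y_def]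
        differential_sect[OF d u, folded y_def] differential_sect[OF d v, folded y_def] cE
        christoffel_tangent_bundle[OF charts_atD(1)[OF d] e])
  also have "\<dots> = (C.H y ?s (u d) (K u) (v d) (K v),
     second_cov_deriv A g \<sigma> x u v d - (1/2) *\<^sub>R Rm d y (u d) (v d) ?s + C.N y ?s (K u) (K v)
       - ?G (C.H y ?s (u d) (K u) (v d) (K v)) ?s)"
    unfolding second_cov_deriv_chart[OF \<sigma> d u v, folded y_def]
    by (simp add: C.cg_conn_def C.cg_hor_def C.cg_vert_def K u v C.dvert_def linear_add[OF lin] C.G_simps[OF y])
      (simp add: Kv C.G_simps[OF y] algebra_simps)
  finally show ?thesis .
qed

section \<open>Splitting the harmonic map equation\<close>

lemma tension_zero_iff:
  assumes x: "x \<in> points A"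
  shows "tension_field A g TM h sect x = 0 \<longleftrightarrow>
    (\<forall>d\<in>charts_at A x.
      (\<Sum>i = 1..DIM('a). Rm d (cmap d x) (\<sigma> x d) (cov_deriv A g \<sigma> x (onb x i) d) (onb x i d)) = 0 \<and>
      (\<Sum>i = 1..DIM('a). second_cov_deriv A g \<sigma> x (onb x i) (onb x i) d
        + N_at d (cmap d x) (\<sigma> x d) (cov_deriv A g \<sigma> x (onb x i) d) (cov_deriv A g \<sigma> x (onb x i) d)) = 0)"
proof -
  let ?I = "{1..DIM('a)}" and ?\<tau> = "tension_field A g TM h sect x"
  let ?P = "\<lambda>d. \<Sum>i\<in>?I. Rm d (cmap d x) (\<sigma> x d) (cov_deriv A g \<sigma> x (onb x i) d) (onb x i d)"
  let ?Q = "\<lambda>d. \<Sum>i\<in>?I. second_cov_deriv A g \<sigma> x (onb x i) (onb x i) d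
        + N_at d (cmap d x) (\<sigma> x d) (cov_deriv A g \<sigma> x (onb x i) d) (cov_deriv A g \<sigma> x (onb x i) d)"
  have chart: "?\<tau> (tangent_chart A d) = 0 \<longleftrightarrow> ?P d = 0 \<and> ?Q d = 0" if d: "d \<in> charts_at A x" for d
  proof -
    interpret C: cheeger_gromoll_chart "cmap d ` cdom d" "metric_comp A g d" "christoffel A g d" p q
      by (rule chart_cg[OF charts_atD(1)[OF d]])
    let ?y = "cmap d x" and ?s = "\<sigma> x d" and ?K = "\<lambda>i. cov_deriv A g \<sigma> x (onb x i) d" and ?b = "\<lambda>i. onb x i d"
    have y: "?y \<in> cmap d ` cdom d" using charts_atD(2)[OF d] by blast
    \<comment> \<open>On the diagonal the two summands of \<open>H\<close> coincide and absorb the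
      factor 1/2.\<close>
    have H: "C.H ?y ?s (?b i) (?K i) (?b i) (?K i) = (C.om ?y ?s powr p) *\<^sub>R Rm d ?y ?s (?K i) (?b i)" for i
      by (simp add: C.H_def flip: scaleR_left_distrib scaleR_2)
    have "?\<tau> (tangent_chart A d) = (\<Sum>i\<in>?I. ((C.om ?y ?s powr p) *\<^sub>R Rm d ?y ?s (?K i) (?b i),
        second_cov_deriv A g \<sigma> x (onb x i) (onb x i) d + C.N ?y ?s (?K i) (?K i)
          - christoffel A g d ?y ((C.om ?y ?s powr p) *\<^sub>R Rm d ?y ?s (?K i) (?b i)) ?s))"
      unfolding tension_field_def metric_trace_onb sum_fun_apply
      by (intro sum.cong refl)
        (simp add: nabla_differential_sect[OF d onb_tangent[OF x] onb_tangent[OF x]] C.Riem_self H)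
    also have "\<dots> = ((C.om ?y ?s powr p) *\<^sub>R ?P d, ?Q d - christoffel A g d ?y ((C.om ?y ?s powr p) *\<^sub>R ?P d) ?s)"
      by (simp add: prod_eq_iff fst_sum snd_sum sum_subtractf C.G_simps[OF y] scaleR_right.sum)
    finally have \<tau>: "?\<tau> (tangent_chart A d) =
      ((C.om ?y ?s powr p) *\<^sub>R ?P d, ?Q d - christoffel A g d ?y ((C.om ?y ?s powr p) *\<^sub>R ?P d) ?s)" .
    \<comment> \<open>The first component forces \<open>P = 0\<close>; the Christoffel correction
      then vanishes and the second component reads \<open>Q = 0\<close>.\<close>
    have zero_iff: "(c *\<^sub>R P, Q - christoffel A g d ?y (c *\<^sub>R P) ?s) = 0 \<longleftrightarrow> P = 0 \<and> Q = 0" if "c \<noteq> 0" for c P Q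
      using that by (auto simp: zero_prod_def C.G_simps(9)[OF y])
    show ?thesis
      unfolding \<tau> by (rule zero_iff) (use C.om_pos[OF y, of ?s] in simp)
  qed
  \<comment> \<open>Components in charts not around the point are 0 by convention, and these must be
    included when functions are compared.\<close>
  have outside: "?\<tau> k = 0" if "k \<notin> tangent_chart A ` charts_at A x" for k
    unfolding tension_field_def metric_trace_onb sum_fun_apply nabla_differential_def fun_diff_def
    using that by (simp add: cov_deriv_along_def differential_def sect_charts[OF x])
  have "?\<tau> = 0 \<longleftrightarrow> (\<forall>d\<in>charts_at A x. ?\<tau> (tangent_chart A d) = 0)"
  proof
    assume "\<forall>d\<in>charts_at A x. ?\<tau> (tangent_chart A d) = 0"
    then have "?\<tau> k = 0" for k
      by (cases "k \<in> tangent_chart A ` charts_at A x") (auto simp: outside simp del: split_paired_All split_paired_Ex)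
    then show "?\<tau> = 0" by (simp add: fun_eq_iff)
  qed simp
  then show ?thesis using chart by simp
qed

text \<open>The gradient has coefficients \<open>\<langle>K i, \<sigma>\<rangle>\<close> in the
  chosen basis. So the derivative of \<open>\<sigma>\<close> along it is the sum of
  \<open>\<langle>K i, \<sigma>\<rangle> K i\<close> and its squared norm is the sum of
  \<open>\<langle>K i, \<sigma>\<rangle>\<close> squared, exactly the sums that occur in the trace
  of \<open>N\<close>.\<close>

lemma vertical_equation_iff:
  assumes x: "x \<in> points A"
  defines "r \<equiv> g x (\<sigma> x) (\<sigma> x)" and "X \<equiv> grad_half_norm_sq A g \<sigma> x"
  shows "rough_laplacian A g \<sigma> x + (2 * p * omega g x (\<sigma> x)) *\<^sub>R cov_deriv A g \<sigma> x X =
      ((p * omega g x (\<sigma> x) + q) / (1 + q * r) * norm_sq_nabla A g \<sigma> x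
        + p * q * omega g x (\<sigma> x) / (1 + q * r) * g x X X) *\<^sub>R \<sigma> x \<longleftrightarrow>
    (\<forall>d\<in>charts_at A x.
      (\<Sum>i = 1..DIM('a). second_cov_deriv A g \<sigma> x (onb x i) (onb x i) d
        + N_at d (cmap d x) (\<sigma> x d) (cov_deriv A g \<sigma> x (onb x i) d) (cov_deriv A g \<sigma> x (onb x i) d)) = 0)"
    (is "?L = ?R \<longleftrightarrow> _")
proof -
  let ?I = "{1..DIM('a)}"
  note \<sigma>x = smooth_field_tangent[OF \<sigma> x]
  let ?Q = "\<lambda>d. \<Sum>i\<in>?I. second_cov_deriv A g \<sigma> x (onb x i) (onb x i) d
        + N_at d (cmap d x) (\<sigma> x d) (cov_deriv A g \<sigma> x (onb x i) d) (cov_deriv A g \<sigma> x (onb x i) d)"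
  have chart: "?L d = ?R d \<longleftrightarrow> ?Q d = 0" if d: "d \<in> charts_at A x" for d
  proof -
    interpret C: cheeger_gromoll_chart "cmap d ` cdom d" "metric_comp A g d" "christoffel A g d" p q
      by (rule chart_cg[OF charts_atD(1)[OF d]])
    let ?y = "cmap d x" and ?s = "\<sigma> x d" and ?b = "\<lambda>i. onb x i d" and ?m = "metric_comp A g d (cmap d x)"
    define K where "K i = cov_deriv A g \<sigma> x (onb x i) d" for i
    have y: "?y \<in> cmap d ` cdom d" using charts_atD(2)[OF d] by blast
    have KT: "cov_deriv A g \<sigma> x (onb x i) \<in> tangent_space A x" if "i \<in> ?I" for i
      by (rule cov_deriv_tangent[OF \<sigma> mopen_points x onb_tangent[OF x that]])
    have gK: "g x (cov_deriv A g \<sigma> x (onb x i)) (\<sigma> x) = ?m (K i) ?s" if "i \<in> ?I" for i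
      by (simp add: metric_chart[OF d KT[OF that] \<sigma>x] K_def)
    have XT: "X \<in> tangent_space A x"
      unfolding X_def gradient_half_norm_sq[OF \<sigma> x] by (intro tangent_sum tangent_scaleR x onb_tangent)
    have Xd: "X d = (\<Sum>i\<in>?I. ?m (K i) ?s *\<^sub>R ?b i)"
      unfolding X_def gradient_half_norm_sq[OF \<sigma> x] sum_fun_apply scaleR_fun_def
      by (intro sum.cong refl) (simp add: gK)
    have lin: "linear (\<lambda>u. D1 d \<sigma> ?y u + christoffel A g d ?y u ?s)"
      using has_derivative_linear[OF has_derivative_field_rep[OF \<sigma> x d]] C.G_bilinear[OF y]
      by (intro linear_compose_add) (auto simp: bilinear_def)
    have Kc: "cov_deriv A g \<sigma> x u d = D1 d \<sigma> ?y (u d) + christoffel A g d ?y (u d) ?s" if "u \<in> tangent_space A x" for u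
      by (rule cov_deriv_smooth[OF \<sigma> x d that])
    have cX: "cov_deriv A g \<sigma> x X d = (\<Sum>i\<in>?I. ?m (K i) ?s *\<^sub>R K i)"
    proof -
      have "cov_deriv A g \<sigma> x X d = (\<Sum>i\<in>?I. ?m (K i) ?s *\<^sub>R (D1 d \<sigma> ?y (?b i) + christoffel A g d ?y (?b i) ?s))"
        unfolding Kc[OF XT] Xd by (simp only: linear_sum[OF lin] linear_scale[OF lin])
      then show ?thesis by (simp add: K_def Kc onb_tangent[OF x])
    qed
    have gX: "g x X X = (\<Sum>i\<in>?I. ?m (K i) ?s * ?m (K i) ?s)"
    proof -
      have "ortho_at d ?y ?b" by (rule ortho_chart[OF d onb[OF x]])
      then have "?m (?b i) (?b j) = (if i = j then 1 else 0)" if "i \<in> ?I" "j \<in> ?I" for i j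
        using that by (simp add: C.ortho_def)
      note on = this
      have "?m (X d) (?b j) = ?m (K j) ?s" if j: "j \<in> ?I" for j
      proof -
        have "?m (X d) (?b j) = (\<Sum>i\<in>?I. ?m (K i) ?s * ?m (?b i) (?b j))"
          unfolding Xd by (simp add: C.m_simps[OF y])
        also have "\<dots> = (\<Sum>i\<in>?I. if i = j then ?m (K i) ?s else 0)"
          by (intro sum.cong refl) (simp add: on[OF _ j])
        finally show ?thesis using j by simp
      qed
      then have "?m (X d) (X d) = (\<Sum>i\<in>?I. ?m (K i) ?s * ?m (K i) ?s)"
        by (subst (2) Xd) (simp add: C.m_simps[OF y])
      then show ?thesis by (simp add: metric_chart[OF d XT XT])
    qed
    have nn: "norm_sq_nabla A g \<sigma> x = (\<Sum>i\<in>?I. ?m (K i) (K i))"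
      unfolding norm_sq_nabla_def metric_trace_onb
      by (intro sum.cong refl) (simp add: metric_chart[OF d KT KT] K_def)
    have rl: "rough_laplacian A g \<sigma> x d = - (\<Sum>i\<in>?I. second_cov_deriv A g \<sigma> x (onb x i) (onb x i) d)"
      by (simp add: rough_laplacian_def metric_trace_onb sum_fun_apply fun_Compl_def)
    have rr: "r = ?m ?s ?s" by (simp add: r_def metric_chart[OF d \<sigma>x \<sigma>x])
    note om = omega_chart[OF d \<sigma>x]
    \<comment> \<open>With equal arguments the two summands in the first term of \<open>N\<close>
      coincide, hence the factor 2 in the equation.\<close>
    have N: "(\<Sum>i\<in>?I. C.N ?y ?s (K i) (K i)) = - (2 * p * C.om ?y ?s) *\<^sub>R (\<Sum>i\<in>?I. ?m (K i) ?s *\<^sub>R K i)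
      + ((p * C.om ?y ?s + q) / (1 + q * r) * (\<Sum>i\<in>?I. ?m (K i) (K i))
        + p * q * C.om ?y ?s / (1 + q * r) * (\<Sum>i\<in>?I. ?m (K i) ?s * ?m (K i) ?s)) *\<^sub>R ?s"
    proof -
      have "C.N ?y ?s (K i) (K i) = - (2 * p * C.om ?y ?s) *\<^sub>R (?m (K i) ?s *\<^sub>R K i)
        + ((p * C.om ?y ?s + q) / (1 + q * r) * ?m (K i) (K i)
        + p * q * C.om ?y ?s / (1 + q * r) * (?m (K i) ?s * ?m (K i) ?s)) *\<^sub>R ?s" for i
        unfolding C.N_def rr
        by (simp add: field_simps flip: scaleR_2) (simp add: add_divide_distrib scaleR_left_distrib)
      then show ?thesis
        by (simp add: sum.distrib sum_subtractf sum_negf scaleR_right.sum sum_distrib_left scaleR_left.sum scaleR_left_distrib)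
    qed
    have "?L d = ?R d \<longleftrightarrow> - (\<Sum>i\<in>?I. second_cov_deriv A g \<sigma> x (onb x i) (onb x i) d)
        + (2 * p * C.om ?y ?s) *\<^sub>R (\<Sum>i\<in>?I. ?m (K i) ?s *\<^sub>R K i)
      = ((p * C.om ?y ?s + q) / (1 + q * r) * (\<Sum>i\<in>?I. ?m (K i) (K i))
        + p * q * C.om ?y ?s / (1 + q * r) * (\<Sum>i\<in>?I. ?m (K i) ?s * ?m (K i) ?s)) *\<^sub>R ?s"
      by (simp add: scaleR_fun_def rl cX gX nn om)
    also have "\<dots> \<longleftrightarrow> (\<Sum>i\<in>?I. second_cov_deriv A g \<sigma> x (onb x i) (onb x i) d) + (\<Sum>i\<in>?I. C.N ?y ?s (K i) (K i)) = 0"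
    proof -
      have "- a + c *\<^sub>R b = e \<longleftrightarrow> a + (- c *\<^sub>R b + e) = 0" for a b e :: 'a and c
        by (auto simp: algebra_simps)
      then show ?thesis unfolding N by blast
    qed
    finally show ?thesis by (simp add: sum.distrib K_def)
  qed
  have "?L d = ?R d" if "d \<notin> charts_at A x" for d
    using that tangent_outside[OF \<sigma>x that]
    by (simp add: scaleR_fun_def rough_laplacian_def metric_trace_onb sum_fun_apply fun_Compl_def second_cov_deriv_def
        cov_deriv_def cov_deriv_along_def)
  then have "?L = ?R \<longleftrightarrow> (\<forall>d\<in>charts_at A x. ?L d = ?R d)" unfolding fun_eq_iff by blast
  then show ?thesis using chart by simp
qed

text \<open>A global orthonormal frame need not exist, so the condition ranges over all local ones.
  Each point has one nearby, and the trace at a point is the same for every frame.\<close>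

lemma horizontal_equation_iff:
  "(\<forall>W e. orthonormal_frame A g W e \<longrightarrow>
      (\<forall>x\<in>W. (\<Sum>i = 1..DIM('a). curvature A g \<sigma> (nabla A g (e i) \<sigma>) (e i) x) = 0)) \<longleftrightarrow>
   (\<forall>x\<in>points A. \<forall>d\<in>charts_at A x.
      (\<Sum>i = 1..DIM('a). Rm d (cmap d x) (\<sigma> x d) (cov_deriv A g \<sigma> x (onb x i) d) (onb x i d)) = 0)"
proof (intro iffI allI impI ballI)
  fix x d assume *: "\<forall>W e. orthonormal_frame A g W e \<longrightarrow>
      (\<forall>x\<in>W. (\<Sum>i = 1..DIM('a). curvature A g \<sigma> (nabla A g (e i) \<sigma>) (e i) x) = 0)"
    and x: "x \<in> points A" and d: "d \<in> charts_at A x"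
  obtain W e where We: "x \<in> W" "orthonormal_frame A g W e" using orthonormal_frame_exists[OF x] by blast
  with * have "(\<Sum>i = 1..DIM('a). curvature A g \<sigma> (nabla A g (e i) \<sigma>) (e i) x) = 0" by blast
  then show "(\<Sum>i = 1..DIM('a). Rm d (cmap d x) (\<sigma> x d) (cov_deriv A g \<sigma> x (onb x i) d) (onb x i d)) = 0"
    using curvature_trace_frame[OF \<sigma> We(2,1) d] by simp
next
  fix W e x assume *: "\<forall>x\<in>points A. \<forall>d\<in>charts_at A x.
      (\<Sum>i = 1..DIM('a). Rm d (cmap d x) (\<sigma> x d) (cov_deriv A g \<sigma> x (onb x i) d) (onb x i d)) = 0"
    and e: "orthonormal_frame A g W e" and x: "x \<in> W"
  show "(\<Sum>i = 1..DIM('a). curvature A g \<sigma> (nabla A g (e i) \<sigma>) (e i) x) = 0"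
  proof
    fix d
    show "(\<Sum>i = 1..DIM('a). curvature A g \<sigma> (nabla A g (e i) \<sigma>) (e i) x) d = 0 d"
    proof (cases "d \<in> charts_at A x")
      case True
      then show ?thesis using * points_charts[OF True] curvature_trace_frame[OF \<sigma> e x True] by simp
    qed (simp add: sum_fun_apply curvature_outside)
  qed
qed

end

theorem proposition5p2:
  fixes A :: "('m, 'a::euclidean_space) chart set"
    and g :: "('m, 'a) metric"
    and p q :: real
    and \<sigma> :: "'m \<Rightarrow> ('m, 'a) tvec"
  assumes "riemannian_manifold A g"
    and "q \<ge> 0"
    and "smooth_field A (points A) \<sigma>"
  shows "harmonic_map A g (tangent_bundle A) (cheeger_gromoll A g p q) (\<lambda>x. (x, \<sigma> x)) \<longleftrightarrow>
    (\<forall>W e. orthonormal_frame A g W e \<longrightarrow>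
       (\<forall>x\<in>W. (\<Sum>i = 1..DIM('a). curvature A g \<sigma> (nabla A g (e i) \<sigma>) (e i) x) = 0)) \<and>
    (\<forall>x\<in>points A.
       rough_laplacian A g \<sigma> x
         + (2 * p * omega g x (\<sigma> x)) *\<^sub>R cov_deriv A g \<sigma> x (grad_half_norm_sq A g \<sigma> x)
       = ((p * omega g x (\<sigma> x) + q) / (1 + q * g x (\<sigma> x) (\<sigma> x)) * norm_sq_nabla A g \<sigma> x
          + p * q * omega g x (\<sigma> x) / (1 + q * g x (\<sigma> x) (\<sigma> x))
              * g x (grad_half_norm_sq A g \<sigma> x) (grad_half_norm_sq A g \<sigma> x)) *\<^sub>R \<sigma> x)"
proof -
  interpret cheeger_gromoll_bundle A g p q \<sigma>
  proof
    show "smooth_atlas A" using assms(1) by (simp add: riemannian_manifold_def smooth_manifold_def)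
  qed (fact assms)+
  show ?thesis
    unfolding harmonic_map_def horizontal_equation_iff
    using smooth_map_sect
    by (simp only: tension_zero_iff vertical_equation_iff cong: ball_cong) blast
qed

end
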